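(* Let $Q\subset\mathbb{CP}^3$ be the preimage of $S^3\subset\mathbb{HP}^1\cong S^4$ under the twistor projection, with the CR structure induced as a real hypersurface of $\mathbb{CP}^3$, and let $SS^3$ be the tangent sphere bundle of the conformal $3$-sphere with its canonical (LeBrun) CR structure. Let $N$ be the oriented unit normal field of $S^3\subset\mathbb{HP}^1$. Then the bijection $$Q\to SS^3,\qquad \mathcal J\in Q_l\mapsto[\mathcal J(N_l)]\in S_lS^3\quad(l\in S^3),$$ is an isomorphism of CR manifolds; here a point of $Q$ over $l\in S^3$ is regarded as an almost complex Hermitian structure $\mathcal J\in\operatorname{End}(T_l\mathbb{HP}^1)$.
   Context: CR structures. A CR structure (of hypersurface type) on a $(2n-1)$-manifold is given by its Levi distribution $H\subset TM$ of real rank $2n-2$ with complex structure $\mathcal J\colon H\to H$ (satisfying integrability conditions). A real hypersurface $M$ of a complex manifold has $H=TM\cap iTM$ with the restricted complex structure. A CR isomorphism is a diffeomorphism whose differential maps Levi distribution to Levi distribution complex linearly. Tangent sphere bundle. For an oriented conformal $3$-manifold $(M,[g])$, $p\colon SM\to M$ is the bundle of oriented tangent lines $[v]$ (nonzero tangent vectors modulo positive multiples). Its canonical CR structure has Levi distribution $H_{[v]}=\{X\in T_{[v]}SM : d_{[v]}p(X)\perp v\}$. The complex structure is defined as follows: choose $g\in[g]$, a representative $v$ with $g(v,v)=1$, and put $V=v^\perp\subset T_{p([v])}M$ with complex structure $w\mapsto v\times w$ (cross product of $g$ and the orientation). Using the Levi-Civita connection of $g$, $H_{[v]}$ splits into its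 vertical part, canonically identified with $V$, and its horizontal part, which is identified with $V$ by $dp$; the complex structure on $H_{[v]}$ is $w\mapsto v\times w$ on both summands. It does not depend on the choice of $g\in[g]$. Twistor projection. Regard $\mathbb H^2$ as a right $\mathbb H$-vector space and identify $\mathbb H^2\cong\mathbb C^4$ via right multiplication by $i$, i.e. $(z_1+jz_2,z_3+jz_4)\leftrightarrow(z_1,\dots,z_4)$. The twistor projection is $\mathbb{CP}^3\to\mathbb{HP}^1\cong S^4$, $e\mapsto l=e\mathbb H=e\oplus ej$. One has $T_l\mathbb{HP}^1\cong\operatorname{Hom}_{\mathbb H}(l,\mathbb H^2/l)$. A point $e$ over $l$ determines the quaternionic linear map $\mathcal J_e\in\operatorname{End}_{\mathbb H}(l)$ with $\mathcal J_e^2=-1$ that is right multiplication by $i$ on $e$; it gives the almost complex Hermitian structure $B\mapsto B\circ\mathcal J_e$ on $T_l\mathbb{HP}^1$, and this identifies $\mathbb{CP}^3$ with the bundle of such structures on $S^4$. The sphere $S^3$. $S^3\subset\mathbb{HP}^1$ is the space of isotropic lines of $\langle v,w\rangle=\bar v_1w_1-\bar v_2w_2$; it is the image of the unit sphere $\{x\in\mathbb H:|x|=1\}$ under $x\mapsto[x:1]$, and has the round conformal structure. $N$ is the unit normal that at $x$ points in the direction of the radial vector $x$. Thus $Q=\{[z]\in\mathbb{CP}^3:|z_1|^2+|z_2|^2-|z_3|^2-|z_4|^2=0\}$. Orientations: $\mathbb{HP}^1$ has the orientation in which bases of the form $(X,\mathcal JX,Y,\mathcal JY)$, for the structures $\mathcal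 J$ above, are positive, and $S^3$ has the orientation for which $(N,X_1,X_2,X_3)$ is positive on $\mathbb{HP}^1$ whenever $(X_1,X_2,X_3)$ is positive on $S^3$. (Equivalently, the frame $(xi,xj,xk)$ of $T_xS^3$ is negatively oriented.) *)

theory Defs
  imports "HOL-Analysis.Analysis"
begin

section \<open>Smooth maps\<close>

primrec C_k_on :: "nat \<Rightarrow> 'a::real_normed_vector set \<Rightarrow> ('a \<Rightarrow> 'b::real_normed_vector) \<Rightarrow> bool"
  where
  "C_k_on 0 W f \<longleftrightarrow> continuous_on W f"
| "C_k_on (Suc k) W f \<longleftrightarrow>
     (\<forall>x\<in>W. f differentiable (at x)) \<and> (\<forall>v. C_k_on k W (\<lambda>x. frechet_derivative f (at x) v))"

definition C_inf_on :: "'a::real_normed_vector set \<Rightarrow> ('a \<Rightarrow> 'b::real_normed_vector) \<Rightarrow> bool"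
  where "C_inf_on W f \<longleftrightarrow> (\<forall>k. C_k_on k W f)"  \<comment> \<open>used for open \<open>W\<close> only\<close>

definition smooth_on :: "'a::real_normed_vector set \<Rightarrow> ('a \<Rightarrow> 'b::real_normed_vector) \<Rightarrow> bool"
  where "smooth_on M f \<longleftrightarrow>
    (\<forall>x\<in>M. \<exists>W h. open W \<and> x \<in> W \<and> C_inf_on W h \<and> (\<forall>y\<in>M \<inter> W. f y = h y))"

text \<open>
  Manifolds are handled as in the books of Milnor and of Guillemin and Pollack: a chart
  \<open>(U, \<phi>)\<close> maps \<open>U\<close> injectively onto a submanifold of a Euclidean space, not necessarily
  onto an open subset, and a map between such submanifolds is smooth if it has local smooth
  extensions.  A submanifold \<open>P\<close> of a manifold with atlas \<open>A\<close> is the pair \<open>(A, P)\<close>.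
\<close>

type_synonym ('p, 'e) chart = "'p set \<times> ('p \<Rightarrow> 'e)"

definition smooth_map ::
  "('p, 'e::real_normed_vector) chart set \<Rightarrow> 'p set \<Rightarrow>
   ('q, 'f::real_normed_vector) chart set \<Rightarrow> 'q set \<Rightarrow> ('p \<Rightarrow> 'q) \<Rightarrow> bool"
  where "smooth_map A P B P' F \<longleftrightarrow> F ` P \<subseteq> P' \<and>
    (\<forall>p\<in>P. \<exists>(U, \<phi>)\<in>A. \<exists>(V, \<psi>)\<in>B. \<exists>W h.
       p \<in> U \<and> F p \<in> V \<and> open W \<and> \<phi> p \<in> W \<and> C_inf_on W h \<and>
       (\<forall>q\<in>U \<inter> P. \<phi> q \<in> W \<longrightarrow> F q \<in> V \<and> \<psi> (F q) = h (\<phi> q)))"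

definition smooth_arc :: "'p set \<Rightarrow> ('p \<Rightarrow> 'e::real_normed_vector) \<Rightarrow> (real \<Rightarrow> 'p) \<Rightarrow> bool"
  where "smooth_arc U \<phi> \<gamma> \<longleftrightarrow>
    (\<exists>\<epsilon>>0. (\<forall>t\<in>{-\<epsilon><..<\<epsilon>}. \<gamma> t \<in> U) \<and> C_inf_on {-\<epsilon><..<\<epsilon>} (\<phi> \<circ> \<gamma>))"

text \<open>
  A tangent vector is given by its coordinate vectors in all charts around its base point
  (and by \<open>0\<close> at the other arguments).
\<close>

type_synonym ('p, 'e) tvec = "('p, 'e) chart \<Rightarrow> 'e"

definition velocity :: "('p, 'e::real_normed_vector) chart set \<Rightarrow> (real \<Rightarrow> 'p) \<Rightarrow> ('p, 'e) tvec"
  where "velocity A \<gamma> = (\<lambda>c.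
    if c \<in> A \<and> \<gamma> 0 \<in> fst c then vector_derivative (snd c \<circ> \<gamma>) (at 0) else 0)"

definition curves_at ::
  "('p, 'e::real_normed_vector) chart set \<Rightarrow> 'p set \<Rightarrow> 'p \<Rightarrow> (real \<Rightarrow> 'p) set"
  where "curves_at A P p = {\<gamma>. \<gamma> 0 = p \<and> (\<exists>(U, \<phi>)\<in>A. smooth_arc (U \<inter> P) \<phi> \<gamma>)}"

definition tangent ::
  "('p, 'e::real_normed_vector) chart set \<Rightarrow> 'p set \<Rightarrow> 'p \<Rightarrow> ('p, 'e) tvec set"
  where "tangent A P p = velocity A ` curves_at A P p"

definition differential ::
  "('p, 'e::real_normed_vector) chart set \<Rightarrow> 'p set \<Rightarrow> ('q, 'f::real_normed_vector) chart set \<Rightarrow>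
   ('p \<Rightarrow> 'q) \<Rightarrow> 'p \<Rightarrow> ('p, 'e) tvec \<Rightarrow> ('q, 'f) tvec"
  where "differential A P B F p X =
    (THE Y. \<exists>\<gamma>\<in>curves_at A P p. velocity A \<gamma> = X \<and> Y = velocity B (F \<circ> \<gamma>))"


section \<open>CR structures\<close>

record ('p, 'e) cr_structure =
  points :: "'p set"
  atlas :: "('p, 'e) chart set"
  levi :: "'p \<Rightarrow> ('p, 'e) tvec set"
  cstr :: "'p \<Rightarrow> ('p, 'e) tvec \<Rightarrow> ('p, 'e) tvec"

definition cr_isomorphism ::
  "('p, 'e::real_normed_vector) cr_structure \<Rightarrow> ('q, 'f::real_normed_vector) cr_structure \<Rightarrow>
   ('p \<Rightarrow> 'q) \<Rightarrow> bool"
  where "cr_isomorphism C D F \<longleftrightarrow>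
    bij_betw F (points C) (points D) \<and>
    smooth_map (atlas C) (points C) (atlas D) (points D) F \<and>
    smooth_map (atlas D) (points D) (atlas C) (points C) (inv_into (points C) F) \<and>
    (\<forall>p\<in>points C. let dF = differential (atlas C) (points C) (atlas D) F p in
       dF ` levi C p = levi D (F p) \<and>
       (\<forall>X\<in>levi C p. \<forall>Y\<in>levi C p. dF (\<lambda>c. X c + Y c) = (\<lambda>c. dF X c + dF Y c)) \<and>
       (\<forall>X\<in>levi C p. \<forall>r. dF (\<lambda>c. r *\<^sub>R X c) = (\<lambda>c. r *\<^sub>R dF X c)) \<and>
       (\<forall>X\<in>levi C p. dF (cstr C p X) = cstr D (F p) (dF X)))"


section \<open>Riemannian geometry of submanifolds of Euclidean space\<close>

definition arcs_at :: "'a::euclidean_space set \<Rightarrow> 'a \<Rightarrow> 'a \<Rightarrow> (real \<Rightarrow> 'a) set"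
  where "arcs_at M x w =
    {\<gamma>. smooth_arc M (\<lambda>y. y) \<gamma> \<and> \<gamma> 0 = x \<and> (\<gamma> has_vector_derivative w) (at 0)}"

definition tspace :: "'a::euclidean_space set \<Rightarrow> 'a \<Rightarrow> 'a set"
  where "tspace M x = {w. arcs_at M x w \<noteq> {}}"

definition ddir ::
  "'a::euclidean_space set \<Rightarrow> ('a \<Rightarrow> 'b::real_normed_vector) \<Rightarrow> 'a \<Rightarrow> 'a \<Rightarrow> 'b"
  where "ddir M f x w =
    (THE d. \<forall>\<gamma>\<in>arcs_at M x w. ((\<lambda>t. f (\<gamma> t)) has_vector_derivative d) (at 0))"

definition vector_field :: "'a::euclidean_space set \<Rightarrow> ('a \<Rightarrow> 'a) \<Rightarrow> bool"
  where "vector_field M X \<longleftrightarrow> smooth_on M X \<and> (\<forall>x\<in>M. X x \<in> tspace M x)"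

type_synonym 'a metric_tensor = "'a \<Rightarrow> 'a \<Rightarrow> 'a \<Rightarrow> real"

text \<open>For a connection \<open>D\<close>, the vector \<open>D x u Y\<close> is \<open>\<nabla>\<^sub>u Y\<close> for \<open>u\<close> tangent at \<open>x\<close>.\<close>

type_synonym 'a connection = "'a \<Rightarrow> 'a \<Rightarrow> ('a \<Rightarrow> 'a) \<Rightarrow> 'a"

definition affine_connection :: "'a::euclidean_space set \<Rightarrow> 'a connection \<Rightarrow> bool"
  where "affine_connection M D \<longleftrightarrow>
    (\<forall>X Y. vector_field M X \<longrightarrow> vector_field M Y \<longrightarrow> vector_field M (\<lambda>x. D x (X x) Y)) \<and>
    (\<forall>x\<in>M. \<forall>u\<in>tspace M x. \<forall>Y. vector_field M Y \<longrightarrow>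
       (\<forall>v\<in>tspace M x. D x (u + v) Y = D x u Y + D x v Y) \<and>
       (\<forall>r. D x (r *\<^sub>R u) Y = r *\<^sub>R D x u Y) \<and>
       (\<forall>Z. vector_field M Z \<longrightarrow> D x u (\<lambda>y. Y y + Z y) = D x u Y + D x u Z) \<and>
       (\<forall>f :: 'a \<Rightarrow> real. smooth_on M f \<longrightarrow>
          D x u (\<lambda>y. f y *\<^sub>R Y y) = ddir M f x u *\<^sub>R Y x + f x *\<^sub>R D x u Y))"

text \<open>
  The Lie bracket of vector fields \<open>X\<close>, \<open>Y\<close> on a submanifold of a Euclidean space is the
  difference of the derivatives of the vector-valued functions \<open>Y\<close> along \<open>X\<close> and \<open>X\<close> along \<open>Y\<close>.
\<close>

definition lie_bracket ::
  "'a::euclidean_space set \<Rightarrow> ('a \<Rightarrow> 'a) \<Rightarrow> ('a \<Rightarrow> 'a) \<Rightarrow> 'a \<Rightarrow> 'a"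
  where "lie_bracket M X Y x = ddir M Y x (X x) - ddir M X x (Y x)"

definition is_levi_civita ::
  "'a::euclidean_space set \<Rightarrow> 'a metric_tensor \<Rightarrow> 'a connection \<Rightarrow> bool"
  where "is_levi_civita M g D \<longleftrightarrow> affine_connection M D \<and>
    (\<forall>X Y. vector_field M X \<longrightarrow> vector_field M Y \<longrightarrow>
       (\<forall>x\<in>M. D x (X x) Y - D x (Y x) X = lie_bracket M X Y x)) \<and>
    (\<forall>Y Z. vector_field M Y \<longrightarrow> vector_field M Z \<longrightarrow>
       (\<forall>x\<in>M. \<forall>u\<in>tspace M x.
          ddir M (\<lambda>y. g y (Y y) (Z y)) x u = g x (D x u Y) (Z x) + g x (Y x) (D x u Z)))"

text \<open>Unique on tangent vectors and vector fields; its values elsewhere are irrelevant.\<close>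

definition levi_civita :: "'a::euclidean_space set \<Rightarrow> 'a metric_tensor \<Rightarrow> 'a connection"
  where "levi_civita M g = (SOME D. is_levi_civita M g D)"

definition conformal_class ::
  "'a::euclidean_space set \<Rightarrow> 'a metric_tensor \<Rightarrow> 'a metric_tensor set"
  where "conformal_class M g\<^sub>0 = {g. \<exists>f. smooth_on M f \<and> (\<forall>x\<in>M. f x > 0) \<and>
    (\<forall>x\<in>M. \<forall>u\<in>tspace M x. \<forall>v\<in>tspace M x. g x u v = f x * g\<^sub>0 x u v)}"

text \<open>An orientation of a 3-manifold is given by its positive frames \<open>(u, v, w)\<close> at \<open>x\<close>.\<close>

type_synonym 'a orientation3 = "'a \<Rightarrow> 'a \<Rightarrow> 'a \<Rightarrow> 'a \<Rightarrow> bool"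

definition cross_product ::
  "'a::euclidean_space set \<Rightarrow> 'a metric_tensor \<Rightarrow> 'a orientation3 \<Rightarrow> 'a \<Rightarrow> 'a \<Rightarrow> 'a \<Rightarrow> 'a"
  where "cross_product M g pos x v w = (THE u. u \<in> tspace M x \<and> g x u v = 0 \<and> g x u w = 0 \<and>
    g x u u = g x v v * g x w w - (g x v w)\<^sup>2 \<and> (u \<noteq> 0 \<longrightarrow> pos x v w u))"


section \<open>The canonical CR structure of the tangent sphere bundle\<close>

definition ray :: "'a::real_vector \<Rightarrow> 'a set"
  where "ray v = {r *\<^sub>R v | r. r > 0}"

definition sphere_bundle :: "'a::euclidean_space set \<Rightarrow> ('a \<times> 'a set) set"
  where "sphere_bundle M = {(x, ray v) | x v. x \<in> M \<and> v \<in> tspace M x \<and> v \<noteq> 0}"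

definition unit_rep :: "'a::euclidean_space metric_tensor \<Rightarrow> 'a \<times> 'a set \<Rightarrow> 'a \<times> 'a"
  where "unit_rep g p = (fst p, THE v. v \<in> snd p \<and> g (fst p) v v = 1)"

text \<open>The smooth structure is that of the unit tangent bundle of \<open>g\<close>, a submanifold of \<open>'a \<times> 'a\<close>.\<close>

definition unit_chart ::
  "'a::euclidean_space set \<Rightarrow> 'a metric_tensor \<Rightarrow> ('a \<times> 'a set, 'a \<times> 'a) chart"
  where "unit_chart M g = (sphere_bundle M, unit_rep g)"

text \<open>
  If a vector field \<open>Y\<close> extends \<open>v\<close>, then the horizontal lift of \<open>w\<close> to \<open>v\<close> is the difference of
  the derivative \<open>(w, dY(w))\<close> of the section \<open>Y\<close> and the vertical vector \<open>(0, \<nabla>\<^sub>w Y)\<close>.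
  It does not depend on \<open>Y\<close>, and it is tangent to the unit tangent bundle if \<open>v\<close> has length 1.
\<close>

definition horizontal_lift ::
  "'a::euclidean_space set \<Rightarrow> 'a metric_tensor \<Rightarrow> 'a \<Rightarrow> 'a \<Rightarrow> 'a \<Rightarrow> 'a \<times> 'a"
  where "horizontal_lift M g x v w =
    (let Y = (SOME Y. vector_field M Y \<and> Y x = v)
     in (w, ddir M Y x w) - (0, levi_civita M g x w Y))"

definition sphere_bundle_J ::
  "'a::euclidean_space set \<Rightarrow> 'a metric_tensor \<Rightarrow> 'a orientation3 \<Rightarrow> 'a \<times> 'a \<Rightarrow> 'a \<times> 'a \<Rightarrow> 'a \<times> 'a"
  where "sphere_bundle_J M g pos = (\<lambda>(x, v) \<xi>.
    let w = fst \<xi>;                                   \<comment> \<open>horizontal part\<close>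
        u = snd (\<xi> - horizontal_lift M g x v w)      \<comment> \<open>vertical part\<close>
    in horizontal_lift M g x v (cross_product M g pos x v w)
       + (0, cross_product M g pos x v u))"

definition sphere_bundle_CR ::
  "'a::euclidean_space set \<Rightarrow> 'a metric_tensor \<Rightarrow> 'a orientation3 \<Rightarrow>
   ('a \<times> 'a set, 'a \<times> 'a) cr_structure"
  where "sphere_bundle_CR M g pos =
    \<lparr>points = sphere_bundle M,
     atlas = {unit_chart M g},
     levi = (\<lambda>p. {X \<in> tangent {unit_chart M g} (sphere_bundle M) p.
        g (fst p) (fst (X (unit_chart M g))) (snd (unit_rep g p)) = 0}),
     cstr = (\<lambda>p X c. if c = unit_chart M g
        then sphere_bundle_J M g pos (unit_rep g p) (X c) else 0)\<rparr>"


section \<open>Quaternions and the twistor projection\<close>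

text \<open>The pair \<open>(a, b)\<close> is the quaternion \<open>a + j b\<close>.\<close>

type_synonym quat = "complex \<times> complex"

type_synonym quat2 = "quat \<times> quat"

definition qmult :: "quat \<Rightarrow> quat \<Rightarrow> quat"  (infixl "*\<^sub>q" 70)
  where "p *\<^sub>q q =
    (fst p * fst q - cnj (snd p) * snd q, cnj (fst p) * snd q + snd p * fst q)"

definition qconj :: "quat \<Rightarrow> quat"
  where "qconj q = (cnj (fst q), - snd q)"

definition qone :: quat
  where "qone = (1, 0)"

definition rmult :: "quat2 \<Rightarrow> quat \<Rightarrow> quat2"  (infixl "*\<^sub>h" 70)
  where "\<psi> *\<^sub>h q = (fst \<psi> *\<^sub>q q, snd \<psi> *\<^sub>q q)"

definition rmult_i :: "quat2 \<Rightarrow> quat2"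
  where "rmult_i \<psi> = \<psi> *\<^sub>h (\<i>, 0)"

definition CP3 :: "quat2 set set"
  where "CP3 = {{\<psi> *\<^sub>h (c, 0) | c. c \<in> (UNIV :: complex set)} | \<psi>. \<psi> \<noteq> 0}"

definition HP1 :: "quat2 set set"
  where "HP1 = {{\<psi> *\<^sub>h q | q. q \<in> (UNIV :: quat set)} | \<psi>. \<psi> \<noteq> 0}"

definition twistor :: "quat2 set \<Rightarrow> quat2 set"
  where "twistor e = {\<psi> *\<^sub>h q | \<psi> q. \<psi> \<in> e}"

definition hform :: "quat2 \<Rightarrow> quat2 \<Rightarrow> quat"
  where "hform v w = qconj (fst v) *\<^sub>q fst w - qconj (snd v) *\<^sub>q snd w"

definition S3 :: "quat2 set set"
  where "S3 = {l \<in> HP1. \<forall>v\<in>l. \<forall>w\<in>l. hform v w = 0}"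

definition twistor_Q :: "quat2 set set"
  where "twistor_Q = {e \<in> CP3. twistor e \<in> S3}"

text \<open>
  The affine chart of \<open>CP3\<close> belonging to a coordinate \<open>k\<close> has its values in the affine
  hyperplane of vectors with \<open>k\<close>-coordinate 1.
\<close>

definition CP3_chart :: "(quat2 \<Rightarrow> complex) \<Rightarrow> (quat2 set, quat2) chart"
  where "CP3_chart k = ({e \<in> CP3. \<exists>z\<in>e. k z = 1}, \<lambda>e. THE z. z \<in> e \<and> k z = 1)"

definition CP3_atlas :: "(quat2 set, quat2) chart set"
  where "CP3_atlas = CP3_chart ` {fst \<circ> fst, snd \<circ> fst, fst \<circ> snd, snd \<circ> snd}"

text \<open>The charts are holomorphic, so that \<open>X \<mapsto> iX\<close> is multiplication by \<open>i\<close> in any of them.\<close>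

definition CP3_J :: "(quat2 set, quat2) tvec \<Rightarrow> (quat2 set, quat2) tvec"
  where "CP3_J X = (\<lambda>c. rmult_i (X c))"

definition Q_CR :: "(quat2 set, quat2) cr_structure"
  where "Q_CR =
    \<lparr>points = twistor_Q,
     atlas = CP3_atlas,
     levi = (\<lambda>e. tangent CP3_atlas twistor_Q e \<inter> CP3_J ` tangent CP3_atlas twistor_Q e),
     cstr = (\<lambda>e. CP3_J)\<rparr>"


section \<open>Points of the twistor space as almost complex structures\<close>

text \<open>
  The velocity of a curve \<open>\<gamma>\<close> of quaternionic lines, as an element of \<open>Hom(l, H\<^sup>2/l)\<close> for
  \<open>l = \<gamma> 0\<close>: the derivatives at \<open>0\<close> of the lifts \<open>s\<close> of \<open>\<gamma>\<close> with \<open>s 0 = \<psi>\<close> form a coset of \<open>l\<close>.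
\<close>

definition line_velocity :: "(real \<Rightarrow> quat2 set) \<Rightarrow> quat2 \<Rightarrow> quat2 set"
  where "line_velocity \<gamma> = (\<lambda>\<psi>\<in>\<gamma> 0.
    {\<phi>. \<exists>s. s 0 = \<psi> \<and> (\<forall>t. s t \<in> \<gamma> t) \<and> (s has_vector_derivative \<phi>) (at 0)})"

definition affine_point :: "quat \<Rightarrow> quat2 set"
  where "affine_point x = {(x, qone) *\<^sub>h q | q. q \<in> (UNIV :: quat set)}"

definition d_affine_point :: "quat \<Rightarrow> quat \<Rightarrow> quat2 \<Rightarrow> quat2 set"
  where "d_affine_point x X = line_velocity (\<lambda>t. affine_point (x + t *\<^sub>R X))"

definition line_J :: "quat2 set \<Rightarrow> quat2 \<Rightarrow> quat2"
  where "line_J e = (let l = twistor e in THE J. J \<in> l \<rightarrow>\<^sub>E l \<and>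
    (\<forall>\<psi>\<in>l. \<forall>\<phi>\<in>l. J (\<psi> + \<phi>) = J \<psi> + J \<phi>) \<and>
    (\<forall>\<psi>\<in>l. \<forall>q. J (\<psi> *\<^sub>h q) = J \<psi> *\<^sub>h q) \<and>
    (\<forall>\<psi>\<in>e. J \<psi> = rmult_i \<psi>))"

definition hom_J :: "quat2 set \<Rightarrow> (quat2 \<Rightarrow> quat2 set) \<Rightarrow> quat2 \<Rightarrow> quat2 set"
  where "hom_J e B = (\<lambda>\<psi>\<in>twistor e. B (line_J e \<psi>))"

text \<open>
  The almost complex structure given by a point \<open>e\<close> over \<open>[x:1]\<close>, where the tangent space of
  \<open>HP1\<close> at \<open>[x:1]\<close> is identified with the quaternions by the differential of \<open>x \<mapsto> [x:1]\<close>.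
\<close>

definition acs :: "quat2 set \<Rightarrow> quat \<Rightarrow> quat \<Rightarrow> quat"
  where "acs e x X = (THE Y. d_affine_point x Y = hom_J e (d_affine_point x X))"

text \<open>The 3-sphere of isotropic lines is identified with the unit sphere by \<open>x \<mapsto> [x:1]\<close>.\<close>

abbreviation unit_sphere :: "quat set"
  where "unit_sphere \<equiv> sphere 0 1"

definition round_metric :: "quat metric_tensor"
  where "round_metric x u v = u \<bullet> v"

text \<open>
  The radial vector; the factor that makes it a unit vector for a given metric of \<open>HP1\<close> is
  positive and does not affect the ray of \<open>J(N)\<close>.
\<close>

definition unit_normal :: "quat \<Rightarrow> quat"
  where "unit_normal x = x"

definition frame_det :: "quat \<Rightarrow> quat \<Rightarrow> quat \<Rightarrow> quat \<Rightarrow> real"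
  where "frame_det X1 X2 X3 X4 = (let coords = (\<lambda>q.
      vector [Re (fst q), Im (fst q), Re (snd q), Im (snd q)] :: real ^ 4)
    in det (vector [coords X1, coords X2, coords X3, coords X4] :: real ^ 4 ^ 4))"

text \<open>
  Orientation of \<open>HP1\<close> at \<open>[x:1]\<close>; the coordinates used in \<open>frame_det\<close> only serve to compare the
  given frame with a frame of the form \<open>(X, JX, Y, JY)\<close>.
\<close>

definition HP1_positive :: "quat \<Rightarrow> quat \<Rightarrow> quat \<Rightarrow> quat \<Rightarrow> quat \<Rightarrow> bool"
  where "HP1_positive x X1 X2 X3 X4 \<longleftrightarrow>
    (\<exists>e\<in>CP3. twistor e = affine_point x \<and>
      (\<exists>X Y. frame_det X (acs e x X) Y (acs e x Y) * frame_det X1 X2 X3 X4 > 0))"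

definition S3_orientation :: "quat orientation3"
  where "S3_orientation x X1 X2 X3 \<longleftrightarrow> HP1_positive x (unit_normal x) X1 X2 X3"

definition twistor_to_sphere_bundle :: "quat2 set \<Rightarrow> quat \<times> quat set"
  where "twistor_to_sphere_bundle e =
    (let x = (THE x. x \<in> unit_sphere \<and> affine_point x = twistor e)
     in (x, ray (acs e x (unit_normal x))))"

end

(*
  A point of Q is the complex line of some z = (z1, z2) with |z1| = |z2|.  Over the base
  point x = z1 z2^-1 its complex structure is right multiplication by p = z2 i z2^-1, so the
  map sends it to (x, [v]) with v = x p = z1 i z2^-1.  If z moves with velocity (a, b), then
  x' = (a - x b) z2^-1 and v' = (a i - v b) z2^-1; replacing (a, b) by (a i, b i) multiplies both by
  p on the right.  On the plane orthogonal to x and v this multiplication is the rotation by the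
  cross product with v, and for the round metric x' and v' are the horizontal and the vertical
  part on the Levi distribution.  In a conformal metric the correction terms of the
  Levi-Civita connection are compensated by the rescaling of v to unit length.  An explicit
  solution z of the equation p z2 = z2 i gives the smooth inverse.
*)

theory Submission
  imports Defs
begin

text \<open>All computations use homogeneous coordinates: a tangent vector of CP3 is given by
  \<open>z\<close> and \<open>\<zeta>\<close>, with \<open>\<zeta>\<close> taken modulo complex
  multiples of \<open>z\<close>, and a curve in Q is lifted to the cone |z1| = |z2|. Two real
  equations cut out the Levi distribution there, and they make x' and v' orthogonal to both x and v.

  For f times the round metric the unit vector is s v with s = f^(-1/2). Its derivative contains
  -(s/(2f)) df(x') v, which is also a term of the horizontal lift; the gradient term of the lift
  carries the factor <x', v> = 0; the last term, a multiple of df(v) x', is rotated by p along with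
  x' and cancels when the vector is put together again.

  The obstacle is choice: the connection and the extending field are picked by \<open>SOME\<close>,
  while differential, cross product and complex structures are definite descriptions. Hence the
  connection needs an explicit formula and a uniqueness proof, and each description needs its own
  uniqueness argument. Surjectivity onto the Levi distribution of the sphere bundle comes from
  pulling curves back along the smooth inverse.\<close>

section \<open>Calculus of smooth maps\<close>

lemma C_k_on_subset: "C_k_on k W f \<Longrightarrow> V \<subseteq> W \<Longrightarrow> C_k_on k V f"
  by (induction k arbitrary: f) (auto intro: continuous_on_subset)

lemma C_k_on_Suc_imp: "C_k_on (Suc k) W f \<Longrightarrow> C_k_on k W f"
proof (induction k arbitrary: f)
  case 0
  then show ?case
    by (auto intro!: continuous_at_imp_continuous_on differentiable_imp_continuous_within)
next
  case (Suc k)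
  then show ?case by (metis C_k_on.simps(2))
qed

lemma C_k_on_cong:
  assumes "open W" "\<And>x. x \<in> W \<Longrightarrow> f x = g x" "C_k_on k W f"
  shows "C_k_on k W g"
  using assms(2,3)
proof (induction k arbitrary: f g)
  case 0
  then show ?case using continuous_on_cong by (metis C_k_on.simps(1))
next
  case (Suc k)
  have D: "(g has_derivative frechet_derivative f (at x)) (at x)" if "x \<in> W" for x
    using that Suc.prems assms(1)
    by (metis C_k_on.simps(2) frechet_derivative_works has_derivative_transform_within_open)
  then have "frechet_derivative f (at x) = frechet_derivative g (at x)" if "x \<in> W" for x
    using that frechet_derivative_at by blast
  then have "C_k_on k W (\<lambda>x. frechet_derivative g (at x) v)" for v
    using Suc.prems(2) by (rule_tac Suc.IH[of "\<lambda>x. frechet_derivative f (at x) v"]) auto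
  then show ?case using D by (auto simp: differentiable_def)
qed

text \<open>\<open>C_k_on\<close> speaks of the chosen \<open>frechet_derivative\<close>; this rule
  lets an explicit formula take its place, so that inductions on \<open>k\<close> can close up on
  formulas.\<close>

lemma C_k_on_SucI:
  assumes "open W" "\<And>x. x \<in> W \<Longrightarrow> (f has_derivative f' x) (at x)"
    and "\<And>v. C_k_on k W (\<lambda>x. f' x v)"
  shows "C_k_on (Suc k) W f"
proof -
  have "frechet_derivative f (at x) = f' x" if "x \<in> W" for x
    using assms(2)[OF that] frechet_derivative_at by metis
  then have "C_k_on k W (\<lambda>x. frechet_derivative f (at x) v)" for v
    by (rule_tac C_k_on_cong[OF assms(1) _ assms(3)[of v]]) simp
  then show ?thesis using assms(2) by (auto simp: differentiable_def)
qed

lemma C_k_on_has_derivative: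
  assumes "C_k_on (Suc k) W f" "x \<in> W"
  shows "(f has_derivative frechet_derivative f (at x)) (at x)"
  using assms frechet_derivative_works by auto

lemma C_k_on_const: "open W \<Longrightarrow> C_k_on k W (\<lambda>x. c)"
proof (induction k arbitrary: c)
  case (Suc k)
  then show ?case by (intro C_k_on_SucI[where f'="\<lambda>x v. 0"]) auto
qed auto

lemma C_k_on_bounded_linear:
  assumes "bounded_linear f" "open W"
  shows "C_k_on k W f"
proof (cases k)
  case 0
  then show ?thesis using assms by (simp add: linear_continuous_on)
next
  case (Suc l)
  show ?thesis unfolding Suc
    by (rule C_k_on_SucI[where f'="\<lambda>x. f"])
      (use assms in \<open>auto intro: bounded_linear_imp_has_derivative C_k_on_const\<close>)
qed

lemma C_k_on_add:
  assumes "open W" "C_k_on k W f" "C_k_on k W g"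
  shows "C_k_on k W (\<lambda>x. f x + g x)"
  using assms(2,3)
proof (induction k arbitrary: f g)
  case 0
  then show ?case by (auto intro: continuous_on_add)
next
  case (Suc k)
  show ?case
    by (rule C_k_on_SucI[OF assms(1), where f'="\<lambda>x v. frechet_derivative f
        (at x) v + frechet_derivative g (at x) v"])
      (use Suc in \<open>auto intro!: has_derivative_add C_k_on_has_derivative\<close>)
qed

text \<open>The product rule yields a sum of bilinear terms again, so the induction closes once it
  ranges over all \<open>f\<close> and \<open>g\<close>. Scalar multiples, inner products and
  quaternion products are all instances.\<close>

lemma C_k_on_bilinear:
  assumes "bounded_bilinear B" "open W" "C_k_on k W f" "C_k_on k W g"
  shows "C_k_on k W (\<lambda>x. B (f x) (g x))"
  using assms(3,4)
proof (induction k arbitrary: f g)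
  case 0
  then show ?case using bounded_bilinear.continuous_on[OF assms(1)] by auto
next
  case (Suc k)
  show ?case
  proof (rule C_k_on_SucI[OF assms(2)])
    fix x assume "x \<in> W"
    then show "((\<lambda>x. B (f x) (g x)) has_derivative
        (\<lambda>v. B (f x) (frechet_derivative g (at x) v) + B (frechet_derivative f (at x) v) (g x))) (at x)"
      using Suc.prems
      by (intro bounded_bilinear.FDERIV[OF assms(1)] C_k_on_has_derivative)
  next
    fix v
    show "C_k_on k W (\<lambda>x. B (f x) (frechet_derivative g (at x) v) + B (frechet_derivative f
        (at x) v) (g x))"
      using Suc.prems C_k_on_Suc_imp[OF Suc.prems(1)] C_k_on_Suc_imp[OF Suc.prems(2)]
      by (intro C_k_on_add[OF assms(2)] Suc.IH) auto
  qed
qed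

lemma C_k_on_sum:
  assumes "open W" "\<And>i. i \<in> I \<Longrightarrow> C_k_on k W (f i)"
  shows "C_k_on k W (\<lambda>x. \<Sum>i\<in>I. f i x)"
  using assms(2)
  by (induction I rule: infinite_finite_induct)
    (auto intro!: C_k_on_add C_k_on_const assms(1))

text \<open>Higher derivatives are defined in fixed directions only. Expanding over the basis turns
  a derivative in a moving direction into a finite sum of derivatives in fixed directions with
  scalar coefficients.\<close>

lemma linear_euclidean_expansion:
  fixes f :: "'a::euclidean_space \<Rightarrow> 'b::real_vector"
  assumes "linear f"
  shows "f v = (\<Sum>b\<in>Basis. (v \<bullet> b) *\<^sub>R f b)"
  using euclidean_representation[of v] assms
  by (metis (mono_tags, lifting) linear_sum linear_cmul sum.cong)

lemma C_k_on_compose: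
  fixes f :: "'a::real_normed_vector \<Rightarrow> 'b::euclidean_space" and g :: "'b \<Rightarrow> 'c::real_normed_vector"
  assumes "open W" "open V" "f ` W \<subseteq> V" "C_k_on k W f" "C_k_on k V g"
  shows "C_k_on k W (\<lambda>x. g (f x))"
  using assms(4,5)
proof (induction k arbitrary: g)
  case 0
  then show ?case using assms(3) by (auto intro: continuous_on_compose2)
next
  case (Suc k)
  have lin: "linear (frechet_derivative g (at y))" if "y \<in> V" for y
    using C_k_on_has_derivative[OF Suc.prems(2) that] has_derivative_linear by blast
  show ?case
  proof (rule C_k_on_SucI[OF assms(1)])
    fix x assume x: "x \<in> W"
    then have "f x \<in> V" using assms(3) by auto
    have "((g \<circ> f) has_derivative
        (frechet_derivative g (at (f x)) \<circ> frechet_derivative f (at x))) (at x)"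
      using diff_chain_at[OF C_k_on_has_derivative[OF Suc.prems(1) x]
          C_k_on_has_derivative[OF Suc.prems(2) \<open>f x \<in> V\<close>]] .
    \<comment> \<open>The direction in which \<open>g\<close> is differentiated depends on
      \<open>x\<close>. After the expansion, the induction hypothesis applies to the derivative of
      \<open>g\<close> along each fixed \<open>b\<close>.\<close>
    moreover have "frechet_derivative g (at (f x)) \<circ> frechet_derivative f (at x) =
        (\<lambda>v. \<Sum>b\<in>Basis. (frechet_derivative f (at x) v \<bullet> b) *\<^sub>R frechet_derivative g (at (f x)) b)"
      unfolding o_def by (rule ext) (rule linear_euclidean_expansion[OF lin[OF \<open>f x \<in> V\<close>]])
    ultimately show "((\<lambda>x. g (f x)) has_derivative (\<lambda>v. \<Sum>b\<in>Basis.
        (frechet_derivative f (at x) v \<bullet> b) *\<^sub>R frechet_derivative g (at (f x)) b)) (at x)"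
      by (simp add: o_def)
  next
    fix v
    have "C_k_on k W (\<lambda>x. frechet_derivative f (at x) v \<bullet> b)" for b
      using Suc.prems
      by (intro C_k_on_bilinear[OF bounded_bilinear_inner] C_k_on_const assms(1)) auto
    moreover have "C_k_on k W (\<lambda>x. frechet_derivative g (at (f x)) b)" for b
      using Suc.prems C_k_on_Suc_imp by (intro Suc.IH) auto
    ultimately show "C_k_on k W (\<lambda>x. \<Sum>b\<in>Basis.
        (frechet_derivative f (at x) v \<bullet> b) *\<^sub>R frechet_derivative g (at (f x)) b)"
      by (intro C_k_on_sum C_k_on_bilinear[OF bounded_bilinear_scaleR] assms(1))
  qed
qed

text \<open>The derivative is polynomial in \<open>inverse\<close> itself, hence as smooth as the
  induction hypothesis says.\<close>

lemma C_k_on_inverse: "C_k_on k (- {0}) (inverse :: 'a::real_normed_field \<Rightarrow> 'a)"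
proof (induction k)
  case 0
  show ?case by (auto intro!: continuous_intros)
next
  case (Suc k)
  show ?case
  proof (rule C_k_on_SucI)
    fix x :: 'a assume "x \<in> - {0}"
    then show "(inverse has_derivative (\<lambda>h. inverse x * (- h * inverse x))) (at x)"
      using has_derivative_inverse'[of x UNIV] by (simp add: mult.assoc)
  qed (intro C_k_on_bilinear[OF bounded_bilinear_mult] Suc C_k_on_const open_Compl closed_singleton)+
qed

text \<open>The exponent varies in the induction because each derivative lowers it by 1.\<close>

lemma C_k_on_powr: "C_k_on k {0<..} (\<lambda>x::real. x powr a)"
proof (induction k arbitrary: a)
  case 0
  show ?case by (auto intro!: continuous_intros)
next
  case (Suc k)
  show ?case
  proof (rule C_k_on_SucI[where f'="\<lambda>x h. a * x powr (a - 1) * h"])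
    fix x :: real assume "x \<in> {0<..}"
    then show "((\<lambda>x. x powr a) has_derivative (\<lambda>h. a * x powr (a - 1) * h)) (at x)"
      using has_real_derivative_powr[of x a] by (simp add: has_field_derivative_def)
  qed (intro C_k_on_bilinear[OF bounded_bilinear_mult] Suc C_k_on_const open_greaterThan)+
qed

lemma C_k_on_local:
  assumes "\<And>x. x \<in> W \<Longrightarrow> \<exists>V. open V \<and> x \<in> V \<and> C_k_on k V f"
  shows "C_k_on k W f"
  using assms
proof (induction k arbitrary: f)
  case 0
  then have "isCont f x" if "x \<in> W" for x
    using that by (metis C_k_on.simps(1) continuous_on_eq_continuous_at)
  then show ?case by (simp add: continuous_at_imp_continuous_on)
next
  case (Suc k)
  have "f differentiable at x" if "x \<in> W" for x using Suc.prems[OF that] by auto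
  moreover have "C_k_on k W (\<lambda>x. frechet_derivative f (at x) v)" for v
    by (intro Suc.IH) (use Suc.prems in fastforce)
  ultimately show ?case by auto
qed

section \<open>Rules for infinitely differentiable maps\<close>

lemma C_inf_on_subset: "C_inf_on W f \<Longrightarrow> V \<subseteq> W \<Longrightarrow> C_inf_on V f"
  unfolding C_inf_on_def using C_k_on_subset by blast

lemma C_inf_on_cong: "open W \<Longrightarrow> (\<And>x. x \<in> W \<Longrightarrow> f x = g x) \<Longrightarrow> C_inf_on W f \<Longrightarrow> C_inf_on W g"
  unfolding C_inf_on_def using C_k_on_cong by metis

lemma C_inf_on_const: "open W \<Longrightarrow> C_inf_on W (\<lambda>x. c)"
  unfolding C_inf_on_def using C_k_on_const by blast

lemma C_inf_on_bounded_linear: "bounded_linear f \<Longrightarrow> open W \<Longrightarrow> C_inf_on W f"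
  unfolding C_inf_on_def using C_k_on_bounded_linear by blast

lemma C_inf_on_id: "open W \<Longrightarrow> C_inf_on W (\<lambda>x. x)"
  by (rule C_inf_on_bounded_linear[OF bounded_linear_ident])

lemma C_inf_on_add:
  "open W \<Longrightarrow> C_inf_on W f \<Longrightarrow> C_inf_on W g \<Longrightarrow> C_inf_on W (\<lambda>x. f x + g x)"
  unfolding C_inf_on_def using C_k_on_add by blast

lemma C_inf_on_bilinear:
  "bounded_bilinear B \<Longrightarrow> open W \<Longrightarrow> C_inf_on W f \<Longrightarrow> C_inf_on W g \<Longrightarrow> C_inf_on W (\<lambda>x. B (f x) (g x))"
  unfolding C_inf_on_def using C_k_on_bilinear by blast

lemmas C_inf_on_scaleR = C_inf_on_bilinear[OF bounded_bilinear_scaleR]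
lemmas C_inf_on_mult = C_inf_on_bilinear[OF bounded_bilinear_mult]
lemmas C_inf_on_inner = C_inf_on_bilinear[OF bounded_bilinear_inner]

lemma C_inf_on_sum:
  "open W \<Longrightarrow> (\<And>i. i \<in> I \<Longrightarrow> C_inf_on W (f i)) \<Longrightarrow> C_inf_on W (\<lambda>x. \<Sum>i\<in>I. f i x)"
  by (simp add: C_inf_on_def C_k_on_sum)

lemma C_inf_on_compose:
  fixes f :: "'a::real_normed_vector \<Rightarrow> 'b::euclidean_space" and g :: "'b \<Rightarrow> 'c::real_normed_vector"
  shows "C_inf_on V g \<Longrightarrow> open W \<Longrightarrow> open V \<Longrightarrow> (\<And>x. x \<in> W \<Longrightarrow> f x \<in> V) \<Longrightarrow> C_inf_on W f \<Longrightarrow>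
    C_inf_on W (\<lambda>x. g (f x))"
  using C_k_on_compose[of W V f _ g] by (auto simp: C_inf_on_def image_subset_iff)

lemma C_inf_on_linear_compose:
  fixes f :: "'a::real_normed_vector \<Rightarrow> 'b::euclidean_space" and g :: "'b \<Rightarrow> 'c::real_normed_vector"
  shows "bounded_linear g \<Longrightarrow> open W \<Longrightarrow> C_inf_on W f \<Longrightarrow> C_inf_on W (\<lambda>x. g (f x))"
  by (rule C_inf_on_compose[OF C_inf_on_bounded_linear[OF _ open_UNIV]]) auto

lemma C_inf_on_minus:
  fixes f :: "'a::real_normed_vector \<Rightarrow> 'b::euclidean_space"
  shows "open W \<Longrightarrow> C_inf_on W f \<Longrightarrow> C_inf_on W (\<lambda>x. - f x)"
  by (rule C_inf_on_linear_compose[OF bounded_linear_minus[OF bounded_linear_ident]])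

lemma C_inf_on_diff:
  fixes f :: "'a::real_normed_vector \<Rightarrow> 'b::euclidean_space"
  shows "open W \<Longrightarrow> C_inf_on W f \<Longrightarrow> C_inf_on W g \<Longrightarrow> C_inf_on W (\<lambda>x. f x - g x)"
  using C_inf_on_add[OF _ _ C_inf_on_minus, of W f g] by simp

lemma C_inf_on_Pair:
  fixes f :: "'a::real_normed_vector \<Rightarrow> 'b::euclidean_space"
    and g :: "'a::real_normed_vector \<Rightarrow> 'c::euclidean_space"
  assumes "open W" "C_inf_on W f" "C_inf_on W g"
  shows "C_inf_on W (\<lambda>x. (f x, g x))"
proof -
  have "C_inf_on W (\<lambda>x. (f x, 0) + (0, g x))"
    by (rule C_inf_on_add[OF assms(1)
          C_inf_on_linear_compose[of "\<lambda>y. (y, 0)", OF _ assms(1,2)]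
          C_inf_on_linear_compose[of "\<lambda>y. (0, y)", OF _ assms(1,3)]])
      (intro bounded_linear_Pair bounded_linear_ident bounded_linear_zero)+
  then show ?thesis by simp
qed

lemma C_inf_on_inverse:
  fixes f :: "'a::real_normed_vector \<Rightarrow> 'b::{real_normed_field,euclidean_space}"
  shows "open W \<Longrightarrow> C_inf_on W f \<Longrightarrow> (\<And>x. x \<in> W \<Longrightarrow> f x \<noteq> 0) \<Longrightarrow> C_inf_on W (\<lambda>x. inverse (f x))"
  by (rule C_inf_on_compose[where V="- {0}" and g=inverse])
    (auto simp: C_inf_on_def C_k_on_inverse)

lemma C_inf_on_powr:
  fixes f :: "'a::real_normed_vector \<Rightarrow> real"
  shows "open W \<Longrightarrow> C_inf_on W f \<Longrightarrow> (\<And>x. x \<in> W \<Longrightarrow> f x > 0) \<Longrightarrow> C_inf_on W (\<lambda>x. f x powr a)"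
  by (rule C_inf_on_compose[where V="{0<..}" and g="\<lambda>x. x powr a"])
    (auto simp: C_inf_on_def C_k_on_powr)

lemma C_inf_on_local:
  "(\<And>x. x \<in> W \<Longrightarrow> \<exists>V. open V \<and> x \<in> V \<and> C_inf_on V f) \<Longrightarrow> C_inf_on W f"
  unfolding C_inf_on_def using C_k_on_local[of W _ f] by metis

lemma C_inf_on_has_derivative:
  "C_inf_on W f \<Longrightarrow> x \<in> W \<Longrightarrow> (f has_derivative frechet_derivative f (at x)) (at x)"
  unfolding C_inf_on_def using C_k_on_has_derivative by blast

lemma C_inf_on_linear_derivative:
  "C_inf_on W f \<Longrightarrow> x \<in> W \<Longrightarrow> linear (frechet_derivative f (at x))"
  using C_inf_on_has_derivative has_derivative_linear by blast

lemma C_inf_on_continuous: "C_inf_on W f \<Longrightarrow> continuous_on W f"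
  unfolding C_inf_on_def by (metis C_k_on.simps(1))

lemma C_inf_on_derivative:
  fixes f :: "'a::euclidean_space \<Rightarrow> 'b::real_normed_vector"
  assumes "open W" "C_inf_on W f" "C_inf_on W X"
  shows "C_inf_on W (\<lambda>x. frechet_derivative f (at x) (X x))"
proof (rule C_inf_on_cong[OF assms(1)])
  show "C_inf_on W (\<lambda>x. \<Sum>b\<in>Basis. (X x \<bullet> b) *\<^sub>R frechet_derivative f (at x) b)"
  proof (intro C_inf_on_sum C_inf_on_scaleR C_inf_on_inner C_inf_on_const assms(1,3))
    fix b :: 'a
    show "C_inf_on W (\<lambda>x. frechet_derivative f (at x) b)"
      using assms(2) unfolding C_inf_on_def by (metis C_k_on.simps(2))
  qed
qed (simp flip: linear_euclidean_expansion[OF C_inf_on_linear_derivative[OF assms(2)]])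

text \<open>Through the power -1/2 of \<open>x \<bullet> x\<close>, \<open>sgn\<close> is composed
  of maps that are known to be smooth.\<close>

lemma C_inf_on_sgn: "C_inf_on (- {0}) (sgn :: 'a::euclidean_space \<Rightarrow> 'a)"
proof (rule C_inf_on_cong)
  show "C_inf_on (- {0}) (\<lambda>x::'a. (x \<bullet> x) powr (- 1 / 2) *\<^sub>R x)"
    by (intro C_inf_on_scaleR C_inf_on_powr C_inf_on_inner C_inf_on_id) auto
next
  fix x :: 'a assume "x \<in> - {0}"
  then have "(norm x ^ 2) powr (- 1 / 2) = inverse (norm x)"
    by (simp add: powr_minus powr_half_sqrt)
  then show "(x \<bullet> x) powr (- 1 / 2) *\<^sub>R x = sgn x"
    by (simp add: sgn_div_norm power2_norm_eq_inner)
qed auto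

section \<open>Submanifolds of a Euclidean space\<close>

lemma smooth_arcE:
  assumes "smooth_arc U \<phi> \<gamma>"
  obtains \<epsilon> where "\<epsilon> > 0" "\<And>t. t \<in> {-\<epsilon><..<\<epsilon>} \<Longrightarrow> \<gamma> t \<in> U" "C_inf_on {-\<epsilon><..<\<epsilon>} (\<lambda>t. \<phi> (\<gamma> t))"
  using assms unfolding smooth_arc_def o_def by blast

lemma eventually_nhds_interval: "\<epsilon> > 0 \<Longrightarrow> eventually (\<lambda>t. t \<in> {-\<epsilon><..<\<epsilon>}) (nhds (0::real))"
  by (rule eventually_nhds_in_open) auto

lemma has_vector_derivative_cong_nhds:
  assumes "eventually (\<lambda>t. f t = g t) (nhds x)"
  shows "(f has_vector_derivative d) (at x) \<longleftrightarrow> (g has_vector_derivative d) (at x)"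
  by (rule has_vector_derivative_cong_ev)
    (use assms eventually_nhds_x_imp_x[OF assms] in \<open>auto elim: eventually_mono\<close>)

lemma has_derivative_along_curve:
  assumes "(\<gamma> has_vector_derivative w) (at t)" "(f has_derivative f') (at (\<gamma> t))"
  shows "((\<lambda>t. f (\<gamma> t)) has_vector_derivative f' w) (at t)"
  using vector_derivative_diff_chain_within[OF assms(1), of f f'] assms(2) has_derivative_at_withinI
  by (auto simp: o_def)

text \<open>A tangent vector comes with at least one arc, and this makes the definite description in
  \<open>ddir\<close> unique.\<close>

lemma ddirI:
  assumes "w \<in> tspace M x" "\<And>\<gamma>. \<gamma> \<in> arcs_at M x w \<Longrightarrow> ((\<lambda>t. f (\<gamma> t)) has_vector_derivative d) (at 0)"
  shows "ddir M f x w = d"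
  unfolding ddir_def
proof (rule the_equality)
  obtain \<gamma> where "\<gamma> \<in> arcs_at M x w" using assms(1) unfolding tspace_def by auto
  then show "d' = d" if "\<forall>\<gamma>\<in>arcs_at M x w. ((\<lambda>t. f (\<gamma> t)) has_vector_derivative d') (at 0)" for d'
    using that assms(2) vector_derivative_unique_at by blast
qed (use assms in auto)

text \<open>The difference \<open>B\<close> of two Levi-Civita connections is symmetric in its two
  fields, by vanishing torsion, and g(B(X,Y),Z) is skew in Y and Z, by compatibility with the
  metric. Alternating three skew and three symmetric exchanges returns to the same expression with
  the opposite sign.\<close>

lemma levi_civita_unique:
  assumes D: "is_levi_civita M g D" and D': "is_levi_civita M g D'"
    and sub: "\<And>x. x \<in> M \<Longrightarrow> subspace (tspace M x)"
    and ext: "\<And>x u. x \<in> M \<Longrightarrow> u \<in> tspace M x \<Longrightarrow> \<exists>X. vector_field M X \<and> X x = u"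
    and add: "\<And>x u v w. x \<in> M \<Longrightarrow> u \<in> tspace M x \<Longrightarrow> v \<in> tspace M x \<Longrightarrow> w \<in> tspace M x \<Longrightarrow>
        g x (u + v) w = g x u w + g x v w"
    and sym: "\<And>x u v. x \<in> M \<Longrightarrow> u \<in> tspace M x \<Longrightarrow> v \<in> tspace M x \<Longrightarrow> g x u v = g x v u"
    and pos: "\<And>x u. x \<in> M \<Longrightarrow> u \<in> tspace M x \<Longrightarrow> g x u u = 0 \<Longrightarrow> u = 0"
    and x: "x \<in> M" and u: "u \<in> tspace M x" and Y: "vector_field M Y"
  shows "D x u Y = D' x u Y"
proof -
  define B where "B X Y = D x (X x) Y - D' x (X x) Y" for X Y
  have tan: "Z x \<in> tspace M x" if "vector_field M Z" for Z
    using that x unfolding vector_field_def by auto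
  have DD: "D x (X x) Y \<in> tspace M x" "D' x (X x) Y \<in> tspace M x"
    if "vector_field M X" "vector_field M Y" for X Y
  proof -
    have "vector_field M (\<lambda>x. D x (X x) Y)" "vector_field M (\<lambda>x. D' x (X x) Y)"
      using D D' that unfolding is_levi_civita_def affine_connection_def by simp_all
    then show "D x (X x) Y \<in> tspace M x" "D' x (X x) Y \<in> tspace M x" using tan by blast+
  qed
  have BT: "B X Y \<in> tspace M x" if "vector_field M X" "vector_field M Y" for X Y
    using DD[OF that] subspace_diff[OF sub[OF x]] unfolding B_def by auto
  have symB: "B X Y = B Y X" if "vector_field M X" "vector_field M Y" for X Y
  proof -
    have "D x (X x) Y - D x (Y x) X = lie_bracket M X Y x" "D' x (X x) Y - D' x (Y x) X
        = lie_bracket M X Y x"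
      using D D' that x unfolding is_levi_civita_def by simp_all
    then show ?thesis unfolding B_def by (simp add: algebra_simps)
  qed
  have gB: "g x (B X Y) (Z x) = g x (D x (X x) Y) (Z x) - g x (D' x (X x) Y) (Z x)"
    if "vector_field M X" "vector_field M Y" "vector_field M Z" for X Y Z
    using add[OF x BT[OF that(1,2)] DD(2)[OF that(1,2)] tan[OF that(3)]] unfolding B_def by simp
  have skew: "g x (B X Y) (Z x) = - g x (B X Z) (Y x)"
    if "vector_field M X" "vector_field M Y" "vector_field M Z" for X Y Z
  proof -
    have "ddir M (\<lambda>y. g y (Y y) (Z y)) x (X x) = g x (D x (X x) Y) (Z x) + g x (Y x) (D x (X x) Z)"
      "ddir M (\<lambda>y. g y (Y y) (Z y)) x (X x) = g x (D' x (X x) Y) (Z x) + g x (Y x) (D' x (X x) Z)"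
      using D D' that x tan[OF that(1)] unfolding is_levi_civita_def by simp_all
    moreover have "g x (Y x) (D x (X x) Z) = g x (D x (X x) Z) (Y x)"
        "g x (Y x) (D' x (X x) Z) = g x (D' x (X x) Z) (Y x)"
      using sym[OF x tan[OF that(2)]] DD[OF that(1,3)] by auto
    ultimately show ?thesis using gB that by simp
  qed
  obtain X where X: "vector_field M X" "X x = u" using ext[OF x u] by auto
  \<comment> \<open>With a field whose value at \<open>x\<close> is \<open>B X Y\<close> itself, the
    expression that equals its own negative is the squared length of \<open>B X Y\<close>.\<close>
  obtain Z where Z: "vector_field M Z" "Z x = B X Y" using ext[OF x BT[OF X(1) Y]] by auto
  have "g x (B X Y) (Z x) = - g x (B X Y) (Z x)"
    using skew[OF X(1) Y Z(1)] skew[OF Z(1) X(1) Y] skew[OF Y Z(1) X(1)]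
      symB[OF X(1) Y] symB[OF X(1) Z(1)] symB[OF Y Z(1)] by simp
  then have "B X Y = 0" using pos[OF x BT[OF X(1) Y]] Z(2) by simp
  then show ?thesis using X(2) by (simp add: B_def)
qed

section \<open>The unit sphere with a conformally round metric\<close>

lemma sgn_unit: "x \<in> sphere 0 1 \<Longrightarrow> sgn x = (x :: 'a::real_normed_vector)"
  by (simp add: sgn_div_norm)

lemma sgn_in_sphere: "x \<noteq> 0 \<Longrightarrow> sgn x \<in> sphere 0 (1 :: real)" for x :: "'a::real_normed_vector"
  by (simp add: norm_sgn)

lemma inner_unit: "x \<in> sphere 0 1 \<Longrightarrow> x \<bullet> x = 1" for x :: "'a::real_inner"
  by (simp add: dot_square_norm)

lemmas unit_simps = sgn_unit[unfolded mem_sphere_0] inner_unit[unfolded mem_sphere_0]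

lemma has_derivative_sgn:
  fixes x :: "'a::real_inner"
  assumes "x \<noteq> 0"
  shows "(sgn has_derivative (\<lambda>h. (h - ((h \<bullet> x) / (x \<bullet> x)) *\<^sub>R x) /\<^sub>R norm x)) (at x)"
proof -
  have "((\<lambda>y::'a. inverse (norm y) *\<^sub>R y) has_derivative
      (\<lambda>h. inverse (norm x) *\<^sub>R h + - (inverse (norm x) * (h \<bullet> sgn x) * inverse (norm x)) *\<^sub>R x)) (at x)"
    using assms by (auto intro!: derivative_eq_intros has_derivative_norm simp: mult.commute)
  moreover have "inverse (norm x) *\<^sub>R h + - (inverse (norm x) * (h \<bullet> sgn x) * inverse (norm x)) *\<^sub>R x =
      (h - ((h \<bullet> x) / (x \<bullet> x)) *\<^sub>R x) /\<^sub>R norm x" for h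
    using assms by (simp add: sgn_div_norm scaleR_diff_right dot_square_norm divide_simps power2_eq_square)
  moreover have "(\<lambda>y::'a. inverse (norm y) *\<^sub>R y) = sgn" by (simp add: fun_eq_iff sgn_div_norm)
  ultimately show ?thesis by simp
qed

section \<open>Smooth functions and tangent spaces of the sphere\<close>

lemma smooth_on_sphereI:
  assumes "C_inf_on (- {0}) h" "\<And>x. x \<in> sphere 0 1 \<Longrightarrow> f x = h x"
  shows "smooth_on (sphere 0 1) f"
  unfolding smooth_on_def using assms
  by (intro ballI exI[of _ "- {0}"] exI[of _ h]) auto

text \<open>The local extensions of \<open>f\<close> depend on the point, but composing them with
  the retraction \<open>sgn\<close> gives a function determined by \<open>f\<close> alone. So the
  pieces agree, and one global extension can be differentiated everywhere.\<close>

lemma smooth_on_sphere_iff: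
  fixes f :: "'a::euclidean_space \<Rightarrow> 'b::real_normed_vector"
  shows "smooth_on (sphere 0 1) f \<longleftrightarrow> C_inf_on (- {0}) (\<lambda>x. f (sgn x))"
proof
  assume L: "smooth_on (sphere 0 1) f"
  show "C_inf_on (- {0}) (\<lambda>x. f (sgn x))"
  proof (rule C_inf_on_local)
    fix x :: 'a assume x: "x \<in> - {0}"
    then obtain W h where W: "open W" "sgn x \<in> W" "C_inf_on W h" "\<forall>y\<in>sphere 0 1 \<inter> W. f y = h y"
      using L sgn_in_sphere[of x] unfolding smooth_on_def by blast
    let ?V = "- {0} \<inter> sgn -` W"
    have V: "open ?V"
      by (rule continuous_open_preimage[OF C_inf_on_continuous[OF C_inf_on_sgn]]) (auto simp: W)
    have "C_inf_on ?V (\<lambda>x. h (sgn x))"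
      by (rule C_inf_on_compose[OF W(3) V W(1)]) (auto intro: C_inf_on_subset[OF C_inf_on_sgn])
    then have "C_inf_on ?V (\<lambda>x. f (sgn x))"
      by (rule C_inf_on_cong[OF V, rotated]) (use W(4) sgn_in_sphere in \<open>metis ComplD IntI Int_iff
          singletonI vimageD\<close>)
    then show "\<exists>V. open V \<and> x \<in> V \<and> C_inf_on V (\<lambda>x. f (sgn x))"
      using V W(2) x by blast
  qed
next
  assume "C_inf_on (- {0}) (\<lambda>x. f (sgn x))"
  then show "smooth_on (sphere 0 1) f"
    by (rule smooth_on_sphereI) (simp add: unit_simps)
qed

lemma arcs_at_sphere:
  assumes "\<gamma> \<in> arcs_at (sphere 0 1) x w"
  shows "eventually (\<lambda>t. \<gamma> t \<in> sphere 0 1) (nhds 0)" "\<gamma> 0 = x" "(\<gamma> has_vector_derivative w) (at 0)"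
proof -
  have \<gamma>: "smooth_arc (sphere 0 1) (\<lambda>y. y) \<gamma>" "\<gamma> 0 = x" "(\<gamma> has_vector_derivative w) (at 0)"
    using assms unfolding arcs_at_def by auto
  then show "\<gamma> 0 = x" "(\<gamma> has_vector_derivative w) (at 0)" by auto
  obtain \<epsilon> where "\<epsilon> > 0" "\<forall>t\<in>{-\<epsilon><..<\<epsilon>}. \<gamma> t \<in> sphere 0 1"
    using \<gamma>(1) unfolding smooth_arc_def by (elim exE conjE)
  then show "eventually (\<lambda>t. \<gamma> t \<in> sphere 0 1) (nhds 0)"
    by (intro eventually_mono[OF eventually_nhds_interval]) auto
qed

text \<open>One inclusion differentiates the constant
  \<open>\<gamma> t \<bullet> \<gamma> t\<close>. For the other, the straight line x + t w is pushed
  back to the sphere by \<open>sgn\<close>, whose derivative at \<open>x\<close> is the projection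
  along the radial direction and therefore fixes \<open>w\<close>.\<close>

lemma tspace_sphere:
  fixes x :: "'a::euclidean_space"
  assumes x: "x \<in> sphere 0 1"
  shows "tspace (sphere 0 1) x = {w. w \<bullet> x = 0}"
proof (intro subset_antisym subsetI CollectI)
  fix w assume "w \<in> tspace (sphere 0 1) x"
  then obtain \<gamma> where \<gamma>: "\<gamma> \<in> arcs_at (sphere 0 1) x w" unfolding tspace_def by auto
  note \<gamma> = arcs_at_sphere[OF \<gamma>]
  have "((\<lambda>t. \<gamma> t \<bullet> \<gamma> t) has_vector_derivative (\<gamma> 0 \<bullet> w + w \<bullet> \<gamma> 0)) (at 0)"
    by (rule bounded_bilinear.has_vector_derivative[OF bounded_bilinear_inner]) (rule \<gamma>)+
  moreover have "((\<lambda>t. \<gamma> t \<bullet> \<gamma> t) has_vector_derivative 0) (at 0)"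
    by (subst has_vector_derivative_cong_nhds[where g="\<lambda>t. 1"])
      (use eventually_mono[OF \<gamma>(1)] inner_unit in \<open>auto simp: unit_simps\<close>)
  ultimately have "\<gamma> 0 \<bullet> w + w \<bullet> \<gamma> 0 = 0" using vector_derivative_unique_at by blast
  then show "w \<bullet> x = 0" using \<gamma>(2) by (simp add: inner_commute)
next
  fix w assume "w \<in> {w. w \<bullet> x = 0}"
  then have wx: "w \<bullet> x = 0" by simp
  have x0: "x \<noteq> 0" using x by auto
  have nz: "x + t *\<^sub>R w \<noteq> 0" for t
  proof
    assume "x + t *\<^sub>R w = 0"
    then have "(x + t *\<^sub>R w) \<bullet> x = 0" by simp
    then show False using wx inner_unit[OF x] by (simp add: inner_left_distrib)
  qed
  have "C_inf_on {-1<..<1} (\<lambda>t. sgn (x + t *\<^sub>R w))"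
    by (rule C_inf_on_compose[OF C_inf_on_sgn _ _ _ C_inf_on_add[OF _ C_inf_on_const
            C_inf_on_scaleR[OF _ C_inf_on_id C_inf_on_const]]])
      (simp_all add: nz open_Compl)
  moreover have "((\<lambda>t. x + t *\<^sub>R w) has_vector_derivative w) (at 0)"
    by (auto intro!: derivative_eq_intros)
  from has_derivative_along_curve[OF this, of sgn] has_derivative_sgn[OF x0]
  have "((\<lambda>t. sgn (x + t *\<^sub>R w)) has_vector_derivative w) (at 0)"
    using x wx by fastforce
  ultimately have "(\<lambda>t. sgn (x + t *\<^sub>R w)) \<in> arcs_at (sphere 0 1) x w"
    unfolding arcs_at_def smooth_arc_def
    using sgn_in_sphere[OF nz] sgn_unit[OF x] by (auto intro!: exI[of _ 1] simp: o_def)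
  then show "w \<in> tspace (sphere 0 1) x" unfolding tspace_def by auto
qed

text \<open>
  The radial extension \<open>f \<circ> sgn\<close> of a function on the sphere is constant in the radial
  direction, so that its gradient is tangent to the sphere.
\<close>

definition sder :: "('a::euclidean_space \<Rightarrow> 'b::real_normed_vector) \<Rightarrow> 'a \<Rightarrow> 'a \<Rightarrow> 'b"
  where "sder f x = frechet_derivative (\<lambda>y. f (sgn y)) (at x)"

lemma sder_works:
  "smooth_on (sphere 0 1) f \<Longrightarrow> x \<noteq> 0 \<Longrightarrow> ((\<lambda>y. f (sgn y)) has_derivative sder f x) (at x)"
  unfolding sder_def smooth_on_sphere_iff by (rule C_inf_on_has_derivative) auto

lemma sder_eqI:
  assumes "((\<lambda>y. f (sgn y)) has_derivative f') (at x)"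
  shows "sder f x = f'"
  unfolding sder_def using frechet_derivative_at[OF assms] by simp

lemma linear_sder: "smooth_on (sphere 0 1) f \<Longrightarrow> x \<noteq> 0 \<Longrightarrow> linear (sder f x)"
  using sder_works has_derivative_linear by blast

lemma sder_radial:
  fixes f :: "'a::euclidean_space \<Rightarrow> 'b::real_normed_vector"
  assumes f: "smooth_on (sphere 0 1) f" and "x \<noteq> 0"
  shows "sder f x x = 0"
proof -
  have c: "((\<lambda>t. x + t *\<^sub>R x) has_vector_derivative x) (at 0)"
    by (auto intro!: derivative_eq_intros)
  have "((\<lambda>y. f (sgn y)) has_derivative sder f x) (at (x + 0 *\<^sub>R x))"
    using sder_works[OF assms] by simp
  from has_derivative_along_curve[OF c this]
  have "((\<lambda>t. f (sgn (x + t *\<^sub>R x))) has_vector_derivative sder f x x) (at 0)" .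
  moreover have "eventually (\<lambda>t. f (sgn (x + t *\<^sub>R x)) = f (sgn x)) (nhds 0)"
  proof (rule eventually_mono[OF eventually_nhds_interval[of 1]])
    fix t :: real assume "t \<in> {-1<..<1}"
    then have "sgn ((1 + t) *\<^sub>R x) = sgn x" by (simp add: sgn_scaleR)
    then show "f (sgn (x + t *\<^sub>R x)) = f (sgn x)" by (simp add: scaleR_left_distrib)
  qed simp
  ultimately have "((\<lambda>t::real. f (sgn x)) has_vector_derivative sder f x x) (at 0)"
    using has_vector_derivative_cong_nhds by fast
  then show ?thesis using vector_derivative_unique_at has_vector_derivative_const by blast
qed

lemma C_inf_on_sder:
  assumes "smooth_on (sphere 0 1) f" "C_inf_on (- {0}) X"
  shows "C_inf_on (- {0}) (\<lambda>x. sder f x (X x))"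
  unfolding sder_def using assms
  by (intro C_inf_on_derivative) (auto simp: smooth_on_sphere_iff)

lemma sder_along_arc:
  fixes f :: "'a::euclidean_space \<Rightarrow> 'b::real_normed_vector"
  assumes "smooth_on (sphere 0 1) f" "x \<in> sphere 0 1" "\<gamma> \<in> arcs_at (sphere 0 1) x w"
  shows "((\<lambda>t. f (\<gamma> t)) has_vector_derivative sder f x w) (at 0)"
proof -
  note \<gamma> = arcs_at_sphere[OF assms(3)]
  have "((\<lambda>y. f (sgn y)) has_derivative sder f x) (at (\<gamma> 0))"
    using sder_works[OF assms(1), of x] assms(2) \<gamma>(2) by fastforce
  from has_derivative_along_curve[OF \<gamma>(3) this]
  have "((\<lambda>t. f (sgn (\<gamma> t))) has_vector_derivative sder f x w) (at 0)" .
  moreover have "eventually (\<lambda>t. f (sgn (\<gamma> t)) = f (\<gamma> t)) (nhds 0)"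
    using \<gamma>(1) by eventually_elim (simp add: unit_simps)
  ultimately show ?thesis using has_vector_derivative_cong_nhds by fast
qed

lemma ddir_sphere:
  assumes "smooth_on (sphere 0 1) f" "x \<in> sphere 0 1" "w \<bullet> x = 0"
  shows "ddir (sphere 0 1) f x w = sder f x w"
  by (rule ddirI) (use assms tspace_sphere[OF assms(2)] in \<open>auto intro: sder_along_arc\<close>)

section \<open>Tangent vector fields on the sphere\<close>

lemma vector_field_sphere:
  "vector_field (sphere 0 1) X \<longleftrightarrow> smooth_on (sphere 0 1) X \<and> (\<forall>x\<in>sphere 0 1. X x \<bullet> x = 0)"
  unfolding vector_field_def using tspace_sphere by blast

text \<open>The tangential projection of the constant field \<open>v\<close> does it.\<close>

lemma sphere_field_exists:
  fixes v :: "'a::euclidean_space"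
  assumes "v \<bullet> x = 0"
  shows "\<exists>Y. vector_field (sphere 0 1) Y \<and> Y x = v"
proof (intro exI conjI)
  let ?Y = "\<lambda>y. v - (v \<bullet> y) *\<^sub>R y"
  have "smooth_on (sphere 0 1) ?Y"
    by (rule smooth_on_sphereI[where h="?Y"])
      (auto intro!: C_inf_on_diff C_inf_on_scaleR C_inf_on_inner C_inf_on_const C_inf_on_id)
  then show "vector_field (sphere 0 1) ?Y"
    unfolding vector_field_sphere by (simp add: inner_diff_left unit_simps)
  show "?Y x = v" using assms by simp
qed

text \<open>This is the second fundamental form: differentiating \<open>Y \<bullet> x = 0\<close>
  gives the normal part of the derivative of \<open>Y\<close>, which the term
  \<open>(u \<bullet> Y x) *\<^sub>R x\<close> of the round connection removes.\<close>

lemma sder_vector_field_inner: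
  assumes Y: "vector_field (sphere 0 1) Y" and x: "x \<in> sphere 0 1" and w: "w \<bullet> x = 0"
  shows "sder Y x w \<bullet> x = - (Y x \<bullet> w)"
proof -
  obtain \<gamma> where \<gamma>: "\<gamma> \<in> arcs_at (sphere 0 1) x w"
    using w tspace_sphere[OF x] unfolding tspace_def by auto
  note \<gamma>' = arcs_at_sphere[OF \<gamma>]
  have Ys: "smooth_on (sphere 0 1) Y" "\<forall>x\<in>sphere 0 1. Y x \<bullet> x = 0"
    using Y unfolding vector_field_sphere by auto
  have "((\<lambda>t. Y (\<gamma> t) \<bullet> \<gamma> t) has_vector_derivative (Y (\<gamma> 0) \<bullet> w + sder Y x w \<bullet> \<gamma> 0)) (at 0)"
    by (rule bounded_bilinear.has_vector_derivative[OF bounded_bilinear_inner sder_along_arc[OF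
        Ys(1) x \<gamma>] \<gamma>'(3)])
  moreover have "((\<lambda>t. Y (\<gamma> t) \<bullet> \<gamma> t) has_vector_derivative 0) (at 0)"
    by (subst has_vector_derivative_cong_nhds[where g="\<lambda>t. 0"])
      (use eventually_mono[OF \<gamma>'(1)] Ys(2) in auto)
  ultimately have "Y (\<gamma> 0) \<bullet> w + sder Y x w \<bullet> \<gamma> 0 = 0" using vector_derivative_unique_at by blast
  then show ?thesis using \<gamma>'(2) by simp
qed

definition sgrad :: "('a::euclidean_space \<Rightarrow> real) \<Rightarrow> 'a \<Rightarrow> 'a"
  where "sgrad f x = (\<Sum>b\<in>Basis. sder f x b *\<^sub>R b)"

lemma sgrad_inner:
  assumes "smooth_on (sphere 0 1) f" "x \<noteq> 0"
  shows "sgrad f x \<bullet> w = sder f x w"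
  unfolding linear_euclidean_expansion[OF linear_sder[OF assms], of w]
  by (simp add: sgrad_def inner_sum_left inner_commute[of w] mult.commute)

lemma C_inf_on_sgrad:
  assumes "smooth_on (sphere 0 1) f"
  shows "C_inf_on (- {0}) (sgrad f)"
  unfolding sgrad_def[abs_def]
  by (intro C_inf_on_sum C_inf_on_scaleR C_inf_on_sder C_inf_on_const assms open_Compl closed_singleton)

text \<open>
  The transformation rule of the Levi-Civita connection under the conformal change
  \<open>e\<^sup>2\<^sup>\<phi>\<close> with \<open>f = e\<^sup>2\<^sup>\<phi>\<close>, hence \<open>d\<phi> = df / (2f)\<close>; the first two terms are the round connection.
\<close>

definition conf_connection :: "('a::euclidean_space \<Rightarrow> real) \<Rightarrow> 'a connection"
  where "conf_connection f x u Y = sder Y x u + (u \<bullet> Y x) *\<^sub>R x +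
    (1 / (2 * f x)) *\<^sub>R (sder f x u *\<^sub>R Y x + sder f x (Y x) *\<^sub>R u - (u \<bullet> Y x) *\<^sub>R sgrad f x)"

lemma affine_connection_conf_connection:
  fixes f :: "'a::euclidean_space \<Rightarrow> real"
  assumes f: "smooth_on (sphere 0 1) f" "\<And>x. x \<in> sphere 0 1 \<Longrightarrow> f x > 0"
  shows "affine_connection (sphere 0 1) (conf_connection f)"
  unfolding affine_connection_def
proof (intro conjI allI impI ballI)
  fix X Y :: "'a \<Rightarrow> 'a"
  assume XY: "vector_field (sphere 0 1) X" "vector_field (sphere 0 1) Y"
  then have sXY: "smooth_on (sphere 0 1) X" "smooth_on (sphere 0 1) Y"
    unfolding vector_field_sphere by auto
  then have c: "C_inf_on (- {0}) (\<lambda>x. X (sgn x))" "C_inf_on (- {0}) (\<lambda>x. Y (sgn x))"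
      "C_inf_on (- {0}) (\<lambda>x. f (sgn x))"
    using f(1) smooth_on_sphere_iff by auto
  have nz: "f (sgn x) \<noteq> 0" if "x \<in> - {0}" for x
    using f(2)[OF sgn_in_sphere] that by fastforce
  have "smooth_on (sphere 0 1) (\<lambda>x. conf_connection f x (X x) Y)"
  proof (rule smooth_on_sphereI)
    \<comment> \<open>A smooth extension to the punctured space: values of the fields and of
      \<open>f\<close> are taken at \<open>sgn x\<close>, while \<open>sder\<close>,
      \<open>sgrad\<close> and \<open>x\<close> itself are smooth off 0 already.\<close>
    show "C_inf_on (- {0}) (\<lambda>x. sder Y x (X (sgn x)) + (X (sgn x) \<bullet> Y (sgn x)) *\<^sub>R x +
      ((1 / 2) * inverse (f (sgn x))) *\<^sub>R (sder f x (X (sgn x)) *\<^sub>R Y (sgn x) +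
        sder f x (Y (sgn x)) *\<^sub>R X (sgn x) - (X (sgn x) \<bullet> Y (sgn x)) *\<^sub>R sgrad f x))"
      by (intro C_inf_on_add C_inf_on_diff C_inf_on_scaleR C_inf_on_mult C_inf_on_inner C_inf_on_inverse
          C_inf_on_sder C_inf_on_sgrad C_inf_on_const C_inf_on_id c f(1) sXY nz open_Compl closed_singleton)
  qed (simp add: conf_connection_def unit_simps inverse_eq_divide)
  moreover have "conf_connection f x (X x) Y \<bullet> x = 0" if x: "x \<in> sphere 0 1" for x
  proof -
    have t: "X x \<bullet> x = 0" "Y x \<bullet> x = 0" using XY x unfolding vector_field_sphere by auto
    \<comment> \<open>The radial extension of \<open>f\<close> is constant along rays, so its
      gradient is tangent and the correction term stays in the tangent space.\<close>
    have "sgrad f x \<bullet> x = 0" using sgrad_inner[OF f(1), of x x] sder_radial[OF f(1), of x] x by fastforce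
    then show ?thesis
      using t inner_unit[OF x] sder_vector_field_inner[OF XY(2) x t(1)]
      by (simp add: conf_connection_def inner_add_left inner_diff_left inner_commute[of "Y x" "X x"])
  qed
  ultimately show "vector_field (sphere 0 1) (\<lambda>x. conf_connection f x (X x) Y)"
    unfolding vector_field_sphere by auto
next
  fix x u and Y :: "'a \<Rightarrow> 'a"
  assume x: "x \<in> sphere (0::'a) 1" and u: "u \<in> tspace (sphere 0 1) x" and Y: "vector_field (sphere 0 1) Y"
  have x0: "x \<noteq> 0" using x by auto
  have Ys: "smooth_on (sphere 0 1) Y" using Y unfolding vector_field_sphere by auto
  note lin = linear_sder[OF Ys x0] linear_sder[OF f(1) x0]
  show "conf_connection f x (u + v) Y = conf_connection f x u Y + conf_connection f x v Y" for v
    using lin by (simp add: conf_connection_def linear_add algebra_simps inner_add_left add_divide_distrib)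
  show "conf_connection f x (r *\<^sub>R u) Y = r *\<^sub>R conf_connection f x u Y" for r
    using lin by (simp add: conf_connection_def linear_scale algebra_simps)
  show "conf_connection f x u (\<lambda>y. Y y + Z y) = conf_connection f x u Y + conf_connection f x u Z"
    if Z: "vector_field (sphere 0 1) Z" for Z
  proof -
    have Zs: "smooth_on (sphere 0 1) Z" using Z unfolding vector_field_sphere by auto
    have "sder (\<lambda>y. Y y + Z y) x = (\<lambda>u. sder Y x u + sder Z x u)"
      by (rule sder_eqI) (intro has_derivative_add sder_works Ys Zs x0)
    then show ?thesis
      using lin by (simp add: conf_connection_def linear_add algebra_simps inner_add_right
          add_divide_distrib)
  qed
  show "conf_connection f x u (\<lambda>y. h y *\<^sub>R Y y) =
      ddir (sphere 0 1) h x u *\<^sub>R Y x + h x *\<^sub>R conf_connection f x u Y"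
    if h: "smooth_on (sphere 0 1) h" for h :: "'a \<Rightarrow> real"
  proof -
    have "sder (\<lambda>y. h y *\<^sub>R Y y) x = (\<lambda>u. h (sgn x) *\<^sub>R sder Y x u + sder h x u *\<^sub>R Y (sgn x))"
      by (rule sder_eqI) (intro has_derivative_scaleR sder_works Ys h x0)
    moreover have "ddir (sphere 0 1) h x u = sder h x u"
      using ddir_sphere[OF h x] u tspace_sphere[OF x] by auto
    ultimately show ?thesis
      using lin sgn_unit[OF x] by (simp add: conf_connection_def linear_scale algebra_simps)
  qed
qed

text \<open>Both the normal correction and the conformal correction are symmetric in the two fields,
  so only the commutator survives in the torsion. In the metric condition the terms with df(Y) and
  df(Z) cancel in pairs, and the two terms with df(u) add up to the derivative of the factor
  \<open>f\<close>.\<close>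

lemma levi_civita_conf_connection:
  fixes f :: "'a::euclidean_space \<Rightarrow> real"
  assumes f: "smooth_on (sphere 0 1) f" "\<And>x. x \<in> sphere 0 1 \<Longrightarrow> f x > 0"
    and g: "\<And>x u v. x \<in> sphere 0 1 \<Longrightarrow> u \<bullet> x = 0 \<Longrightarrow> v \<bullet> x = 0 \<Longrightarrow> g x u v = f x * (u \<bullet> v)"
  shows "is_levi_civita (sphere 0 1) g (conf_connection f)"
  unfolding is_levi_civita_def
proof (intro conjI allI impI ballI affine_connection_conf_connection f)
  fix X Y :: "'a \<Rightarrow> 'a" and x
  assume XY: "vector_field (sphere 0 1) X" "vector_field (sphere 0 1) Y" and x: "x \<in> sphere (0::'a) 1"
  then show "conf_connection f x (X x) Y - conf_connection f x (Y x) X = lie_bracket (sphere 0 1) X Y x"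
    unfolding lie_bracket_def vector_field_sphere
    by (simp add: ddir_sphere conf_connection_def inner_commute algebra_simps)
next
  fix Y Z :: "'a \<Rightarrow> 'a" and x u
  assume YZ: "vector_field (sphere 0 1) Y" "vector_field (sphere 0 1) Z"
    and x: "x \<in> sphere (0::'a) 1" and "u \<in> tspace (sphere 0 1) x"
  then have u: "u \<bullet> x = 0" using tspace_sphere by blast
  have x0: "x \<noteq> 0" using x by auto
  have YZs: "smooth_on (sphere 0 1) Y" "smooth_on (sphere 0 1) Z" and
    t: "\<And>x. x \<in> sphere 0 1 \<Longrightarrow> Y x \<bullet> x = 0 \<and> Z x \<bullet> x = 0"
    using YZ unfolding vector_field_sphere by auto
  \<comment> \<open>\<open>g\<close> is prescribed only at points of the sphere and on tangent
    vectors, which is what the fields provide at \<open>sgn y\<close>.\<close>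
  have eq: "g (sgn y) (Y (sgn y)) (Z (sgn y)) = f (sgn y) * (Y (sgn y) \<bullet> Z (sgn y))" if "y \<noteq> 0" for y
    using g t sgn_in_sphere[OF that] by blast
  have "C_inf_on (- {0}) (\<lambda>y. f (sgn y) * (Y (sgn y) \<bullet> Z (sgn y)))"
    using YZs f(1) unfolding smooth_on_sphere_iff by (auto intro!: C_inf_on_mult C_inf_on_inner)
  then have "smooth_on (sphere 0 1) (\<lambda>y. g y (Y y) (Z y))"
    unfolding smooth_on_sphere_iff by (rule C_inf_on_cong[rotated 2]) (auto simp: eq)
  from ddir_sphere[OF this x u]
  have "ddir (sphere 0 1) (\<lambda>y. g y (Y y) (Z y)) x u = sder (\<lambda>y. g y (Y y) (Z y)) x u" .
  also have "sder (\<lambda>y. g y (Y y) (Z y)) x = (\<lambda>u. f (sgn x) * (Y (sgn x) \<bullet> sder Z x u + sder Y x u \<bullet>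
      Z (sgn x))
      + sder f x u * (Y (sgn x) \<bullet> Z (sgn x)))"
  proof (rule sder_eqI, rule has_derivative_transform_within_open[of _ _ x "UNIV" "- {0}"])
    show "((\<lambda>y. f (sgn y) * (Y (sgn y) \<bullet> Z (sgn y))) has_derivative
       (\<lambda>u. f (sgn x) * (Y (sgn x) \<bullet> sder Z x u + sder Y x u \<bullet> Z (sgn x))
      + sder f x u * (Y (sgn x) \<bullet> Z (sgn x)))) (at x)"
      by (intro has_derivative_mult has_derivative_inner sder_works YZs f(1) x0)
  qed (use eq x0 in auto)
  finally have L: "ddir (sphere 0 1) (\<lambda>y. g y (Y y) (Z y)) x u =
     f x * (Y x \<bullet> sder Z x u + sder Y x u \<bullet> Z x) + sder f x u * (Y x \<bullet> Z x)"
    using sgn_unit[OF x] by simp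
  \<comment> \<open>The formula for \<open>g\<close> may be applied to the derivatives only after
    they are known to be tangent.\<close>
  have tan: "conf_connection f x u Y \<bullet> x = 0" "conf_connection f x u Z \<bullet> x = 0"
  proof -
    obtain U where U: "vector_field (sphere 0 1) U" "U x = u" using sphere_field_exists[OF u] by auto
    have "affine_connection (sphere 0 1) (conf_connection f)"
      by (rule affine_connection_conf_connection) (fact f)+
    then have "vector_field (sphere 0 1) (\<lambda>x. conf_connection f x (U x) Y)"
        "vector_field (sphere 0 1) (\<lambda>x. conf_connection f x (U x) Z)"
      using U(1) YZ unfolding affine_connection_def by blast+
    then show "conf_connection f x u Y \<bullet> x = 0" "conf_connection f x u Z \<bullet> x = 0"
      using U(2) x unfolding vector_field_sphere by auto
  qed
  have "f x \<noteq> 0" using f(2)[OF x] by auto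
  then show "ddir (sphere 0 1) (\<lambda>y. g y (Y y) (Z y)) x u =
      g x (conf_connection f x u Y) (Z x) + g x (Y x) (conf_connection f x u Z)"
    unfolding L using g[OF x tan(1), of "Z x"] g[OF x _ tan(2), of "Y x"] t[OF x]
    by (simp add: conf_connection_def inner_add_left inner_add_right inner_diff_left inner_diff_right
        inner_commute[of x] sgrad_inner[OF f(1) x0] inner_commute[of _ "sgrad f x"])
      (simp add: field_simps inner_commute)
qed

text \<open>The derivative of the extending field \<open>Y\<close> occurs in both parts of the lift
  and cancels; only \<open>Y x = v\<close> remains. Existence and uniqueness of the Levi-Civita
  connection make the one selected by \<open>SOME\<close> agree with
  \<open>conf_connection\<close>.\<close>

lemma horizontal_lift_sphere:
  fixes f :: "'a::euclidean_space \<Rightarrow> real"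
  assumes f: "smooth_on (sphere 0 1) f" "\<And>x. x \<in> sphere 0 1 \<Longrightarrow> f x > 0"
    and g: "\<And>x u v. x \<in> sphere 0 1 \<Longrightarrow> u \<bullet> x = 0 \<Longrightarrow> v \<bullet> x = 0 \<Longrightarrow> g x u v = f x * (u \<bullet> v)"
    and x: "x \<in> sphere 0 1" and v: "v \<bullet> x = 0" and w: "w \<bullet> x = 0"
  shows "horizontal_lift (sphere 0 1) g x v w = (w, - ((w \<bullet> v) *\<^sub>R x +
    (1 / (2 * f x)) *\<^sub>R (sder f x w *\<^sub>R v + sder f x v *\<^sub>R w - (w \<bullet> v) *\<^sub>R sgrad f x)))"
proof -
  define Y where "Y = (SOME Y. vector_field (sphere 0 1) Y \<and> Y x = v)"
  have Y: "vector_field (sphere 0 1) Y" "Y x = v"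
    using someI_ex[OF sphere_field_exists[OF v]] unfolding Y_def by auto
  have lc': "is_levi_civita (sphere 0 1) g (conf_connection f)"
    by (rule levi_civita_conf_connection) (fact f g)+
  then have lc: "is_levi_civita (sphere 0 1) g (levi_civita (sphere 0 1) g)"
    unfolding levi_civita_def by (rule someI[of "is_levi_civita (sphere 0 1) g"])
  have "levi_civita (sphere 0 1) g x w Y = conf_connection f x w Y"
  proof (rule levi_civita_unique[OF lc lc'])
    show "subspace (tspace (sphere 0 1) y)" if "y \<in> sphere 0 1" for y :: 'a
      by (auto simp: tspace_sphere[OF that] subspace_def inner_add_left)
    show "u = 0" if "y \<in> sphere 0 1" "u \<in> tspace (sphere 0 1) y" "g y u u = 0" for y u
    proof -
      have "f y * (u \<bullet> u) = 0" using that g[OF that(1)] by (simp add: tspace_sphere[OF that(1)])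
      then show ?thesis using f(2)[OF that(1)] by simp
    qed
    show "g y (u + v) w = g y u w + g y v w"
      if "y \<in> sphere 0 1" "u \<in> tspace (sphere 0 1) y" "v \<in> tspace (sphere 0 1) y" "w
          \<in> tspace (sphere 0 1) y"
      for y u v w
      using that g[OF that(1)] by (simp add: tspace_sphere[OF that(1)] inner_add_left distrib_left)
    show "g y u v = g y v u"
      if "y \<in> sphere 0 1" "u \<in> tspace (sphere 0 1) y" "v \<in> tspace (sphere 0 1) y" for y u v
      using that g[OF that(1)] by (simp add: tspace_sphere[OF that(1)] inner_commute)
    show "\<exists>X. vector_field (sphere 0 1) X \<and> X y = u"
      if "y \<in> sphere 0 1" "u \<in> tspace (sphere 0 1) y" for y u
      using sphere_field_exists that tspace_sphere[OF that(1)] by blast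
  qed (use x w Y tspace_sphere[OF x] in auto)
  moreover have "ddir (sphere 0 1) Y x w = sder Y x w"
    using Y(1) ddir_sphere x w unfolding vector_field_sphere by blast
  ultimately show ?thesis
    unfolding horizontal_lift_def Let_def Y_def[symmetric]
    using Y(2) by (simp add: conf_connection_def)
qed

section \<open>Quaternions\<close>

abbreviation qi :: quat
  where "qi \<equiv> (\<i>, 0)"

lemma bounded_bilinear_qmult: "bounded_bilinear (*\<^sub>q)"
  unfolding bilinear_conv_bounded_bilinear[symmetric] bilinear_def
  by (auto intro!: linearI simp: qmult_def prod_eq_iff algebra_simps)

lemmas qmult_add_left = bounded_bilinear.add_left[OF bounded_bilinear_qmult]
  and qmult_add_right = bounded_bilinear.add_right[OF bounded_bilinear_qmult]
  and qmult_diff_left = bounded_bilinear.diff_left[OF bounded_bilinear_qmult]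
  and qmult_diff_right = bounded_bilinear.diff_right[OF bounded_bilinear_qmult]
  and qmult_minus_left = bounded_bilinear.minus_left[OF bounded_bilinear_qmult]
  and qmult_minus_right = bounded_bilinear.minus_right[OF bounded_bilinear_qmult]
  and qmult_scaleR_left = bounded_bilinear.scaleR_left[OF bounded_bilinear_qmult]
  and qmult_scaleR_right = bounded_bilinear.scaleR_right[OF bounded_bilinear_qmult]
  and qmult_zero_left = bounded_bilinear.zero_left[OF bounded_bilinear_qmult]
  and qmult_zero_right = bounded_bilinear.zero_right[OF bounded_bilinear_qmult]

lemmas qmult_linear_simps = qmult_add_left qmult_add_right qmult_diff_left qmult_diff_right
  qmult_minus_left qmult_minus_right qmult_scaleR_left qmult_scaleR_right
  qmult_zero_left qmult_zero_right

lemma qmult_assoc: "p *\<^sub>q q *\<^sub>q r = p *\<^sub>q (q *\<^sub>q r)"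
  by (simp add: qmult_def prod_eq_iff algebra_simps)

lemma qmult_one [simp]: "qone *\<^sub>q q = q" "q *\<^sub>q qone = q"
  by (simp_all add: qmult_def qone_def prod_eq_iff)

lemma qi_squared: "qi *\<^sub>q qi = - qone"
  by (simp add: qmult_def qone_def prod_eq_iff)

lemma qmult_qi_qi: "q *\<^sub>q qi *\<^sub>q qi = - q"
  by (simp add: qmult_assoc qi_squared qmult_minus_right)

lemma qone_nonzero [simp]: "qone \<noteq> 0"
  by (simp add: qone_def prod_eq_iff)

lemma inner_quat: "p \<bullet> q = Re (fst p) * Re (fst q) + Im (fst p) * Im (fst q) +
    (Re (snd p) * Re (snd q) + Im (snd p) * Im (snd q))" for p q :: quat
  by (simp add: inner_prod_def inner_complex_def)

lemma inner_qmult_left: "(p *\<^sub>q q) \<bullet> r = q \<bullet> (qconj p *\<^sub>q r)"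
  by (simp add: inner_quat qmult_def qconj_def algebra_simps)

lemma inner_qmult_right: "(q *\<^sub>q p) \<bullet> r = q \<bullet> (r *\<^sub>q qconj p)"
  by (simp add: inner_quat qmult_def qconj_def algebra_simps)

lemma qconj_qmult: "qconj (p *\<^sub>q q) = qconj q *\<^sub>q qconj p"
  by (simp add: qmult_def qconj_def prod_eq_iff algebra_simps)

lemma qmult_qconj: "q *\<^sub>q qconj q = (norm q)\<^sup>2 *\<^sub>R qone" "qconj q *\<^sub>q q = (norm q)\<^sup>2 *\<^sub>R qone"
  by (simp_all add: power2_norm_eq_inner inner_quat qmult_def qconj_def qone_def prod_eq_iff complex_eq_iff
      algebra_simps)

lemma inner_qmult_cancel_left: "(p *\<^sub>q q) \<bullet> (p *\<^sub>q r) = (norm p)\<^sup>2 * (q \<bullet> r)"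
  unfolding inner_qmult_left[of p q] qmult_assoc[symmetric] qmult_qconj
  by (simp add: qmult_scaleR_left)

lemma inner_qmult_cancel_right: "(q *\<^sub>q p) \<bullet> (r *\<^sub>q p) = (norm p)\<^sup>2 * (q \<bullet> r)"
  unfolding inner_qmult_right[of q p] qmult_assoc qmult_qconj
  by (simp add: qmult_scaleR_right)

lemma norm_qmult: "norm (p *\<^sub>q q) = norm p * norm q"
  by (simp add: norm_eq_sqrt_inner[of "p *\<^sub>q q"] inner_qmult_cancel_left real_sqrt_mult
      norm_eq_sqrt_inner[of q])

lemma norm_qi [simp]: "norm qi = 1"
  by (simp add: norm_Pair)

lemma norm_qone [simp]: "norm qone = 1"
  by (simp add: qone_def norm_Pair)

lemma qmult_eq_0_iff: "p *\<^sub>q q = 0 \<longleftrightarrow> p = 0 \<or> q = 0"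
  by (metis mult_eq_0_iff norm_eq_zero norm_qmult)

definition qinv :: "quat \<Rightarrow> quat"
  where "qinv q = inverse ((norm q)\<^sup>2) *\<^sub>R qconj q"

lemma qmult_qinv:
  assumes "q \<noteq> 0"
  shows "q *\<^sub>q qinv q = qone" "qinv q *\<^sub>q q = qone"
  using assms by (simp_all add: qinv_def qmult_linear_simps qmult_qconj)

lemma qmult_qinv_cancel:
  assumes "q \<noteq> 0"
  shows "p *\<^sub>q q *\<^sub>q qinv q = p" "p *\<^sub>q qinv q *\<^sub>q q = p" "q *\<^sub>q (qinv q *\<^sub>q p) = p"
      "qinv q *\<^sub>q (q *\<^sub>q p) = p"
  using qmult_qinv[OF assms] by (simp_all add: qmult_assoc flip: qmult_assoc[of q] qmult_assoc[of "qinv q"])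

lemma qmult_left_cancel: "q \<noteq> 0 \<Longrightarrow> q *\<^sub>q p = q *\<^sub>q r \<longleftrightarrow> p = r"
  by (metis qmult_qinv_cancel(4))

lemma norm_qinv: "q \<noteq> 0 \<Longrightarrow> norm (qinv q) = inverse (norm q)"
  using norm_qmult[of q "qinv q"] qmult_qinv(1)[of q] by (simp add: inverse_eq_divide eq_divide_eq
      mult.commute)

lemma inner_qmult_qi: "q \<bullet> (q *\<^sub>q qi) = 0" "(p *\<^sub>q qi) \<bullet> q = - (p \<bullet> (q *\<^sub>q qi))"
  by (simp_all add: inner_quat qmult_def algebra_simps)

lemma C_inf_on_qmult: "open W \<Longrightarrow> C_inf_on W f \<Longrightarrow> C_inf_on W g \<Longrightarrow> C_inf_on W (\<lambda>x. f x *\<^sub>q g x)"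
  by (rule C_inf_on_bilinear[OF bounded_bilinear_qmult])

lemma bounded_linear_qconj: "bounded_linear qconj"
  unfolding linear_conv_bounded_linear[symmetric]
  by (rule linearI) (simp_all add: qconj_def prod_eq_iff)

lemma C_inf_on_qinv:
  assumes "open W" "C_inf_on W f" "\<And>x. x \<in> W \<Longrightarrow> f x \<noteq> 0"
  shows "C_inf_on W (\<lambda>x. qinv (f x))"
  unfolding qinv_def power2_norm_eq_inner
  by (intro C_inf_on_scaleR C_inf_on_inverse C_inf_on_inner C_inf_on_linear_compose[OF
      bounded_linear_qconj] assms(1,2))
    (use assms(3) in simp)

section \<open>Orientation\<close>

lemma det_4:
  "det (A::'a::comm_ring_1^4^4) =
    A$1$1 * (A$2$2 * A$3$3 * A$4$4 + A$2$3 * A$3$4 * A$4$2 + A$2$4 * A$3$2 * A$4$3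
      - A$2$2 * A$3$4 * A$4$3 - A$2$3 * A$3$2 * A$4$4 - A$2$4 * A$3$3 * A$4$2) -
    A$1$2 * (A$2$1 * A$3$3 * A$4$4 + A$2$3 * A$3$4 * A$4$1 + A$2$4 * A$3$1 * A$4$3
      - A$2$1 * A$3$4 * A$4$3 - A$2$3 * A$3$1 * A$4$4 - A$2$4 * A$3$3 * A$4$1) +
    A$1$3 * (A$2$1 * A$3$2 * A$4$4 + A$2$2 * A$3$4 * A$4$1 + A$2$4 * A$3$1 * A$4$2
      - A$2$1 * A$3$4 * A$4$2 - A$2$2 * A$3$1 * A$4$4 - A$2$4 * A$3$2 * A$4$1) -
    A$1$4 * (A$2$1 * A$3$2 * A$4$3 + A$2$2 * A$3$3 * A$4$1 + A$2$3 * A$3$1 * A$4$2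
      - A$2$1 * A$3$3 * A$4$2 - A$2$2 * A$3$1 * A$4$3 - A$2$3 * A$3$2 * A$4$1)"
proof -
  have f1234: "finite {2::4, 3, 4}" "1 \<notin> {2::4, 3, 4}" by auto
  have f234: "finite {3::4, 4}" "2 \<notin> {3::4, 4}" by auto
  have f34: "finite {4::4}" "3 \<notin> {4::4}" by auto
  show ?thesis
    unfolding det_def UNIV_4
    unfolding sum_over_permutations_insert[OF f1234]
    unfolding sum_over_permutations_insert[OF f234]
    unfolding sum_over_permutations_insert[OF f34]
    unfolding permutes_sing
    by (simp add: sign_swap_id permutation_swap_id permutation_compose sign_compose sign_id
        swap_id_eq algebra_simps)
qed

lemma vector_4:
  "(vector [x,y,z,w] :: 'a::zero^4)$1 = x"
  "(vector [x,y,z,w] :: 'a^4)$2 = y"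
  "(vector [x,y,z,w] :: 'a^4)$3 = z"
  "(vector [x,y,z,w] :: 'a^4)$4 = w"
  unfolding vector_def by simp_all

lemma frame_det_scale:
  "frame_det X1 (r *\<^sub>R X2) X3 (s *\<^sub>R X4) = r * s * frame_det X1 X2 X3 X4"
  by (simp add: frame_det_def Let_def det_4 vector_4 algebra_simps)

text \<open>Right multiplication by a unit imaginary \<open>p\<close> turns the quaternions into a
  complex plane. The right side is the Gram determinant of \<open>X\<close> and \<open>Y\<close> for
  its Hermitian form, that is, the squared modulus of their complex determinant.\<close>

lemma frame_det_qmult:
  assumes "Re (fst p) = 0" "norm p = 1"
  shows "frame_det X (X *\<^sub>q p) Y (Y *\<^sub>q p) =
    (X \<bullet> X) * (Y \<bullet> Y) - (X \<bullet> Y)\<^sup>2 - ((X *\<^sub>q p) \<bullet> Y)\<^sup>2"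
proof -
  \<comment> \<open>With \<open>p \<bullet> p\<close> in place of 1 this is a polynomial identity,
    homogeneous of degree 2 in \<open>p\<close>, and can be checked by expansion.\<close>
  have "frame_det X (X *\<^sub>q p) Y (Y *\<^sub>q p) =
      (p \<bullet> p) * ((X \<bullet> X) * (Y \<bullet> Y) - (X \<bullet> Y)\<^sup>2) - ((X *\<^sub>q p) \<bullet> Y)\<^sup>2"
    using assms(1)
    by (simp add: frame_det_def Let_def det_4 vector_4 inner_quat qmult_def power2_eq_square algebra_simps)
  then show ?thesis using assms(2) by (simp add: dot_square_norm)
qed

lemma unit_imaginary_square:
  assumes "Re (fst p) = 0" "norm p = 1"
  shows "qconj p = - p" "p *\<^sub>q p = - qone"
proof -
  show "qconj p = - p" using assms(1) by (simp add: qconj_def prod_eq_iff complex_eq_iff)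
  then show "p *\<^sub>q p = - qone" using qmult_qconj(1)[of p] assms(2)
    by (simp add: qmult_minus_right minus_equation_iff[of "p *\<^sub>q p"])
qed

lemma inner_qmult_imaginary:
  assumes "Re (fst p) = 0" "norm p = 1"
  shows "X \<bullet> (X *\<^sub>q p) = 0" "(X *\<^sub>q p) \<bullet> Y = - (X \<bullet> (Y *\<^sub>q p))"
proof -
  show *: "(X *\<^sub>q p) \<bullet> Y = - (X \<bullet> (Y *\<^sub>q p))" for X Y
    using unit_imaginary_square[OF assms] by (simp add: inner_qmult_right qmult_minus_right)
  show "X \<bullet> (X *\<^sub>q p) = 0" using *[of X X] by (simp add: inner_commute)
qed

text \<open>All complex structures given by right multiplication induce the same orientation, namely
  that of the coordinates used in \<open>frame_det\<close>.\<close>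

lemma frame_det_qmult_nonneg:
  assumes p: "Re (fst p) = 0" "norm p = 1"
  shows "frame_det X (X *\<^sub>q p) Y (Y *\<^sub>q p) \<ge> 0"
proof (cases "X = 0")
  case True
  then show ?thesis using frame_det_qmult[OF p, of X Y] by (simp add: qmult_zero_left)
next
  case False
  define r where "r = X \<bullet> X"
  have r: "r > 0" using False by (simp add: r_def)
  have Xp: "(X *\<^sub>q p) \<bullet> (X *\<^sub>q p) = r" "X \<bullet> (X *\<^sub>q p) = 0" "(X *\<^sub>q p) \<bullet> X = 0"
    using inner_qmult_imaginary(1)[OF p, of X] p
    by (simp_all add: inner_qmult_cancel_right r_def inner_commute[of "X *\<^sub>q p" X])
  \<comment> \<open>\<open>Z\<close> is \<open>r\<close> times the component of \<open>Y\<close>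
    orthogonal to \<open>X\<close> and X p; its squared length is \<open>r\<close> times the
    determinant.\<close>
  define Z where "Z = r *\<^sub>R Y - (X \<bullet> Y) *\<^sub>R X - ((X *\<^sub>q p) \<bullet> Y) *\<^sub>R (X *\<^sub>q p)"
  have "Z \<bullet> Z = r * frame_det X (X *\<^sub>q p) Y (Y *\<^sub>q p)"
    unfolding Z_def frame_det_qmult[OF p] using Xp
    by (simp add: inner_diff_left inner_diff_right r_def[symmetric]
        inner_commute[of Y X] inner_commute[of Y "X *\<^sub>q p"] power2_eq_square algebra_simps)
  moreover have "Z \<bullet> Z \<ge> 0" by simp
  ultimately show ?thesis using r by (metis mult_less_0_iff not_le order_less_asym)
qed

text \<open>Subtracting the projection to \<open>a\<close> leaves a vector orthogonal to a spanning
  set, hence to itself. It pins down the direction of the cross product below.\<close>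

lemma orthogonal_complement_line:
  fixes a u :: "'a::euclidean_space"
  assumes "pairwise orthogonal (insert a B)" "0 \<notin> insert a B" "a \<notin> B" "finite B" "Suc (card B) = DIM('a)"
    and u: "\<And>b. b \<in> B \<Longrightarrow> orthogonal u b"
  shows "u = ((u \<bullet> a) / (a \<bullet> a)) *\<^sub>R a"
proof -
  have "UNIV \<subseteq> span (insert a B)"
    using assms by (intro card_ge_dim_independent pairwise_orthogonal_independent) auto
  define y where "y = u - ((u \<bullet> a) / (a \<bullet> a)) *\<^sub>R a"
  have "orthogonal y b" if "b \<in> insert a B" for b
  proof (cases "b = a")
    case True
    then show ?thesis using assms(2) by (auto simp: y_def orthogonal_def inner_diff_left)
  next
    case False
    then have "orthogonal a b" using assms(1) that by (auto simp: pairwise_def)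
    then show ?thesis using u[of b] that False by (auto simp: y_def orthogonal_def inner_diff_left)
  qed
  then have "orthogonal y y"
    using \<open>UNIV \<subseteq> span (insert a B)\<close> by (intro orthogonal_to_span[of y "insert a B"]) auto
  then have "y = 0" by (simp add: orthogonal_self)
  then show ?thesis by (simp add: y_def)
qed

section \<open>Quaternionic and complex lines\<close>

definition cline :: "quat2 \<Rightarrow> quat2 set"
  where "cline z = {z *\<^sub>h (c, 0) | c. c \<in> (UNIV :: complex set)}"

definition qline :: "quat2 \<Rightarrow> quat2 set"
  where "qline z = {z *\<^sub>h q | q. q \<in> (UNIV :: quat set)}"

lemma mem_cline_iff: "y \<in> cline z \<longleftrightarrow> (\<exists>c. y = z *\<^sub>h (c, 0))"
  by (simp add: cline_def)

lemma mem_qline_iff: "y \<in> qline z \<longleftrightarrow> (\<exists>q. y = z *\<^sub>h q)"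
  unfolding qline_def by blast

lemma rmult_assoc: "z *\<^sub>h p *\<^sub>h q = z *\<^sub>h (p *\<^sub>q q)"
  by (simp add: rmult_def qmult_assoc)

lemma rmult_one [simp]: "z *\<^sub>h qone = z"
  by (simp add: rmult_def)

lemma bounded_bilinear_rmult: "bounded_bilinear (*\<^sub>h)"
  unfolding bilinear_conv_bounded_bilinear[symmetric] bilinear_def
  by (intro conjI allI linearI) (simp_all add: rmult_def qmult_linear_simps)

lemmas rmult_diff_left = bounded_bilinear.diff_left[OF bounded_bilinear_rmult]
  and rmult_minus_left = bounded_bilinear.minus_left[OF bounded_bilinear_rmult]
  and rmult_zero_left = bounded_bilinear.zero_left[OF bounded_bilinear_rmult]

lemma qmult_complex: "(a, 0) *\<^sub>q (b, 0) = (a * b, 0)"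
  by (simp add: qmult_def)

lemma rmult_eq_0_iff: "z *\<^sub>h q = 0 \<longleftrightarrow> z = 0 \<or> q = 0"
proof -
  have "z *\<^sub>h q = 0 \<longleftrightarrow> fst z *\<^sub>q q = 0 \<and> snd z *\<^sub>q q = 0" "z = 0 \<longleftrightarrow> fst z = 0 \<and> snd z = 0"
    by (auto simp: rmult_def prod_eq_iff)
  then show ?thesis using qmult_eq_0_iff by metis
qed

lemma cline_subset: "y \<in> cline z \<Longrightarrow> cline y \<subseteq> cline z"
  by (auto simp: mem_cline_iff rmult_assoc qmult_complex)

lemma qline_subset: "y \<in> qline z \<Longrightarrow> qline y \<subseteq> qline z"
  unfolding subset_iff mem_qline_iff by (metis rmult_assoc)

lemma mem_cline: "z \<in> cline z"
  unfolding mem_cline_iff using rmult_one[of z] unfolding qone_def by metis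

lemma mem_qline: "z \<in> qline z"
  unfolding mem_qline_iff by (metis rmult_one)

lemma twistor_cline: "twistor (cline z) = qline z"
proof -
  have "\<psi> *\<^sub>h q \<in> qline z" if "\<psi> \<in> cline z" for \<psi> q
    using that unfolding mem_qline_iff mem_cline_iff by (metis rmult_assoc)
  moreover have "\<exists>\<psi> q. y = \<psi> *\<^sub>h q \<and> \<psi> \<in> cline z" if "y \<in> qline z" for y
    using that mem_cline unfolding mem_qline_iff by metis
  ultimately show ?thesis unfolding twistor_def by blast
qed

lemma cline_rmult:
  assumes "c \<noteq> 0"
  shows "cline (z *\<^sub>h (c, 0)) = cline z"
proof (intro subset_antisym cline_subset)
  show "z *\<^sub>h (c, 0) \<in> cline z" by (auto simp: mem_cline_iff)
  have "z = z *\<^sub>h (c, 0) *\<^sub>h (1 / c, 0)"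
    using assms by (simp add: rmult_assoc qmult_complex flip: qone_def)
  then show "z \<in> cline (z *\<^sub>h (c, 0))" unfolding mem_cline_iff by blast
qed

lemma qline_rmult:
  assumes "q \<noteq> 0"
  shows "qline (z *\<^sub>h q) = qline z"
proof (intro subset_antisym qline_subset)
  show "z *\<^sub>h q \<in> qline z" unfolding mem_qline_iff by blast
  have "z = z *\<^sub>h q *\<^sub>h qinv q"
    using assms by (simp add: rmult_assoc qmult_qinv)
  then show "z \<in> qline (z *\<^sub>h q)" unfolding mem_qline_iff by blast
qed

lemma affine_point_qline: "affine_point x = qline (x, qone)"
  by (simp add: affine_point_def qline_def)

lemma qline_affine_point:
  assumes "snd z \<noteq> 0"
  shows "qline z = affine_point (fst z *\<^sub>q qinv (snd z))"
proof -
  have "z = (fst z *\<^sub>q qinv (snd z), qone) *\<^sub>h snd z"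
    by (simp add: rmult_def qmult_qinv_cancel assms)
  then show ?thesis unfolding affine_point_qline using qline_rmult[OF assms] by metis
qed

lemma mem_affine_point: "\<psi> \<in> affine_point x \<longleftrightarrow> fst \<psi> = x *\<^sub>q snd \<psi>"
proof
  show "fst \<psi> = x *\<^sub>q snd \<psi>" if "\<psi> \<in> affine_point x"
    using that by (auto simp: affine_point_qline mem_qline_iff rmult_def)
  show "\<psi> \<in> affine_point x" if "fst \<psi> = x *\<^sub>q snd \<psi>"
    unfolding affine_point_qline mem_qline_iff
    by (rule exI[of _ "snd \<psi>"]) (use that in \<open>simp add: rmult_def flip: that\<close>)
qed

lemma affine_point_inject: "affine_point x = affine_point y \<longleftrightarrow> x = y"
proof
  assume "affine_point x = affine_point y"
  then have "(x, qone) \<in> affine_point y" by (metis mem_affine_point fst_conv snd_conv qmult_one(2))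
  then show "x = y" by (simp add: mem_affine_point)
qed simp

lemma qline_eq_affine_pointD:
  assumes "z \<noteq> 0" "qline z = affine_point x"
  shows "snd z \<noteq> 0" "x = fst z *\<^sub>q qinv (snd z)"
proof -
  have "fst z = x *\<^sub>q snd z" using mem_qline[of z] assms(2) by (simp add: mem_affine_point)
  then show *: "snd z \<noteq> 0" using assms(1) prod_eqI[of z 0] by (auto simp: qmult_zero_right)
  show "x = fst z *\<^sub>q qinv (snd z)" using qline_affine_point[OF *] assms(2) affine_point_inject by auto
qed

lemma CP3_iff: "e \<in> CP3 \<longleftrightarrow> (\<exists>z. z \<noteq> 0 \<and> e = cline z)"
  unfolding CP3_def cline_def by blast

text \<open>Since conj(a) a is real and thus central, the form on the quaternionic line of
  \<open>z\<close> is the real number |z1|^2 - |z2|^2 times conj(p) q. Isotropy of the whole line is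
  decided by one generator.\<close>

lemma twistor_Q_iff:
  "e \<in> twistor_Q \<longleftrightarrow> (\<exists>z. z \<noteq> 0 \<and> norm (fst z) = norm (snd z) \<and> e = cline z)"
proof -
  have "qline z \<in> S3 \<longleftrightarrow> norm (fst z) = norm (snd z)" if z: "z \<noteq> 0" for z
  proof -
    have h: "hform (z *\<^sub>h p) (z *\<^sub>h q) = ((norm (fst z))\<^sup>2 - (norm (snd z))\<^sup>2) *\<^sub>R (qconj p *\<^sub>q q)" for p q
    proof -
      have "qconj (a *\<^sub>q p) *\<^sub>q (a *\<^sub>q q) = (norm a)\<^sup>2 *\<^sub>R (qconj p *\<^sub>q q)" for a
      proof -
        have "qconj (a *\<^sub>q p) *\<^sub>q (a *\<^sub>q q) = qconj p *\<^sub>q (qconj a *\<^sub>q a *\<^sub>q q)"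
          by (simp add: qconj_qmult qmult_assoc)
        then show ?thesis by (simp add: qmult_qconj qmult_linear_simps)
      qed
      then show ?thesis by (simp add: hform_def rmult_def scaleR_diff_left)
    qed
    have "norm (fst z) = norm (snd z)" if *: "\<forall>v\<in>qline z. \<forall>w\<in>qline z. hform v w = 0"
    proof -
      have "hform (z *\<^sub>h qone) (z *\<^sub>h qone) = 0" using * mem_qline[of z] by simp
      then have "((norm (fst z))\<^sup>2 - (norm (snd z))\<^sup>2) *\<^sub>R (qconj qone *\<^sub>q qone) = 0" unfolding h .
      moreover have "qconj qone = qone" by (simp add: qconj_def qone_def)
      ultimately show ?thesis by simp
    qed
    moreover have "qline z \<in> HP1" using z unfolding HP1_def qline_def by blast
    moreover have "hform v w = 0" if "norm (fst z) = norm (snd z)" "v \<in> qline z" "w \<in> qline z" for v w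
      using that h unfolding mem_qline_iff by auto
    ultimately show ?thesis unfolding S3_def by blast
  qed
  then show ?thesis unfolding twistor_Q_def mem_Collect_eq CP3_iff using twistor_cline by metis
qed

section \<open>The almost complex structure of a point of the twistor space\<close>

text \<open>A lift \<open>s\<close> satisfies s1 = (x + t X) s2, and differentiating gives the
  equation. Conversely, s2 may be taken affine in t with any slope, and s1 is then forced. So
  \<phi>1 - x \<phi>2 is the coordinate on H^2/l in which \<open>X\<close> acts by left
  multiplication.\<close>

lemma d_affine_point_eq:
  "d_affine_point x X = (\<lambda>\<psi>\<in>affine_point x. {\<phi>. fst \<phi> = X *\<^sub>q snd \<psi> + x *\<^sub>q snd \<phi>})"
proof -
  have "{\<phi>. \<exists>s. s 0 = \<psi> \<and> (\<forall>t. s t \<in> affine_point (x + t *\<^sub>R X)) \<and> (s has_vector_derivative \<phi>) (at 0)} =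
      {\<phi>. fst \<phi> = X *\<^sub>q snd \<psi> + x *\<^sub>q snd \<phi>}" if \<psi>: "\<psi> \<in> affine_point x" for \<psi>
  proof (intro subset_antisym subsetI CollectI)
    fix \<phi> assume "\<phi> \<in> {\<phi>. \<exists>s. s 0 = \<psi> \<and> (\<forall>t. s t \<in> affine_point (x + t *\<^sub>R X))
        \<and> (s has_vector_derivative \<phi>) (at 0)}"
    then obtain s where s: "s 0 = \<psi>" "\<And>t. fst (s t) = (x + t *\<^sub>R X) *\<^sub>q snd (s t)"
        "(s has_vector_derivative \<phi>) (at 0)"
      unfolding mem_affine_point by blast
    have d: "((\<lambda>t. fst (s t)) has_vector_derivative fst \<phi>) (at 0)"
        "((\<lambda>t. snd (s t)) has_vector_derivative snd \<phi>) (at 0)"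
      using bounded_linear.has_vector_derivative[OF bounded_linear_fst s(3)]
        bounded_linear.has_vector_derivative[OF bounded_linear_snd s(3)] by auto
    have "((\<lambda>t. x + t *\<^sub>R X) has_vector_derivative X) (at 0)"
      by (auto intro!: derivative_eq_intros)
    from bounded_bilinear.has_vector_derivative[OF bounded_bilinear_qmult this d(2)]
    have "((\<lambda>t. fst (s t)) has_vector_derivative (x *\<^sub>q snd \<phi> + X *\<^sub>q snd \<psi>)) (at 0)"
      using s(1) by (simp add: s(2))
    then show "fst \<phi> = X *\<^sub>q snd \<psi> + x *\<^sub>q snd \<phi>"
      using vector_derivative_unique_at[OF d(1)] by (simp add: add.commute)
  next
    fix \<phi> assume \<phi>: "\<phi> \<in> {\<phi>. fst \<phi> = X *\<^sub>q snd \<psi> + x *\<^sub>q snd \<phi>}"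
    define s where "s t = ((x + t *\<^sub>R X) *\<^sub>q (snd \<psi> + t *\<^sub>R snd \<phi>), snd \<psi> + t *\<^sub>R snd \<phi>)" for t
    have "((\<lambda>t. x + t *\<^sub>R X) has_vector_derivative X) (at 0)"
      "((\<lambda>t. snd \<psi> + t *\<^sub>R snd \<phi>) has_vector_derivative snd \<phi>) (at 0)"
      by (auto intro!: derivative_eq_intros)
    from has_vector_derivative_Pair[OF bounded_bilinear.has_vector_derivative[OF
        bounded_bilinear_qmult this] this(2)]
    have "(s has_vector_derivative (x *\<^sub>q snd \<phi> + X *\<^sub>q snd \<psi>, snd \<phi>)) (at 0)"
      unfolding s_def by simp
    moreover have "(x *\<^sub>q snd \<phi> + X *\<^sub>q snd \<psi>, snd \<phi>) = \<phi>"
      using \<phi> by (simp add: prod_eqI add.commute)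
    ultimately have "(s has_vector_derivative \<phi>) (at 0)" by simp
    moreover have "s 0 = \<psi>" using \<psi> by (simp add: s_def mem_affine_point prod_eq_iff)
    moreover have "\<forall>t. s t \<in> affine_point (x + t *\<^sub>R X)" by (simp add: s_def mem_affine_point)
    ultimately show "\<exists>s. s 0 = \<psi> \<and> (\<forall>t. s t \<in> affine_point (x + t *\<^sub>R X)) \<and> (s has_vector_derivative
        \<phi>) (at 0)"
      by blast
  qed
  then show ?thesis unfolding d_affine_point_def line_velocity_def by (auto simp: restrict_def fun_eq_iff)
qed

text \<open>
  The line of \<open>z\<close> spans the right \<open>i\<close>-eigenspace of \<open>\<J>\<close>; in the basis \<open>(x, 1)\<close> of the
  quaternionic line this is left multiplication by \<open>z\<^sub>2 i z\<^sub>2\<^sup>-\<^sup>1\<close>.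
\<close>

definition twist :: "quat2 \<Rightarrow> quat"
  where "twist z = snd z *\<^sub>q qi *\<^sub>q qinv (snd z)"

lemma twist_unit_imaginary:
  assumes "snd z \<noteq> 0"
  shows "Re (fst (twist z)) = 0" "norm (twist z) = 1"
proof -
  have *: "Re (fst (q *\<^sub>q qi *\<^sub>q qconj q)) = 0" for q
    by (simp add: qmult_def qconj_def algebra_simps)
  then show "Re (fst (twist z)) = 0" by (simp add: twist_def qinv_def qmult_scaleR_right)
  show "norm (twist z) = 1" using assms by (simp add: twist_def norm_qmult norm_qinv)
qed

lemma twist_qmult: "snd z \<noteq> 0 \<Longrightarrow> twist z *\<^sub>q snd z = snd z *\<^sub>q qi"
  by (simp add: twist_def qmult_qinv_cancel)

text \<open>A quaternionic linear map on l = zH is determined by its value at \<open>z\<close>,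
  which gives uniqueness. Left multiplication by \<open>twist z\<close> commutes with all right
  multiplications, and it is right multiplication by i on the complex line because i commutes with
  complex numbers.\<close>

lemma line_J_cline:
  assumes z: "snd z \<noteq> 0" and x: "x = fst z *\<^sub>q qinv (snd z)"
  shows "line_J (cline z) = (\<lambda>\<psi>\<in>affine_point x. (x *\<^sub>q (twist z *\<^sub>q snd \<psi>), twist z *\<^sub>q snd \<psi>))"
    (is "_ = ?J")
proof -
  have l: "twistor (cline z) = affine_point x"
    unfolding twistor_cline x by (rule qline_affine_point[OF z])
  have zx: "z = (x *\<^sub>q snd z, snd z)"
    using x z by (simp add: qmult_qinv_cancel)
  have add: "\<psi> + \<phi> \<in> affine_point x" if "\<psi> \<in> affine_point x" "\<phi> \<in> affine_point x" for \<psi> \<phi>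
    using that by (simp add: mem_affine_point qmult_add_right)
  have mult: "\<psi> *\<^sub>h q \<in> affine_point x" if "\<psi> \<in> affine_point x" for \<psi> q
    using that by (simp add: mem_affine_point rmult_def qmult_assoc)
  have e: "\<psi> \<in> affine_point x" if "\<psi> \<in> cline z" for \<psi>
    using that mult mem_qline[of z] twistor_cline[of z] l unfolding mem_cline_iff by metis
  show ?thesis
    unfolding line_J_def Let_def l
  proof (rule the_equality, intro conjI ballI allI)
    show "?J \<in> affine_point x \<rightarrow>\<^sub>E affine_point x" by (auto simp: mem_affine_point)
    show "?J (\<psi> + \<phi>) = ?J \<psi> + ?J \<phi>" if "\<psi> \<in> affine_point x" "\<phi> \<in> affine_point x" for \<psi> \<phi>
      using that add by (simp add: qmult_add_right)
    show "?J (\<psi> *\<^sub>h q) = ?J \<psi> *\<^sub>h q" if "\<psi> \<in> affine_point x" for \<psi> q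
      using that mult by (simp add: qmult_assoc rmult_def)
    show "?J \<psi> = rmult_i \<psi>" if \<psi>: "\<psi> \<in> cline z" for \<psi>
    proof -
      obtain c where c: "\<psi> = z *\<^sub>h (c, 0)" using \<psi> unfolding mem_cline_iff by blast
      have "twist z *\<^sub>q snd \<psi> = snd \<psi> *\<^sub>q qi"
      proof -
        have "twist z *\<^sub>q snd \<psi> = snd z *\<^sub>q (qi *\<^sub>q (c, 0))"
          using twist_qmult[OF z] by (simp add: c rmult_def flip: qmult_assoc)
        also have "qi *\<^sub>q (c, 0) = (c, 0) *\<^sub>q qi" by (simp add: qmult_def)
        finally show ?thesis by (simp add: c rmult_def qmult_assoc)
      qed
      moreover have "fst \<psi> = x *\<^sub>q snd \<psi>" using e[OF \<psi>] mem_affine_point by auto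
      ultimately show ?thesis using e[OF \<psi>] by (simp add: rmult_i_def rmult_def qmult_assoc)
    qed
  next
    fix J assume J: "J \<in> affine_point x \<rightarrow>\<^sub>E affine_point x \<and>
      (\<forall>\<psi>\<in>affine_point x. \<forall>\<phi>\<in>affine_point x. J (\<psi> + \<phi>) = J \<psi> + J \<phi>) \<and>
      (\<forall>\<psi>\<in>affine_point x. \<forall>q. J (\<psi> *\<^sub>h q) = J \<psi> *\<^sub>h q) \<and> (\<forall>\<psi>\<in>cline z. J \<psi> = rmult_i \<psi>)"
    show "J = ?J"
    proof
      fix \<psi>
      show "J \<psi> = ?J \<psi>"
      proof (cases "\<psi> \<in> affine_point x")
        case True
        define q where "q = qinv (snd z) *\<^sub>q snd \<psi>"
        have q: "\<psi> = z *\<^sub>h q"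
          using True z by (subst zx) (simp add: mem_affine_point rmult_def q_def qmult_assoc
              qmult_qinv_cancel prod_eq_iff)
        have "J \<psi> = rmult_i z *\<^sub>h q"
          using J e[OF mem_cline] mem_cline[of z] unfolding q by metis
        also have "\<dots> = (x *\<^sub>q (twist z *\<^sub>q snd \<psi>), twist z *\<^sub>q snd \<psi>)"
          by (subst zx) (simp add: rmult_i_def rmult_def q_def twist_def qmult_assoc)
        finally show ?thesis using True by simp
      next
        case False
        \<comment> \<open>Outside the line both functions take the default value of extensional
          functions.\<close>
        have "J \<in> affine_point x \<rightarrow>\<^sub>E affine_point x" using J by blast
        from PiE_arb[OF this False] show ?thesis using False by simp
      qed
    qed
  qed
qed

text \<open>Precomposition sends \<psi>2 to \<open>twist z\<close> times \<psi>2 before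
  \<open>X\<close> multiplies from the left; by associativity \<open>X\<close> itself is multiplied
  by \<open>twist z\<close> from the right. Evaluating the coset at \<open>(x, qone)\<close>
  recovers the tangent vector.\<close>

lemma acs_cline:
  assumes z: "snd z \<noteq> 0" and x: "x = fst z *\<^sub>q qinv (snd z)"
  shows "acs (cline z) x X = X *\<^sub>q twist z"
proof -
  have l: "twistor (cline z) = affine_point x"
    unfolding twistor_cline x by (rule qline_affine_point[OF z])
  have "hom_J (cline z) (d_affine_point x X) = (\<lambda>\<psi>\<in>affine_point x. {\<phi>. fst \<phi>
      = X *\<^sub>q (twist z *\<^sub>q snd \<psi>) + x *\<^sub>q snd \<phi>})"
    unfolding hom_J_def l line_J_cline[OF assms] d_affine_point_eq
    by (auto simp: fun_eq_iff restrict_def mem_affine_point)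
  then have h: "hom_J (cline z) (d_affine_point x X) = d_affine_point x (X *\<^sub>q twist z)"
    unfolding d_affine_point_eq by (simp add: qmult_assoc)
  have "Y = Y'" if "d_affine_point x Y = d_affine_point x Y'" for Y Y'
  proof -
    have "(x, qone) \<in> affine_point x" by (simp add: mem_affine_point)
    then have "{\<phi>. fst \<phi> = Y + x *\<^sub>q snd \<phi>} = {\<phi>. fst \<phi> = Y' + x *\<^sub>q snd \<phi>}"
      using fun_cong[OF that, of "(x, qone)"] by (simp add: d_affine_point_eq)
    then have "(Y, 0) \<in> {\<phi>. fst \<phi> = Y' + x *\<^sub>q snd \<phi>}"
      by (metis (mono_tags, lifting) mem_Collect_eq fst_conv snd_conv qmult_zero_right add_0_right)
    then show ?thesis by (simp add: qmult_zero_right)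
  qed
  then show ?thesis unfolding acs_def h by (intro the_equality) auto
qed

text \<open>The reference frames (X, J X, Y, J Y) never have negative determinant, so a positive
  product forces the sign of the other factor. For the converse a single reference frame with
  positive determinant suffices.\<close>

lemma S3_orientation_iff: "S3_orientation x X1 X2 X3 \<longleftrightarrow> frame_det x X1 X2 X3 > 0"
proof
  assume "S3_orientation x X1 X2 X3"
  then obtain e X Y where e: "e \<in> CP3" "twistor e = affine_point x"
    and pos: "frame_det X (acs e x X) Y (acs e x Y) * frame_det x X1 X2 X3 > 0"
    unfolding S3_orientation_def HP1_positive_def unit_normal_def by blast
  obtain z where z: "z \<noteq> 0" "e = cline z" using e(1) CP3_iff by auto
  then have "qline z = affine_point x" using e(2) twistor_cline by simp
  note zz = qline_eq_affine_pointD[OF z(1) this]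
  have "frame_det X (acs e x X) Y (acs e x Y) \<ge> 0"
    unfolding z(2) acs_cline[OF zz] using frame_det_qmult_nonneg twist_unit_imaginary[OF zz(1)] by auto
  then show "frame_det x X1 X2 X3 > 0" using pos by (metis zero_less_mult_iff not_le)
next
  assume pos: "frame_det x X1 X2 X3 > 0"
  let ?z = "(x, qone)" and ?j = "(0, 1) :: quat"
  have q1: "qinv qone = qone" using qmult_qinv(1)[of qone] by simp
  then have z: "snd ?z \<noteq> 0" "x = fst ?z *\<^sub>q qinv (snd ?z)" by simp_all
  have tw: "twist ?z = qi" using q1 by (simp add: twist_def)
  \<comment> \<open>For the line of (x, 1) the structure is right multiplication by i, and the frame
    1, i, j, j i is the standard basis of the coordinates.\<close>
  have "frame_det qone (acs (cline ?z) x qone) ?j (acs (cline ?z) x ?j) = 1"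
    unfolding acs_cline[OF z] tw
    by (simp add: frame_det_def Let_def det_4 vector_4 qone_def qmult_def)
  moreover have "cline ?z \<in> CP3" unfolding CP3_iff by (intro exI[of _ ?z]) (auto simp: prod_eq_iff qone_def)
  moreover have "twistor (cline ?z) = affine_point x" unfolding twistor_cline affine_point_qline ..
  ultimately show "S3_orientation x X1 X2 X3"
    unfolding S3_orientation_def HP1_positive_def unit_normal_def using pos
    by (intro bexI[of _ "cline ?z"] conjI exI[of _ qone] exI[of _ ?j]) auto
qed

text \<open>The vector w p is orthogonal to x, x p and w, has the length of w, and (x, x p, w, w p)
  is a complex frame, hence positive. For uniqueness, a candidate is a multiple of w p by dimension;
  its length leaves the factors 1 and -1, and the orientation excludes -1. The condition on
  \<open>s\<close> says that \<open>s *\<^sub>R (x *\<^sub>q p)\<close> has unit length for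
  \<open>g\<close>.\<close>

lemma cross_product_sphere:
  assumes g: "\<And>u v. u \<bullet> x = 0 \<Longrightarrow> v \<bullet> x = 0 \<Longrightarrow> g x u v = f * (u \<bullet> v)"
    and f: "f > 0" "s > 0" "f * s\<^sup>2 = 1" and x: "x \<in> unit_sphere"
    and p: "Re (fst p) = 0" "norm p = 1"
    and w: "w \<bullet> x = 0" "w \<bullet> (x *\<^sub>q p) = 0"
  shows "cross_product unit_sphere g S3_orientation x (s *\<^sub>R (x *\<^sub>q p)) w = w *\<^sub>q p"
proof -
  have x1: "x \<bullet> x = 1" using inner_unit[OF x] .
  have ip: "(Y *\<^sub>q p) \<bullet> (Y *\<^sub>q p) = Y \<bullet> Y" "Y \<bullet> (Y *\<^sub>q p) = 0" "(Y *\<^sub>q p) \<bullet> Y = 0" for Y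
    using inner_qmult_imaginary(1)[OF p, of Y] p
    by (simp_all add: inner_qmult_cancel_right inner_commute[of "Y *\<^sub>q p" Y])
  have wp: "(w *\<^sub>q p) \<bullet> x = 0" "(w *\<^sub>q p) \<bullet> (x *\<^sub>q p) = 0"
    using inner_qmult_imaginary(2)[OF p, of w x] w p by (simp_all add: inner_qmult_cancel_right)
  \<comment> \<open>As the first factor is a \<open>g\<close>-unit vector orthogonal to
    \<open>w\<close>, the area condition loses its conformal factor and becomes Euclidean.\<close>
  have norm_cond: "g x u u = g x (s *\<^sub>R (x *\<^sub>q p)) (s *\<^sub>R (x *\<^sub>q p)) * g x w w - (g x (s *\<^sub>R (x *\<^sub>q p)) w)\<^sup>2
      \<longleftrightarrow> u \<bullet> u = w \<bullet> w" if "u \<bullet> x = 0" for u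
  proof -
    have "g x (s *\<^sub>R (x *\<^sub>q p)) (s *\<^sub>R (x *\<^sub>q p)) = 1"
      using f(3) g ip x1 by (simp add: power2_eq_square)
    moreover have "g x (s *\<^sub>R (x *\<^sub>q p)) w = 0" using g ip w by (simp add: inner_commute)
    ultimately show ?thesis using g that w f(1) by simp
  qed
  \<comment> \<open>One formula gives the orientation of w p itself (c = 1) and later the sign of
    the factor \<open>c\<close> of a candidate.\<close>
  have fd: "frame_det x (s *\<^sub>R (x *\<^sub>q p)) w (c *\<^sub>R (w *\<^sub>q p)) = s * c * (w \<bullet> w)" for c
    using w by (simp add: frame_det_scale frame_det_qmult[OF p] x1 inner_commute)
  show ?thesis
    unfolding cross_product_def tspace_sphere[OF x] S3_orientation_iff mem_Collect_eq
  proof (rule the_equality)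
    have "frame_det x (s *\<^sub>R (x *\<^sub>q p)) w (w *\<^sub>q p) = s * (w \<bullet> w)" using fd[of 1] by simp
    moreover have "w \<bullet> w > 0" if "w *\<^sub>q p \<noteq> 0" using that by (auto simp: qmult_zero_left)
    ultimately show "(w *\<^sub>q p) \<bullet> x = 0 \<and> g x (w *\<^sub>q p) (s *\<^sub>R (x *\<^sub>q p)) = 0 \<and> g x (w *\<^sub>q p) w = 0 \<and>
      g x (w *\<^sub>q p) (w *\<^sub>q p) = g x (s *\<^sub>R (x *\<^sub>q p)) (s *\<^sub>R (x *\<^sub>q p)) * g x w w - (g x (s *\<^sub>R (x
          *\<^sub>q p)) w)\<^sup>2 \<and>
      (w *\<^sub>q p \<noteq> 0 \<longrightarrow> 0 < frame_det x (s *\<^sub>R (x *\<^sub>q p)) w (w *\<^sub>q p))"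
      unfolding norm_cond[OF wp(1)] using g ip w wp f by simp
  next
    fix u assume u: "u \<bullet> x = 0 \<and> g x u (s *\<^sub>R (x *\<^sub>q p)) = 0 \<and> g x u w = 0 \<and>
      g x u u = g x (s *\<^sub>R (x *\<^sub>q p)) (s *\<^sub>R (x *\<^sub>q p)) * g x w w - (g x (s *\<^sub>R (x *\<^sub>q p)) w)\<^sup>2 \<and>
      (u \<noteq> 0 \<longrightarrow> 0 < frame_det x (s *\<^sub>R (x *\<^sub>q p)) w u)"
    then have ux: "u \<bullet> x = 0" by simp
    have u1: "u \<bullet> (x *\<^sub>q p) = 0" "u \<bullet> w = 0"
      using u g[OF ux, of "s *\<^sub>R (x *\<^sub>q p)"] g[OF ux w(1)] ip(3)[of x] f(1,2) by simp_all
    have uu: "u \<bullet> u = w \<bullet> w" using u norm_cond[OF ux] by simp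
    show "u = w *\<^sub>q p"
    proof (cases "w = 0")
      case True
      then show ?thesis using uu by (simp add: qmult_zero_left)
    next
      case False
      then have ww: "w \<bullet> w > 0" by simp
      have ne: "x \<noteq> 0" "x *\<^sub>q p \<noteq> 0" "w *\<^sub>q p \<noteq> 0"
        using x1 ip(1)[of x] ip(1)[of w] ww by (metis inner_zero_left zero_neq_one less_irrefl)+
      have d: "x \<noteq> x *\<^sub>q p" "x \<noteq> w" "x *\<^sub>q p \<noteq> w" "w *\<^sub>q p \<noteq> x" "w *\<^sub>q p \<noteq> x *\<^sub>q p" "w *\<^sub>q p \<noteq> w"
        using ip(2)[of x] ip(2)[of w] w wp ne False x1 by (metis inner_eq_zero_iff)+
      have "u = ((u \<bullet> (w *\<^sub>q p)) / ((w *\<^sub>q p) \<bullet> (w *\<^sub>q p))) *\<^sub>R (w *\<^sub>q p)"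
      proof (rule orthogonal_complement_line[where B="{x, x *\<^sub>q p, w}"])
        show "pairwise orthogonal {w *\<^sub>q p, x, x *\<^sub>q p, w}"
          using w wp ip by (auto simp: pairwise_def orthogonal_def inner_commute)
        show "orthogonal u b" if "b \<in> {x, x *\<^sub>q p, w}" for b
          using that ux u1 by (auto simp: orthogonal_def)
        show "Suc (card {x, x *\<^sub>q p, w}) = DIM(quat)" using d by simp
      qed (use ne False d in auto)
      then obtain c where c: "u = c *\<^sub>R (w *\<^sub>q p)" by blast
      then have "c\<^sup>2 * (w \<bullet> w) = w \<bullet> w" using uu by (simp add: ip power2_eq_square mult.assoc)
      then have "c\<^sup>2 = 1" using ww by simp
      moreover have "c > 0"
      proof -
        have "u \<noteq> 0" using uu ww by auto
        then have "s * c * (w \<bullet> w) > 0" using u fd[of c] c by simp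
        then show ?thesis using f(2) ww by (simp add: zero_less_mult_iff)
      qed
      ultimately have "c = 1" by (metis less_le power2_eq_1_iff neg_0_le_iff_le not_one_le_zero)
      then show ?thesis using c by simp
    qed
  qed
qed

section \<open>Curves in the twistor space\<close>

definition CP3_coords :: "(quat2 \<Rightarrow> complex) set"
  where "CP3_coords = {fst \<circ> fst, snd \<circ> fst, fst \<circ> snd, snd \<circ> snd}"

lemma bounded_linear_coord: "k \<in> CP3_coords \<Longrightarrow> bounded_linear k"
  unfolding CP3_coords_def o_def
  by (auto intro: bounded_linear_compose[OF bounded_linear_fst bounded_linear_fst]
      bounded_linear_compose[OF bounded_linear_snd bounded_linear_fst]
      bounded_linear_compose[OF bounded_linear_fst bounded_linear_snd]
      bounded_linear_compose[OF bounded_linear_snd bounded_linear_snd])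

lemma coord_rmult: "k \<in> CP3_coords \<Longrightarrow> k (z *\<^sub>h (c, 0)) = k z * c"
  by (auto simp: CP3_coords_def rmult_def qmult_def)

lemma coord_nonzero_exists:
  assumes "z \<noteq> 0"
  obtains k where "k \<in> CP3_coords" "k z \<noteq> 0"
proof -
  have "z = 0" if "\<forall>k\<in>CP3_coords. k z = 0" using that by (auto simp: CP3_coords_def prod_eq_iff)
  then show ?thesis using assms that by blast
qed

lemma coord_nonzero: "k \<in> CP3_coords \<Longrightarrow> k z \<noteq> 0 \<Longrightarrow> z \<noteq> 0"
  by (auto simp: CP3_coords_def)

lemma chart_domain:
  assumes "k \<in> CP3_coords" "z \<noteq> 0"
  shows "cline z \<in> fst (CP3_chart k) \<longleftrightarrow> k z \<noteq> 0"
proof -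
  have "(\<exists>y\<in>cline z. k y = 1) \<longleftrightarrow> (\<exists>c. k (z *\<^sub>h (c, 0)) = 1)"
    unfolding Bex_def mem_cline_iff by metis
  also have "\<dots> \<longleftrightarrow> (\<exists>c. k z * c = 1)" using coord_rmult[OF assms(1)] by simp
  also have "\<dots> \<longleftrightarrow> k z \<noteq> 0" using right_inverse by force
  moreover have "cline z \<in> CP3" using CP3_iff assms(2) by blast
  ultimately show ?thesis by (simp add: CP3_chart_def)
qed

lemma chart_value:
  assumes k: "k \<in> CP3_coords" and z: "k z \<noteq> 0"
  shows "snd (CP3_chart k) (cline z) = z *\<^sub>h (inverse (k z), 0)"
  unfolding CP3_chart_def snd_conv
proof (rule the_equality)
  show "z *\<^sub>h (inverse (k z), 0) \<in> cline z \<and> k (z *\<^sub>h (inverse (k z), 0)) = 1"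
    using z coord_rmult[OF k] by (auto simp: mem_cline_iff)
  fix y assume y: "y \<in> cline z \<and> k y = 1"
  then obtain c where c: "y = z *\<^sub>h (c, 0)" unfolding mem_cline_iff by blast
  then have "k z * c = 1" using y coord_rmult[OF k] by simp
  then have "c = inverse (k z)" using z by (simp add: field_simps)
  then show "y = z *\<^sub>h (inverse (k z), 0)" using c by simp
qed

lemma CP3_atlasE:
  assumes "c \<in> CP3_atlas"
  obtains k where "k \<in> CP3_coords" "c = CP3_chart k"
  using assms unfolding CP3_atlas_def CP3_coords_def[symmetric] by (rule imageE) blast

lemma CP3_chart_in_atlas: "k \<in> CP3_coords \<Longrightarrow> CP3_chart k \<in> CP3_atlas"
  unfolding CP3_atlas_def CP3_coords_def[symmetric] by (rule imageI)

text \<open>The quotient rule for the derivative of z / k(z), the homogeneous form of the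
  chart.\<close>

definition dchart :: "(quat2 \<Rightarrow> complex) \<Rightarrow> quat2 \<Rightarrow> quat2 \<Rightarrow> quat2"
  where "dchart k z \<zeta> = \<zeta> *\<^sub>h (inverse (k z), 0) - z *\<^sub>h (inverse (k z) * k \<zeta> * inverse (k z), 0)"

lemma velocity_chart:
  assumes k: "k \<in> CP3_coords" and y: "(y has_vector_derivative \<zeta>) (at 0)" "k (y 0) \<noteq> 0"
    and \<gamma>: "eventually (\<lambda>t. \<gamma> t = cline (y t)) (nhds 0)"
  shows "velocity CP3_atlas \<gamma> (CP3_chart k) = dchart k (y 0) \<zeta>"
proof -
  note \<gamma>0 = eventually_nhds_x_imp_x[OF \<gamma>]
  have dk: "((\<lambda>t. k (y t)) has_vector_derivative k \<zeta>) (at 0)"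
    by (rule bounded_linear.has_vector_derivative[OF bounded_linear_coord[OF k] y(1)])
  then have "((\<lambda>t. k (y t)) \<longlongrightarrow> k (y 0)) (at 0)"
    using has_vector_derivative_continuous continuous_within by blast
  from tendsto_imp_eventually_ne[OF this y(2)] have "eventually (\<lambda>t. k (y t) \<noteq> 0) (nhds 0)"
    using y(2) by (simp add: eventually_nhds_conv_at)
  then have ev: "eventually (\<lambda>t. snd (CP3_chart k) (\<gamma> t) = y t *\<^sub>h (inverse (k (y t)), 0)) (nhds 0)"
    using \<gamma> by eventually_elim (simp add: chart_value[OF k])
  have "((\<lambda>t. inverse (k (y t))) has_vector_derivative - (inverse (k (y 0)) * k \<zeta> * inverse (k (y
      0)))) (at 0)"
    using has_derivative_along_curve[OF dk has_derivative_inverse'[of "k (y 0)" UNIV]] y(2) by simp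
  then have "((\<lambda>t. (inverse (k (y t)), 0::complex)) has_vector_derivative
      (- (inverse (k (y 0)) * k \<zeta> * inverse (k (y 0))), 0)) (at 0)"
    by (intro has_vector_derivative_Pair has_vector_derivative_const)
  from bounded_bilinear.has_vector_derivative[OF bounded_bilinear_rmult y(1) this]
  have "((\<lambda>t. y t *\<^sub>h (inverse (k (y t)), 0)) has_vector_derivative dchart k (y 0) \<zeta>) (at 0)"
    using bounded_bilinear.minus_right[OF bounded_bilinear_rmult, of "y 0" "(inverse (k (y 0)) * k \<zeta>
        * inverse (k (y 0)), 0)"]
    by (simp add: dchart_def add.commute)
  then have "(snd (CP3_chart k) \<circ> \<gamma> has_vector_derivative dchart k (y 0) \<zeta>) (at 0)"
    using has_vector_derivative_cong_nhds[OF ev] by (simp add: o_def)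
  moreover have "\<gamma> 0 \<in> fst (CP3_chart k)" using \<gamma>0 chart_domain[OF k coord_nonzero[OF k y(2)]] y(2) by simp
  ultimately show ?thesis unfolding velocity_def using CP3_chart_in_atlas[OF k]
      by (simp add: vector_derivative_at)
qed

text \<open>The tangent vector of \<open>CP3\<close> at the line of \<open>z\<close> represented by \<open>\<zeta>\<close> modulo the line.\<close>

definition cvec :: "quat2 \<Rightarrow> quat2 \<Rightarrow> (quat2 set, quat2) tvec"
  where "cvec z \<zeta> = velocity CP3_atlas (\<lambda>t. cline (z + t *\<^sub>R \<zeta>))"

lemma cvec_chart:
  assumes "k \<in> CP3_coords" "k z \<noteq> 0"
  shows "cvec z \<zeta> (CP3_chart k) = dchart k z \<zeta>"
proof -
  have "((\<lambda>t. z + t *\<^sub>R \<zeta>) has_vector_derivative \<zeta>) (at 0)" by (auto intro!: derivative_eq_intros)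
  from velocity_chart[OF assms(1) this, of "\<lambda>t. cline (z + t *\<^sub>R \<zeta>)"] assms(2)
  show ?thesis unfolding cvec_def by simp
qed

lemma cvec_outside:
  assumes "z \<noteq> 0" "\<And>k. k \<in> CP3_coords \<Longrightarrow> k z \<noteq> 0 \<Longrightarrow> c \<noteq> CP3_chart k"
  shows "cvec z \<zeta> c = 0"
proof -
  have "\<not> (c \<in> CP3_atlas \<and> cline z \<in> fst c)"
    using assms chart_domain by (metis CP3_atlasE)
  then show ?thesis unfolding cvec_def velocity_def by auto
qed

text \<open>Tangent vectors are total functions of the chart, so equality must also be checked where
  they take the default value 0: at charts that miss the point and at arguments outside the
  atlas.\<close>

lemma tvec_eqI:
  assumes "z \<noteq> 0" "\<And>k. k \<in> CP3_coords \<Longrightarrow> k z \<noteq> 0 \<Longrightarrow> X (CP3_chart k) = Y (CP3_chart k)"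
    and "\<And>c. (\<And>k. k \<in> CP3_coords \<Longrightarrow> k z \<noteq> 0 \<Longrightarrow> c \<noteq> CP3_chart k) \<Longrightarrow> X c = Y c"
  shows "X = Y"
  using assms by (metis ext)

lemma velocity_cline:
  assumes y: "(y has_vector_derivative \<zeta>) (at 0)" "y 0 \<noteq> 0"
    and \<gamma>: "eventually (\<lambda>t. \<gamma> t = cline (y t)) (nhds 0)"
  shows "velocity CP3_atlas \<gamma> = cvec (y 0) \<zeta>"
proof (rule tvec_eqI[OF y(2)])
  show "velocity CP3_atlas \<gamma> (CP3_chart k) = cvec (y 0) \<zeta> (CP3_chart k)" if "k \<in> CP3_coords"
      "k (y 0) \<noteq> 0" for k
    using velocity_chart[OF that(1) y(1) that(2) \<gamma>] cvec_chart[OF that] by simp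
  fix c assume c: "\<And>k. k \<in> CP3_coords \<Longrightarrow> k (y 0) \<noteq> 0 \<Longrightarrow> c \<noteq> CP3_chart k"
  have "\<gamma> 0 = cline (y 0)" using eventually_nhds_x_imp_x[OF \<gamma>] .
  then have "\<not> (c \<in> CP3_atlas \<and> \<gamma> 0 \<in> fst c)"
    using c chart_domain[OF _ y(2)] by (metis CP3_atlasE)
  then show "velocity CP3_atlas \<gamma> c = cvec (y 0) \<zeta> c"
    using cvec_outside[OF y(2) c] unfolding velocity_def by auto
qed

lemma linear_dchart:
  assumes "k \<in> CP3_coords"
  shows "linear (dchart k z)"
proof -
  note lk = bounded_linear.linear[OF bounded_linear_coord[OF assms]]
  have 1: "((a + b, 0) :: quat) = (a, 0) + (b, 0)" "((r *\<^sub>R a, 0) :: quat) = r *\<^sub>R (a, 0)" for a b r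
      by simp_all
  show ?thesis
    unfolding dchart_def
    by (intro linearI)
      (simp_all only: linear_add[OF lk] linear_scale[OF lk] distrib_left distrib_right mult_scaleR_left
        mult_scaleR_right 1 bounded_bilinear.add_left[OF bounded_bilinear_rmult]
        bounded_bilinear.add_right[OF bounded_bilinear_rmult] bounded_bilinear.scaleR_left[OF
            bounded_bilinear_rmult]
        bounded_bilinear.scaleR_right[OF bounded_bilinear_rmult] add_diff_add scaleR_diff_right)
qed

lemma dchart_rmult:
  assumes "k \<in> CP3_coords"
  shows "dchart k z (\<zeta> *\<^sub>h (c, 0)) = dchart k z \<zeta> *\<^sub>h (c, 0)"
  by (simp add: dchart_def rmult_diff_left rmult_assoc qmult_complex coord_rmult[OF assms] mult_ac)

lemma cvec_add:
  assumes "z \<noteq> 0"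
  shows "cvec z (\<zeta> + \<eta>) = (\<lambda>c. cvec z \<zeta> c + cvec z \<eta> c)"
  by (rule tvec_eqI[OF assms])
    (simp_all add: cvec_chart linear_add[OF linear_dchart] cvec_outside[OF assms] add_0)

lemma cvec_scaleR:
  assumes "z \<noteq> 0"
  shows "cvec z (r *\<^sub>R \<zeta>) = (\<lambda>c. r *\<^sub>R cvec z \<zeta> c)"
  by (rule tvec_eqI[OF assms])
    (simp_all add: cvec_chart linear_scale[OF linear_dchart] cvec_outside[OF assms] scaleR_zero_right)

lemma CP3_J_cvec:
  assumes "z \<noteq> 0"
  shows "CP3_J (cvec z \<zeta>) = cvec z (\<zeta> *\<^sub>h qi)"
  unfolding CP3_J_def rmult_i_def
  by (rule tvec_eqI[OF assms])
    (simp_all add: cvec_chart dchart_rmult cvec_outside[OF assms] rmult_zero_left)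

lemma cvec_rmult_self:
  assumes "z \<noteq> 0"
  shows "cvec z (z *\<^sub>h (c, 0)) = (\<lambda>_. 0)"
proof (rule tvec_eqI[OF assms])
  fix k assume k: "k \<in> CP3_coords" "k z \<noteq> 0"
  then show "cvec z (z *\<^sub>h (c, 0)) (CP3_chart k) = 0"
    by (simp add: cvec_chart dchart_def rmult_assoc qmult_complex coord_rmult[OF k(1)] mult_ac)
qed (simp add: cvec_outside[OF assms])

text \<open>The kernel of \<open>dchart k z\<close> consists of the complex multiples of
  \<open>z\<close>, the factor being the quotient of the \<open>k\<close>-coordinates.\<close>

lemma cvec_eqD:
  assumes "z \<noteq> 0" "cvec z \<zeta> = cvec z \<eta>"
  obtains c where "\<zeta> = \<eta> + z *\<^sub>h (c, 0)"
proof -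
  obtain k where k: "k \<in> CP3_coords" "k z \<noteq> 0" using coord_nonzero_exists[OF assms(1)] .
  have "dchart k z (\<zeta> - \<eta>) = 0"
    using cvec_chart[OF k] assms(2) linear_diff[OF linear_dchart[OF k(1)]] by (metis eq_iff_diff_eq_0)
  then have "(\<zeta> - \<eta>) *\<^sub>h (inverse (k z), 0) *\<^sub>h (k z, 0) =
      z *\<^sub>h (inverse (k z) * k (\<zeta> - \<eta>) * inverse (k z), 0) *\<^sub>h (k z, 0)"
    by (simp add: dchart_def)
  then have "\<zeta> - \<eta> = z *\<^sub>h (inverse (k z) * k (\<zeta> - \<eta>), 0)"
    using k(2) by (simp add: rmult_assoc qmult_complex mult.assoc flip: qone_def)
  then show ?thesis using that by (metis add.commute diff_add_cancel)
qed

section \<open>Curves in the hypersurface\<close>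

abbreviation null_cone :: "quat2 set"
  where "null_cone \<equiv> {z. z \<noteq> 0 \<and> norm (fst z) = norm (snd z)}"

lemma coneD: "z \<in> null_cone \<Longrightarrow> fst z \<noteq> 0 \<and> snd z \<noteq> 0"
  using prod_eqI[of z 0] by auto

lemma cone_rmult: "z \<in> null_cone \<Longrightarrow> c \<noteq> 0 \<Longrightarrow> z *\<^sub>h (c, 0) \<in> null_cone"
  using rmult_eq_0_iff[of z "(c, 0)"] by (auto simp: norm_qmult rmult_def zero_prod_def)

lemma cline_in_twistor_Q: "z \<in> null_cone \<Longrightarrow> cline z \<in> twistor_Q"
  unfolding twistor_Q_iff by blast

lemma twistor_QE:
  assumes "e \<in> twistor_Q"
  obtains z where "z \<in> null_cone" "e = cline z"
  using assms unfolding twistor_Q_iff by blast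

text \<open>The cone is stable under nonzero complex factors, so a chart of CP3 is itself a local
  section of the cone over Q.\<close>

lemma chart_twistor_Q:
  assumes k: "k \<in> CP3_coords" and e: "e \<in> fst (CP3_chart k)" "e \<in> twistor_Q"
  shows "snd (CP3_chart k) e \<in> null_cone" "e = cline (snd (CP3_chart k) e)"
proof -
  obtain z where z: "z \<in> null_cone" "e = cline z" using twistor_QE[OF e(2)] .
  then have kz: "k z \<noteq> 0" using chart_domain[OF k] e(1) by auto
  then have v: "snd (CP3_chart k) e = z *\<^sub>h (inverse (k z), 0)" using chart_value[OF k] z(2) by simp
  show "snd (CP3_chart k) e \<in> null_cone" unfolding v using kz by (intro cone_rmult z(1)) simp
  show "e = cline (snd (CP3_chart k) e)" using v z(2) cline_rmult[of "inverse (k z)" z] kz by simp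
qed

lemma smooth_arcI:
  assumes "open W" "0 \<in> W" "\<And>t. t \<in> W \<Longrightarrow> \<gamma> t \<in> U" "C_inf_on W (\<lambda>t. \<phi> (\<gamma> t))"
  shows "smooth_arc U \<phi> \<gamma>"
proof -
  obtain \<epsilon> where \<epsilon>: "\<epsilon> > 0" "ball 0 \<epsilon> \<subseteq> W" using assms(1,2) open_contains_ball by blast
  moreover have "ball 0 \<epsilon> = {-\<epsilon><..<\<epsilon>}" by (simp add: ball_eq_greaterThanLessThan)
  ultimately show ?thesis
    unfolding smooth_arc_def o_def using assms(3,4) by (intro exI[of _ \<epsilon>]) (auto intro: C_inf_on_subset)
qed

lemma cline_curve:
  assumes W: "open W" "0 \<in> W" and y: "C_inf_on W y" "\<And>t. t \<in> W \<Longrightarrow> y t \<in> null_cone"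
  shows "(\<lambda>t. cline (y t)) \<in> curves_at CP3_atlas twistor_Q (cline (y 0))"
proof -
  have "y 0 \<noteq> 0" using y(2)[OF W(2)] by simp
  then obtain k where k: "k \<in> CP3_coords" "k (y 0) \<noteq> 0" using coord_nonzero_exists by blast
  have ky: "C_inf_on W (\<lambda>t. k (y t))"
    by (rule C_inf_on_linear_compose[OF bounded_linear_coord[OF k(1)] W(1) y(1)])
  define V where "V = W \<inter> (\<lambda>t. k (y t)) -` (- {0})"
  have V: "open V" unfolding V_def
    by (rule continuous_open_preimage[OF C_inf_on_continuous[OF ky] W(1)]) auto
  have V0: "0 \<in> V" using W(2) k(2) unfolding V_def by auto
  have sub: "C_inf_on V y" "C_inf_on V (\<lambda>t. k (y t))"
    using C_inf_on_subset y(1) ky unfolding V_def by blast+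
  have "C_inf_on V (\<lambda>t. y t *\<^sub>h (inverse (k (y t)), 0))"
    by (rule C_inf_on_bilinear[OF bounded_bilinear_rmult V sub(1) C_inf_on_Pair[OF V
        C_inf_on_inverse[OF V sub(2)] C_inf_on_const[OF V]]])
      (auto simp: V_def)
  then have "C_inf_on V (\<lambda>t. snd (CP3_chart k) (cline (y t)))"
    by (rule C_inf_on_cong[OF V, rotated]) (simp add: chart_value[OF k(1)] V_def)
  moreover have "cline (y t) \<in> fst (CP3_chart k) \<inter> twistor_Q" if "t \<in> V" for t
    using that y(2)[of t] chart_domain[OF k(1), of "y t"] cline_in_twistor_Q[of "y t"]
        unfolding V_def by auto
  ultimately have "smooth_arc (fst (CP3_chart k) \<inter> twistor_Q) (snd (CP3_chart k)) (\<lambda>t. cline (y t))"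
    by (intro smooth_arcI[OF V V0])
  then show ?thesis unfolding curves_at_def using CP3_chart_in_atlas[OF k(1)]
    by (intro CollectI conjI refl bexI[of _ "CP3_chart k"]) (auto simp: case_prod_beta)
qed

text \<open>Derivatives along curves in Q can be taken in homogeneous coordinates, with a lift
  through any prescribed representative of the base point.\<close>

lemma curve_lift:
  assumes \<gamma>: "\<gamma> \<in> curves_at CP3_atlas twistor_Q (cline z)" and z: "z \<in> null_cone"
  obtains W y \<zeta> where "open W" "(0::real) \<in> W" "C_inf_on W y" "\<forall>t\<in>W. y t \<in> null_cone \<and> \<gamma> t
      = cline (y t)" "y 0 = z" "(y has_vector_derivative \<zeta>) (at 0)"
    "velocity CP3_atlas \<gamma> = cvec z \<zeta>"
proof -
  obtain c where c: "c \<in> CP3_atlas" "smooth_arc (fst c \<inter> twistor_Q) (snd c) \<gamma>" and \<gamma>0: "\<gamma> 0 = cline z"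
    using \<gamma> unfolding curves_at_def by auto
  obtain k where k: "k \<in> CP3_coords" "c = CP3_chart k" using CP3_atlasE[OF c(1)] .
  obtain \<epsilon> where \<epsilon>: "\<epsilon> > 0" "\<And>t. t \<in> {-\<epsilon><..<\<epsilon>} \<Longrightarrow> \<gamma> t \<in> fst c \<inter> twistor_Q"
      "C_inf_on {-\<epsilon><..<\<epsilon>} (\<lambda>t. snd c (\<gamma> t))"
    using smooth_arcE[OF c(2)] by blast
  define W where "W = {-\<epsilon><..<\<epsilon>}"
  have W: "open W" "0 \<in> W" unfolding W_def using \<epsilon>(1) by auto
  have kz: "k z \<noteq> 0" using chart_domain[OF k(1), of z] z \<epsilon>(2)[of 0] \<epsilon>(1) \<gamma>0 k(2) by auto
  \<comment> \<open>The chart normalizes \<open>k\<close> to 1; the constant factor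
    \<open>k z\<close> moves the lift so that it starts at \<open>z\<close>.\<close>
  define y where "y t = snd c (\<gamma> t) *\<^sub>h (k z, 0)" for t
  have yW: "C_inf_on W y" unfolding y_def[abs_def]
    using C_inf_on_bilinear[OF bounded_bilinear_rmult W(1) \<epsilon>(3)[folded W_def] C_inf_on_const[OF W(1)]] .
  have cone: "y t \<in> null_cone" "\<gamma> t = cline (y t)" if "t \<in> W" for t
  proof -
    note * = \<epsilon>(2)[OF that[unfolded W_def], unfolded k(2)]
    show "y t \<in> null_cone" unfolding y_def k(2) using chart_twistor_Q(1)[OF k(1)] *
        by (intro cone_rmult kz) auto
    show "\<gamma> t = cline (y t)" unfolding y_def k(2) cline_rmult[OF kz] using chart_twistor_Q(2)[OF
        k(1)] * by auto
  qed
  have y0: "y 0 = z"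
    unfolding y_def \<gamma>0 k(2) chart_value[OF k(1) kz] using kz
    by (simp add: rmult_assoc qmult_complex flip: qone_def)
  have "frechet_derivative y (at 0) = (\<lambda>x. x *\<^sub>R frechet_derivative y (at 0) 1)"
  proof
    show "frechet_derivative y (at 0) x = x *\<^sub>R frechet_derivative y (at 0) 1" for x
      using linear_scale[OF C_inf_on_linear_derivative[OF yW W(2)], of x 1]
      unfolding real_scaleR_def mult_1_right .
  qed
  then have d: "(y has_vector_derivative frechet_derivative y (at 0) 1) (at 0)"
    unfolding has_vector_derivative_def using C_inf_on_has_derivative[OF yW W(2)] by simp
  have "eventually (\<lambda>t. \<gamma> t = cline (y t)) (nhds 0)"
    using eventually_nhds_in_open[OF W] by eventually_elim (rule cone(2))
  from velocity_cline[OF d _ this] have "velocity CP3_atlas \<gamma> = cvec z (frechet_derivative y (at 0) 1)"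
    using y0 z by auto
  then show ?thesis using that[OF W yW _ y0 d] cone by blast
qed

lemma cone_curve_derivative:
  assumes W: "open W" "(0::real) \<in> W" and y: "\<And>t. t \<in> W \<Longrightarrow> y t \<in> null_cone" "(y has_vector_derivative
      \<zeta>) (at 0)"
  shows "fst (y 0) \<bullet> fst \<zeta> = snd (y 0) \<bullet> snd \<zeta>"
proof -
  have "((\<lambda>t. fst (y t)) has_vector_derivative fst \<zeta>) (at 0)"
      "((\<lambda>t. snd (y t)) has_vector_derivative snd \<zeta>) (at 0)"
    by (rule bounded_linear.has_vector_derivative[OF bounded_linear_fst y(2)]
      bounded_linear.has_vector_derivative[OF bounded_linear_snd y(2)])+
  then have d: "((\<lambda>t. fst (y t) \<bullet> fst (y t) - snd (y t) \<bullet> snd (y t)) has_vector_derivative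
      (fst (y 0) \<bullet> fst \<zeta> + fst \<zeta> \<bullet> fst (y 0) - (snd (y 0) \<bullet> snd \<zeta> + snd \<zeta> \<bullet> snd (y 0)))) (at 0)"
    by (intro has_vector_derivative_diff bounded_bilinear.has_vector_derivative[OF bounded_bilinear_inner])
  have "fst (y t) \<bullet> fst (y t) - snd (y t) \<bullet> snd (y t) = 0" if "t \<in> W" for t
    using y(1)[OF that] by (simp add: dot_square_norm)
  then have "eventually (\<lambda>t. fst (y t) \<bullet> fst (y t) - snd (y t) \<bullet> snd (y t) = 0) (nhds 0)"
    using eventually_nhds_in_open[OF W] by (rule eventually_mono[rotated])
  from has_vector_derivative_cong_nhds[OF this] d
  have "((\<lambda>t. 0) has_vector_derivative
      (fst (y 0) \<bullet> fst \<zeta> + fst \<zeta> \<bullet> fst (y 0) - (snd (y 0) \<bullet> snd \<zeta> + snd \<zeta> \<bullet> snd (y 0))))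
          (at (0::real))" by simp
  from vector_derivative_unique_at[OF this has_vector_derivative_const] show ?thesis
    by (simp add: inner_commute)
qed

text \<open>The straight line z + t \<zeta> leaves the cone. Rescaling both components to the
  constant length |z1| = |z2| brings it back, and this changes the initial derivative only by a real
  multiple of \<open>z\<close>, which \<open>cvec\<close> ignores.\<close>

lemma tangent_twistor_Q:
  assumes z: "z \<in> null_cone"
  shows "X \<in> tangent CP3_atlas twistor_Q (cline z) \<longleftrightarrow> (\<exists>\<zeta>. X = cvec z \<zeta> \<and> fst z \<bullet> fst \<zeta> = snd z \<bullet> snd \<zeta>)"
proof
  assume "X \<in> tangent CP3_atlas twistor_Q (cline z)"
  then obtain \<gamma> where "\<gamma> \<in> curves_at CP3_atlas twistor_Q (cline z)" "X = velocity CP3_atlas \<gamma>"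
    unfolding tangent_def by auto
  note \<gamma> = this
  obtain W y \<zeta> where W: "open W" "(0::real) \<in> W" "\<forall>t\<in>W. y t \<in> null_cone \<and> \<gamma> t = cline (y t)"
    and y: "y 0 = z" "(y has_vector_derivative \<zeta>) (at 0)" "velocity CP3_atlas \<gamma> = cvec z \<zeta>"
    by (rule curve_lift[OF \<gamma>(1) z])
  have "fst (y 0) \<bullet> fst \<zeta> = snd (y 0) \<bullet> snd \<zeta>"
    by (rule cone_curve_derivative[OF W(1,2) _ y(2)]) (use W(3) in blast)
  then show "\<exists>\<zeta>. X = cvec z \<zeta> \<and> fst z \<bullet> fst \<zeta> = snd z \<bullet> snd \<zeta>"
    using y(1,3) \<gamma>(2) by metis
next
  assume "\<exists>\<zeta>. X = cvec z \<zeta> \<and> fst z \<bullet> fst \<zeta> = snd z \<bullet> snd \<zeta>"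
  then obtain \<zeta> where X: "X = cvec z \<zeta>" and \<zeta>: "fst z \<bullet> fst \<zeta> = snd z \<bullet> snd \<zeta>" by blast
  define r where "r = norm (fst z)"
  have nz: "fst z \<noteq> 0" "snd z \<noteq> 0" and r: "norm (snd z) = r" "r > 0" using z coneD[OF z]
      unfolding r_def by auto
  define a where "a t = fst z + t *\<^sub>R fst \<zeta>" for t
  define b where "b t = snd z + t *\<^sub>R snd \<zeta>" for t
  define W where "W = {t. a t \<noteq> 0} \<inter> {t. b t \<noteq> 0}"
  define y where "y t = (r *\<^sub>R sgn (a t), r *\<^sub>R sgn (b t))" for t
  have W: "open W" "0 \<in> W" unfolding W_def a_def b_def using nz
    by (auto intro!: open_Int open_Collect_neq continuous_intros)
  have ab: "C_inf_on W a" "C_inf_on W b" unfolding a_def[abs_def] b_def[abs_def]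
    by (intro C_inf_on_add C_inf_on_scaleR C_inf_on_const C_inf_on_id W(1))+
  have sab: "C_inf_on W (\<lambda>t. sgn (a t))" "C_inf_on W (\<lambda>t. sgn (b t))"
    by (rule C_inf_on_compose[OF C_inf_on_sgn W(1) _ _ ab(1)] C_inf_on_compose[OF C_inf_on_sgn W(1)
        _ _ ab(2)];
      auto simp: W_def)+
  have yW: "C_inf_on W y" unfolding y_def[abs_def]
    by (intro C_inf_on_Pair C_inf_on_scaleR C_inf_on_const W(1) sab)
  have cone: "y t \<in> null_cone" if "t \<in> W" for t
  proof -
    have "norm (fst (y t)) = r" "norm (snd (y t)) = r"
      using that r(2) unfolding W_def y_def by (simp_all add: norm_sgn)
    then show ?thesis using r(2) by auto
  qed
  have y0: "y 0 = z" using r nz unfolding y_def a_def b_def by (simp add: sgn_div_norm r_def[symmetric])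
  \<comment> \<open>The radial rate, equal for both components by the hypothesis on
    \<open>\<zeta>\<close>; without a common rate the correction would not be a multiple of
    \<open>z\<close>.\<close>
  define l where "l = (fst z \<bullet> fst \<zeta>) / r\<^sup>2"
  have da: "(a has_vector_derivative fst \<zeta>) (at 0)" "(b has_vector_derivative snd \<zeta>) (at 0)"
    unfolding a_def b_def by (auto intro!: derivative_eq_intros)
  have "((\<lambda>t. sgn (a t)) has_vector_derivative (fst \<zeta> - l *\<^sub>R fst z) /\<^sub>R r) (at 0)"
    using has_derivative_along_curve[OF da(1) has_derivative_sgn[of "a 0"]] nz
    by (simp add: a_def l_def r_def dot_square_norm inner_commute)
  moreover have "((\<lambda>t. sgn (b t)) has_vector_derivative (snd \<zeta> - l *\<^sub>R snd z) /\<^sub>R r) (at 0)"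
    using has_derivative_along_curve[OF da(2) has_derivative_sgn[of "b 0"]] nz
    by (simp add: b_def l_def r(1) dot_square_norm inner_commute[of _ "snd z"] \<zeta>)
  ultimately have "(y has_vector_derivative
      (r *\<^sub>R ((fst \<zeta> - l *\<^sub>R fst z) /\<^sub>R r), r *\<^sub>R ((snd \<zeta> - l *\<^sub>R snd z) /\<^sub>R r))) (at 0)"
    unfolding y_def[abs_def]
    by (intro has_vector_derivative_Pair bounded_linear.has_vector_derivative[OF
        bounded_linear_scaleR_right])
  moreover have "(r *\<^sub>R ((fst \<zeta> - l *\<^sub>R fst z) /\<^sub>R r), r *\<^sub>R ((snd \<zeta> - l *\<^sub>R snd z) /\<^sub>R r))
      = \<zeta> + (- l) *\<^sub>R z"
    using r by (simp add: prod_eqI)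
  ultimately have "(y has_vector_derivative (\<zeta> + (- l) *\<^sub>R z)) (at 0)" by simp
  from velocity_cline[OF this, of "\<lambda>t. cline (y t)"]
  have "velocity CP3_atlas (\<lambda>t. cline (y t)) = cvec z (\<zeta> + (- l) *\<^sub>R z)" using y0 z by simp
  also have "(- l) *\<^sub>R z = z *\<^sub>h (complex_of_real (- l), 0)"
    by (simp add: rmult_def qmult_def prod_eq_iff scaleR_conv_of_real)
  finally have "velocity CP3_atlas (\<lambda>t. cline (y t)) = X"
    using z X by (simp add: cvec_add cvec_rmult_self)
  then show "X \<in> tangent CP3_atlas twistor_Q (cline z)"
    unfolding tangent_def using cline_curve[OF W yW cone] y0 by auto
qed

text \<open>The second equation says that i times the vector is tangent as well. The two
  representatives coming from T and from iT may differ by some z c, which both equations tolerate;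
  the converse uses that the square of J is -1.\<close>

lemma levi_Q:
  assumes z: "z \<in> null_cone"
  shows "X \<in> levi Q_CR (cline z) \<longleftrightarrow> (\<exists>\<zeta>. X = cvec z \<zeta> \<and> fst z \<bullet> fst \<zeta> = snd z \<bullet> snd \<zeta> \<and>
    fst z \<bullet> (fst \<zeta> *\<^sub>q qi) = snd z \<bullet> (snd \<zeta> *\<^sub>q qi))"
proof -
  have z0: "z \<noteq> 0" using z by simp
  \<comment> \<open>Since both components of \<open>z\<close> have the same norm, adding a complex
    multiple of \<open>z\<close> to \<open>\<zeta>\<close> affects neither equation.\<close>
  have self: "fst z \<bullet> (fst z *\<^sub>q q) = snd z \<bullet> (snd z *\<^sub>q q)" for q
    using inner_qmult_cancel_left[of "fst z" qone q] inner_qmult_cancel_left[of "snd z" qone q] z by simp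
  have minus: "\<zeta> *\<^sub>h qi *\<^sub>h qi = - \<zeta>" for \<zeta>
    by (simp add: rmult_def qmult_qi_qi uminus_prod_def)
  show ?thesis
  proof
    assume "X \<in> levi Q_CR (cline z)"
    then have X: "X \<in> tangent CP3_atlas twistor_Q (cline z)" "X \<in> CP3_J ` tangent CP3_atlas
        twistor_Q (cline z)"
      unfolding Q_CR_def by simp_all
    obtain \<zeta> where \<zeta>: "X = cvec z \<zeta>" "fst z \<bullet> fst \<zeta> = snd z \<bullet> snd \<zeta>" using X(1) tangent_twistor_Q[OF
        z] by blast
    obtain \<eta> where \<eta>: "X = cvec z (\<eta> *\<^sub>h qi)" "fst z \<bullet> fst \<eta> = snd z \<bullet> snd \<eta>"
      using X(2) tangent_twistor_Q[OF z] CP3_J_cvec[OF z0] by auto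
    obtain c where c: "\<zeta> = \<eta> *\<^sub>h qi + z *\<^sub>h (c, 0)" using cvec_eqD[OF z0] \<zeta>(1) \<eta>(1) by metis
    have "fst \<zeta> *\<^sub>q qi = - fst \<eta> + fst z *\<^sub>q ((c, 0) *\<^sub>q qi)" "snd \<zeta> *\<^sub>q qi
        = - snd \<eta> + snd z *\<^sub>q ((c, 0) *\<^sub>q qi)"
      unfolding c by (simp_all only: rmult_def fst_add snd_add fst_conv snd_conv qmult_add_left
          qmult_qi_qi qmult_assoc[of _ "(c, 0)"])
    then have "fst z \<bullet> (fst \<zeta> *\<^sub>q qi) = snd z \<bullet> (snd \<zeta> *\<^sub>q qi)"
      using \<eta>(2) self by (simp only: inner_add_right inner_minus_right)
    then show "\<exists>\<zeta>. X = cvec z \<zeta> \<and> fst z \<bullet> fst \<zeta> = snd z \<bullet> snd \<zeta> \<and>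
        fst z \<bullet> (fst \<zeta> *\<^sub>q qi) = snd z \<bullet> (snd \<zeta> *\<^sub>q qi)" using \<zeta> by blast
  next
    assume "\<exists>\<zeta>. X = cvec z \<zeta> \<and> fst z \<bullet> fst \<zeta> = snd z \<bullet> snd \<zeta> \<and> fst z \<bullet> (fst \<zeta> *\<^sub>q qi)
        = snd z \<bullet> (snd \<zeta> *\<^sub>q qi)"
    then obtain \<zeta> where \<zeta>: "X = cvec z \<zeta>" "fst z \<bullet> fst \<zeta> = snd z \<bullet> snd \<zeta>"
      "fst z \<bullet> (fst \<zeta> *\<^sub>q qi) = snd z \<bullet> (snd \<zeta> *\<^sub>q qi)" by blast
    have "X = CP3_J (cvec z (- (\<zeta> *\<^sub>h qi)))"
      unfolding CP3_J_cvec[OF z0] rmult_minus_left minus \<zeta>(1) by simp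
    moreover have "cvec z (- (\<zeta> *\<^sub>h qi)) \<in> tangent CP3_atlas twistor_Q (cline z)"
      unfolding tangent_twistor_Q[OF z] using \<zeta>(3)
      by (intro exI[of _ "- (\<zeta> *\<^sub>h qi)"]) (simp add: rmult_def)
    moreover have "X \<in> tangent CP3_atlas twistor_Q (cline z)"
      using tangent_twistor_Q[OF z] \<zeta> by blast
    ultimately show "X \<in> levi Q_CR (cline z)" unfolding Q_CR_def by simp
  qed
qed

section \<open>The map to the tangent sphere bundle\<close>

definition base :: "quat2 \<Rightarrow> quat"
  where "base z = fst z *\<^sub>q qinv (snd z)"

definition fibre :: "quat2 \<Rightarrow> quat"
  where "fibre z = fst z *\<^sub>q qi *\<^sub>q qinv (snd z)"

lemma base_qmult: "snd z \<noteq> 0 \<Longrightarrow> base z *\<^sub>q snd z = fst z"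
  by (simp add: base_def qmult_qinv_cancel)

lemma fibre_qmult: "snd z \<noteq> 0 \<Longrightarrow> fibre z *\<^sub>q snd z = fst z *\<^sub>q qi"
  by (simp add: fibre_def qmult_qinv_cancel)

lemma fibre_twist: "snd z \<noteq> 0 \<Longrightarrow> fibre z = base z *\<^sub>q twist z"
  unfolding base_def fibre_def twist_def by (simp add: qmult_assoc qmult_qinv_cancel)

lemma base_fibre_unit:
  assumes "z \<in> null_cone"
  shows "base z \<in> unit_sphere" "fibre z \<in> unit_sphere" "fibre z \<bullet> base z = 0"
proof -
  have nz: "snd z \<noteq> 0" using coneD[OF assms] by auto
  then show "base z \<in> unit_sphere" "fibre z \<in> unit_sphere"
    using assms by (auto simp: base_def fibre_def norm_qmult norm_qinv)
  show "fibre z \<bullet> base z = 0"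
    unfolding fibre_twist[OF nz] using inner_qmult_imaginary(1)[OF twist_unit_imaginary[OF nz], of "base z"]
    by (simp add: inner_commute)
qed

lemma twistor_to_sphere_bundle_cline:
  assumes "z \<in> null_cone"
  shows "twistor_to_sphere_bundle (cline z) = (base z, ray (fibre z))"
proof -
  have nz: "snd z \<noteq> 0" using coneD[OF assms] by auto
  have "twistor (cline z) = affine_point (base z)"
    unfolding twistor_cline base_def by (rule qline_affine_point[OF nz])
  then have "(THE x. x \<in> unit_sphere \<and> affine_point x = twistor (cline z)) = base z"
    using base_fibre_unit(1)[OF assms] affine_point_inject by (intro the_equality) auto
  then show ?thesis
    unfolding twistor_to_sphere_bundle_def Let_def unit_normal_def
    by (simp add: acs_cline[OF nz base_def] fibre_twist[OF nz])
qed

lemma ray_scaleR: "r > 0 \<Longrightarrow> ray (r *\<^sub>R v) = ray v"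
  unfolding ray_def
proof (intro subset_antisym subsetI; clarify)
  fix s assume "r > 0" "(s::real) > 0"
  then show "\<exists>t. s *\<^sub>R r *\<^sub>R v = t *\<^sub>R v \<and> 0 < t" by (intro exI[of _ "s * r"]) simp
  show "\<exists>t. s *\<^sub>R v = t *\<^sub>R r *\<^sub>R v \<and> 0 < t" using \<open>r > 0\<close> \<open>s > 0\<close> by (intro exI[of _ "s / r"]) simp
qed

lemma ray_unit_inject:
  assumes "ray u = ray v" "norm u = 1" "norm v = 1"
  shows "u = (v :: 'a::real_normed_vector)"
proof -
  have "u \<in> ray u" unfolding ray_def by (intro CollectI exI[of _ 1]) simp
  then have "u \<in> ray v" using assms(1) by simp
  then obtain r where r: "u = r *\<^sub>R v" "r > 0" unfolding ray_def by blast
  then have "r = 1" using assms by simp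
  then show ?thesis using r by simp
qed

lemma sphere_bundle_sphere:
  "p \<in> sphere_bundle (sphere 0 1) \<longleftrightarrow> (\<exists>x v. p = (x, ray v) \<and> x \<in> sphere 0 1 \<and> v \<bullet> x = 0 \<and> v \<noteq> 0)"
  unfolding sphere_bundle_def using tspace_sphere by blast

lemma twistor_to_sphere_bundle_in:
  assumes "z \<in> null_cone"
  shows "twistor_to_sphere_bundle (cline z) \<in> sphere_bundle unit_sphere"
proof -
  have "fibre z \<noteq> 0" using base_fibre_unit(2)[OF assms] by auto
  then show ?thesis
    unfolding sphere_bundle_sphere twistor_to_sphere_bundle_cline[OF assms]
    using base_fibre_unit[OF assms] by blast
qed

text \<open>Equal base points give y = z r for a quaternion \<open>r\<close>, and equal vectors over
  them make \<open>r\<close> commute with i. The centralizer of i is the complex numbers, so the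
  complex lines agree.\<close>

lemma twistor_to_sphere_bundle_inj: "inj_on twistor_to_sphere_bundle twistor_Q"
proof (rule inj_onI)
  fix e e' assume e: "e \<in> twistor_Q" "e' \<in> twistor_Q" "twistor_to_sphere_bundle e
      = twistor_to_sphere_bundle e'"
  obtain z where z: "z \<in> null_cone" "e = cline z" using twistor_QE[OF e(1)] .
  obtain y where y: "y \<in> null_cone" "e' = cline y" using twistor_QE[OF e(2)] .
  have nz: "snd z \<noteq> 0" "snd y \<noteq> 0" using coneD z(1) y(1) by blast+
  have x: "base z = base y" "ray (fibre z) = ray (fibre y)"
    using e(3) z y by (simp_all only: twistor_to_sphere_bundle_cline prod.inject)
  have "fibre z = fibre y"
    using ray_unit_inject[OF x(2)] base_fibre_unit(2)[OF z(1)] base_fibre_unit(2)[OF y(1)] by simp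
  then have "base z *\<^sub>q twist z = base z *\<^sub>q twist y" using fibre_twist nz x(1) by simp
  moreover have "base z \<noteq> 0" using base_fibre_unit(1)[OF z(1)] by auto
  ultimately have tw: "twist z = twist y" using qmult_left_cancel by blast
  define r where "r = qinv (snd z) *\<^sub>q snd y"
  have y2: "snd y = snd z *\<^sub>q r" unfolding r_def by (simp add: qmult_qinv_cancel nz)
  have y1: "fst y = fst z *\<^sub>q r"
    using base_qmult[OF nz(1)] base_qmult[OF nz(2)] x(1) y2 by (metis qmult_assoc)
  have "snd z *\<^sub>q (qi *\<^sub>q r) = snd z *\<^sub>q (r *\<^sub>q qi)"
    using twist_qmult[OF nz(1)] twist_qmult[OF nz(2)] tw y2 by (metis qmult_assoc)
  then have "qi *\<^sub>q r = r *\<^sub>q qi" using qmult_left_cancel[OF nz(1)] by blast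
  then have "snd r = 0" by (simp add: qmult_def complex_eq_iff)
  then have r: "r = (fst r, 0)" by (simp add: prod_eq_iff)
  have "y = z *\<^sub>h (fst r, 0)" using y1 y2 r by (simp add: rmult_def prod_eqI)
  moreover have "fst r \<noteq> 0" using y2 nz(2) r by (auto simp: qmult_zero_right zero_prod_def[symmetric])
  ultimately show "e = e'" using cline_rmult z(2) y(2) by metis
qed

text \<open>
  A solution \<open>q\<close> of \<open>p q = q i\<close> is \<open>a - p a i\<close>, for any \<open>a\<close> for which it is not zero;
  here \<open>p = x\<^sup>-\<^sup>1 v\<close> for a unit vector \<open>v\<close> at \<open>x\<close>.
\<close>

definition lift :: "quat \<Rightarrow> quat \<times> quat \<Rightarrow> quat2"
  where "lift a = (\<lambda>(x, v). let q = a - qconj x *\<^sub>q sgn v *\<^sub>q a *\<^sub>q qi in (x *\<^sub>q q, q))"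

text \<open>The real part of conj(x) v is <x, v> = 0, so p is a unit imaginary and its square is -1.
  Hence p (a - p a i) = p a + a i = (a - p a i) i, and p becomes the \<open>twist\<close> of the
  lift.\<close>

lemma lift_correct:
  assumes x: "x \<in> unit_sphere" and v: "v \<bullet> x = 0" "v \<noteq> 0" and q: "snd (lift a (x, v)) \<noteq> 0"
  shows "lift a (x, v) \<in> null_cone" "twistor_to_sphere_bundle (cline (lift a (x, v))) = (x, ray v)"
proof -
  define p where "p = qconj x *\<^sub>q sgn v"
  define z where "z = lift a (x, v)"
  have z: "snd z = a - p *\<^sub>q a *\<^sub>q qi" "fst z = x *\<^sub>q snd z" by (simp_all add: z_def lift_def Let_def p_def)
  have nz: "snd z \<noteq> 0" using q z_def by simp
  have xp: "x *\<^sub>q p = sgn v"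
    using x unfolding p_def by (simp add: qmult_qconj qmult_scaleR_left flip: qmult_assoc)
  have "norm x = 1" using x by simp
  then have "norm p = 1" using norm_qmult[of x p] xp v(2) by (simp add: norm_sgn)
  moreover have "Re (fst p) = x \<bullet> sgn v" by (simp add: p_def qmult_def qconj_def inner_quat)
  then have "Re (fst p) = 0" using v(1) by (simp add: sgn_div_norm inner_commute)
  ultimately have pp: "p *\<^sub>q p = - qone" using unit_imaginary_square(2) by blast
  show "lift a (x, v) \<in> null_cone"
    unfolding z_def[symmetric] using z(2) nz \<open>norm x = 1\<close> by (auto simp: norm_qmult)
  note cone = this[folded z_def]
  have "p *\<^sub>q (p *\<^sub>q r) = - r" for r using pp by (simp add: qmult_minus_left flip: qmult_assoc)
  then have "p *\<^sub>q snd z = snd z *\<^sub>q qi"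
    unfolding z(1) by (simp add: qmult_diff_left qmult_diff_right qmult_assoc qi_squared qmult_minus_right)
  then have "twist z = p" unfolding twist_def using nz by (metis qmult_qinv_cancel(1))
  moreover have "base z = x" unfolding base_def z(2) using nz by (simp add: qmult_qinv_cancel)
  ultimately have "fibre z = sgn v" using fibre_twist[OF nz] xp by simp
  moreover have "ray (sgn v) = ray v" unfolding sgn_div_norm using v(2) by (intro ray_scaleR) simp
  ultimately show "twistor_to_sphere_bundle (cline (lift a (x, v))) = (x, ray v)"
    using twistor_to_sphere_bundle_cline[OF cone] \<open>base z = x\<close> z_def by simp
qed

text \<open>The seed a = 1 fails only for p = -i, and there the seed a = j gives 2 j. Every seed
  fails for some p, so the inverse is described locally.\<close>

lemma lift_exists:
  obtains a where "snd (lift a (x, v)) \<noteq> 0"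
proof -
  define p where "p = qconj x *\<^sub>q sgn v"
  have "\<not> (qone - p *\<^sub>q qone *\<^sub>q qi = 0 \<and> (0, 1) - p *\<^sub>q (0, 1) *\<^sub>q qi = 0)"
  proof
    assume *: "qone - p *\<^sub>q qone *\<^sub>q qi = 0 \<and> (0, 1) - p *\<^sub>q (0, 1) *\<^sub>q qi = 0"
    then have "p *\<^sub>q qi *\<^sub>q qi = qone *\<^sub>q qi" by simp
    then have "- p = qi" by (simp only: qmult_qi_qi qmult_one)
    then have "p = - qi" by (metis minus_minus)
    then show False using * by (simp add: qmult_def prod_eq_iff complex_eq_iff)
  qed
  then show ?thesis using that[of qone] that[of "(0, 1)"] by (auto simp: lift_def Let_def p_def)
qed

lemma twistor_to_sphere_bundle_bij:
  "bij_betw twistor_to_sphere_bundle twistor_Q (sphere_bundle unit_sphere)"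
  unfolding bij_betw_def
proof (intro conjI twistor_to_sphere_bundle_inj subset_antisym subsetI)
  fix p assume "p \<in> twistor_to_sphere_bundle ` twistor_Q"
  then obtain e where e: "e \<in> twistor_Q" "p = twistor_to_sphere_bundle e" by (rule imageE) auto
  obtain z where "z \<in> null_cone" "e = cline z" using twistor_QE[OF e(1)] .
  then show "p \<in> sphere_bundle unit_sphere"
    unfolding e(2) by (simp only: twistor_to_sphere_bundle_in)
next
  fix p assume "p \<in> sphere_bundle unit_sphere"
  then obtain x v where p: "p = (x, ray v)" "x \<in> unit_sphere" "v \<bullet> x = 0" "v \<noteq> 0"
    unfolding sphere_bundle_sphere by blast
  obtain a where a: "snd (lift a (x, v)) \<noteq> 0" using lift_exists .
  note l = lift_correct[OF p(2-4) a]
  show "p \<in> twistor_to_sphere_bundle ` twistor_Q"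
    unfolding p(1) l(2)[symmetric] by (rule imageI[OF cline_in_twistor_Q[OF l(1)]])
qed

text \<open>Smoothness provides some derivative X'; differentiating the product X z2 = A z then
  determines it without a formula for the derivative of \<open>qinv\<close>.\<close>

lemma has_derivative_qdiv:
  assumes A: "bounded_linear A" and z: "snd z \<noteq> 0"
  shows "((\<lambda>z. A z *\<^sub>q qinv (snd z)) has_derivative
    (\<lambda>\<zeta>. (A \<zeta> - A z *\<^sub>q qinv (snd z) *\<^sub>q snd \<zeta>) *\<^sub>q qinv (snd z))) (at (z :: quat2))"
proof -
  let ?W = "{z :: quat2. snd z \<noteq> 0}" and ?X = "\<lambda>z. A z *\<^sub>q qinv (snd z)"
  have W: "open ?W" by (intro open_Collect_neq continuous_intros)
  have "C_inf_on ?W ?X"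
    by (intro C_inf_on_qmult C_inf_on_qinv C_inf_on_bounded_linear A bounded_linear_snd W) simp
  then obtain X' where X': "(?X has_derivative X') (at z)"
    using C_inf_on_has_derivative z by blast
  have "((\<lambda>z. ?X z *\<^sub>q snd z) has_derivative (\<lambda>\<zeta>. ?X z *\<^sub>q snd \<zeta> + X' \<zeta> *\<^sub>q snd z)) (at z)"
    by (rule bounded_bilinear.FDERIV[OF bounded_bilinear_qmult X'])
      (rule bounded_linear_imp_has_derivative[OF bounded_linear_snd])
  then have "(A has_derivative (\<lambda>\<zeta>. ?X z *\<^sub>q snd \<zeta> + X' \<zeta> *\<^sub>q snd z)) (at z)"
    by (rule has_derivative_transform_within_open[OF _ W]) (use z qmult_qinv_cancel in auto)
  then have eq: "A = (\<lambda>\<zeta>. ?X z *\<^sub>q snd \<zeta> + X' \<zeta> *\<^sub>q snd z)"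
    using has_derivative_unique bounded_linear_imp_has_derivative[OF A] by blast
  have "A \<zeta> - ?X z *\<^sub>q snd \<zeta> = X' \<zeta> *\<^sub>q snd z" for \<zeta>
    using fun_cong[OF eq, of \<zeta>] by simp
  then have "X' = (\<lambda>\<zeta>. (A \<zeta> - ?X z *\<^sub>q snd \<zeta>) *\<^sub>q qinv (snd z))"
    by (simp add: qmult_qinv_cancel z)
  then show ?thesis using X' by simp
qed

definition dbase :: "quat2 \<Rightarrow> quat2 \<Rightarrow> quat"
  where "dbase z \<zeta> = (fst \<zeta> - base z *\<^sub>q snd \<zeta>) *\<^sub>q qinv (snd z)"

definition dfibre :: "quat2 \<Rightarrow> quat2 \<Rightarrow> quat"
  where "dfibre z \<zeta> = (fst \<zeta> *\<^sub>q qi - fibre z *\<^sub>q snd \<zeta>) *\<^sub>q qinv (snd z)"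

lemma bounded_linear_qmult_qi: "bounded_linear (\<lambda>z::quat2. fst z *\<^sub>q qi)"
  using bounded_linear_compose[OF bounded_bilinear.bounded_linear_left[OF bounded_bilinear_qmult]
      bounded_linear_fst] .

lemma has_derivative_base: "snd z \<noteq> 0 \<Longrightarrow> (base has_derivative dbase z) (at z)"
  using has_derivative_qdiv[OF bounded_linear_fst, of z] unfolding base_def[abs_def] dbase_def[abs_def] .

lemma has_derivative_fibre: "snd z \<noteq> 0 \<Longrightarrow> (fibre has_derivative dfibre z) (at z)"
  using has_derivative_qdiv[OF bounded_linear_qmult_qi, of z] unfolding fibre_def[abs_def]
      dfibre_def[abs_def] .

lemma dbase_dfibre_self:
  assumes "snd z \<noteq> 0"
  shows "dbase z (z *\<^sub>h (c, 0)) = 0" "dfibre z (z *\<^sub>h (c, 0)) = 0"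
proof -
  have "qi *\<^sub>q (c, 0) = (c, 0) *\<^sub>q qi" by (simp add: qmult_def)
  then show "dbase z (z *\<^sub>h (c, 0)) = 0" "dfibre z (z *\<^sub>h (c, 0)) = 0"
    using base_qmult[OF assms] fibre_qmult[OF assms]
    by (simp_all add: dbase_def dfibre_def rmult_def qmult_assoc[symmetric] qmult_zero_left)
      (simp add: qmult_assoc qmult_zero_left)
qed

text \<open>The reason is i z2^-1 = z2^-1 p: a factor i on the right of \<open>\<zeta>\<close>
  passes through the division by z2 and comes out as p.\<close>

lemma dbase_dfibre_qi:
  assumes "snd z \<noteq> 0"
  shows "dbase z (\<zeta> *\<^sub>h qi) = dbase z \<zeta> *\<^sub>q twist z" "dfibre z (\<zeta> *\<^sub>h qi) = dfibre z \<zeta> *\<^sub>q twist z"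
  using assms by (simp_all add: dbase_def dfibre_def twist_def rmult_def qmult_diff_left qmult_assoc
      qmult_qinv_cancel)

text \<open>Multiplying both arguments by z2 from the right scales inner products by |z2|^2 and
  clears the denominators. The four products reduce to the two defects of the Levi equations, up to
  sign.\<close>

lemma dbase_dfibre_inner:
  assumes z: "z \<in> null_cone"
  shows "(norm (snd z))\<^sup>2 * (dbase z \<zeta> \<bullet> base z) = fst z \<bullet> fst \<zeta> - snd z \<bullet> snd \<zeta>"
    "(norm (snd z))\<^sup>2 * (dbase z \<zeta> \<bullet> fibre z) = snd z \<bullet> (snd \<zeta> *\<^sub>q qi) - fst z \<bullet> (fst \<zeta> *\<^sub>q qi)"
    "(norm (snd z))\<^sup>2 * (dfibre z \<zeta> \<bullet> fibre z) = fst z \<bullet> fst \<zeta> - snd z \<bullet> snd \<zeta>"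
    "(norm (snd z))\<^sup>2 * (dfibre z \<zeta> \<bullet> base z) = fst z \<bullet> (fst \<zeta> *\<^sub>q qi) - snd z \<bullet> (snd \<zeta> *\<^sub>q qi)"
proof -
  have nz: "snd z \<noteq> 0" using coneD[OF z] by auto
  have n: "norm (base z) = 1" "norm (fibre z) = 1" using base_fibre_unit[OF z] by simp_all
  have d: "dbase z \<zeta> *\<^sub>q snd z = fst \<zeta> - base z *\<^sub>q snd \<zeta>" "dfibre z \<zeta> *\<^sub>q snd z
      = fst \<zeta> *\<^sub>q qi - fibre z *\<^sub>q snd \<zeta>"
    using nz by (simp_all add: dbase_def dfibre_def qmult_qinv_cancel)
  have b: "(base z *\<^sub>q u) \<bullet> (base z *\<^sub>q w) = u \<bullet> w" "(fibre z *\<^sub>q u) \<bullet> (fibre z *\<^sub>q w) = u \<bullet> w" for u w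
    using n by (simp_all add: inner_qmult_cancel_left)
  have f: "fst z = - (fibre z *\<^sub>q (snd z *\<^sub>q qi))" "fst z = base z *\<^sub>q snd z"
      "fst z *\<^sub>q qi = fibre z *\<^sub>q snd z" "fst z *\<^sub>q qi = base z *\<^sub>q (snd z *\<^sub>q qi)"
    using fibre_qmult[OF nz] base_qmult[OF nz] by (simp_all add: qmult_qi_qi flip: qmult_assoc)
  have qq: "(u *\<^sub>q qi) \<bullet> (w *\<^sub>q qi) = u \<bullet> w" "(u *\<^sub>q qi) \<bullet> w = - (u \<bullet> (w *\<^sub>q qi))" for u w
    using inner_qmult_cancel_right[of u qi w] inner_qmult_qi(2)[of u w] by simp_all
  have c: "(norm (snd z))\<^sup>2 * (u \<bullet> w) = (u *\<^sub>q snd z) \<bullet> (w *\<^sub>q snd z)" for u w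
    by (rule inner_qmult_cancel_right[symmetric])
  have "(dbase z \<zeta> *\<^sub>q snd z) \<bullet> (base z *\<^sub>q snd z) = fst \<zeta> \<bullet> fst z - snd \<zeta> \<bullet> snd z"
    unfolding d inner_diff_left b by (simp only: f(2))
  then show "(norm (snd z))\<^sup>2 * (dbase z \<zeta> \<bullet> base z) = fst z \<bullet> fst \<zeta> - snd z \<bullet> snd \<zeta>"
    unfolding c by (simp only: inner_commute)
  have "(dbase z \<zeta> *\<^sub>q snd z) \<bullet> (fibre z *\<^sub>q snd z) = fst \<zeta> \<bullet> (fst z *\<^sub>q qi) - snd \<zeta> \<bullet> (snd z *\<^sub>q qi)"
    unfolding d inner_diff_left f(3)[symmetric] by (simp only: f(4) b)
  then show "(norm (snd z))\<^sup>2 * (dbase z \<zeta> \<bullet> fibre z) = snd z \<bullet> (snd \<zeta> *\<^sub>q qi) - fst z \<bullet> (fst \<zeta> *\<^sub>q qi)"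
    unfolding c using qq(2)[of "fst z" "fst \<zeta>"] qq(2)[of "snd z" "snd \<zeta>"] by (simp add: inner_commute)
  have "(dfibre z \<zeta> *\<^sub>q snd z) \<bullet> (fibre z *\<^sub>q snd z) = fst \<zeta> \<bullet> fst z - snd \<zeta> \<bullet> snd z"
    unfolding d inner_diff_left b by (simp only: f(3)[symmetric] qq(1))
  then show "(norm (snd z))\<^sup>2 * (dfibre z \<zeta> \<bullet> fibre z) = fst z \<bullet> fst \<zeta> - snd z \<bullet> snd \<zeta>"
    unfolding c by (simp only: inner_commute)
  have "(fibre z *\<^sub>q snd \<zeta>) \<bullet> fst z = - (snd \<zeta> \<bullet> (snd z *\<^sub>q qi))"
    by (subst f(1)) (simp add: b)
  moreover have "snd \<zeta> \<bullet> (snd z *\<^sub>q qi) = - (snd z \<bullet> (snd \<zeta> *\<^sub>q qi))"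
    using qq(2)[of "snd z" "snd \<zeta>"] by (simp add: inner_commute)
  ultimately have "(dfibre z \<zeta> *\<^sub>q snd z) \<bullet> (base z *\<^sub>q snd z) = (fst \<zeta> *\<^sub>q qi) \<bullet> fst z - snd z \<bullet>
      (snd \<zeta> *\<^sub>q qi)"
    unfolding d inner_diff_left base_qmult[OF nz] by simp
  then show "(norm (snd z))\<^sup>2 * (dfibre z \<zeta> \<bullet> base z) = fst z \<bullet> (fst \<zeta> *\<^sub>q qi) - snd z \<bullet> (snd \<zeta> *\<^sub>q qi)"
    unfolding c by (simp add: inner_commute)
qed

section \<open>Smooth maps and curves\<close>

lemma velocity_cong:
  assumes "eventually (\<lambda>t. \<gamma> t = \<delta> t) (nhds 0)"
  shows "velocity A \<gamma> = velocity A \<delta>"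
proof -
  have "eventually (\<lambda>t. (\<phi> \<circ> \<gamma>) t = (\<phi> \<circ> \<delta>) t) (nhds 0)" for \<phi> :: "'a \<Rightarrow> 'b"
    using assms by eventually_elim simp
  note has_vector_derivative_cong_nhds[OF this]
  then have "vector_derivative (\<phi> \<circ> \<gamma>) (at 0) = vector_derivative (\<phi> \<circ> \<delta>) (at 0)" for \<phi> :: "'a \<Rightarrow> 'b"
    unfolding vector_derivative_def by (simp only:)
  then show ?thesis using eventually_nhds_x_imp_x[OF assms] by (auto simp: velocity_def fun_eq_iff)
qed

text \<open>With a single source chart, the chart in which the arc is smooth is also the one in
  which \<open>F\<close> has a smooth extension.\<close>

lemma smooth_map_curve:
  fixes \<phi> :: "'p \<Rightarrow> 'e::euclidean_space"
  assumes F: "smooth_map {(U, \<phi>)} P B P' F" and \<gamma>: "\<gamma> \<in> curves_at {(U, \<phi>)} P p"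
  shows "F \<circ> \<gamma> \<in> curves_at B P' (F p)"
proof -
  have \<gamma>0: "\<gamma> 0 = p" and arc: "smooth_arc (U \<inter> P) \<phi> \<gamma>" using \<gamma> unfolding curves_at_def by auto
  obtain \<epsilon> where \<epsilon>: "\<epsilon> > 0" "\<And>t. t \<in> {-\<epsilon><..<\<epsilon>} \<Longrightarrow> \<gamma> t \<in> U \<inter> P" "C_inf_on {-\<epsilon><..<\<epsilon>} (\<lambda>t. \<phi> (\<gamma> t))"
    using smooth_arcE[OF arc] by blast
  have "p \<in> P" using \<epsilon>(1) \<epsilon>(2)[of 0] \<gamma>0 by auto
  then obtain c W h where c: "c \<in> B" "open W" "\<phi> p \<in> W" "C_inf_on W h"
    and h: "\<And>q. q \<in> U \<inter> P \<Longrightarrow> \<phi> q \<in> W \<Longrightarrow> F q \<in> fst c \<and> snd c (F q) = h (\<phi> q)"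
    using F unfolding smooth_map_def case_prod_beta by fastforce
  define T where "T = {-\<epsilon><..<\<epsilon>} \<inter> (\<lambda>t. \<phi> (\<gamma> t)) -` W"
  have T: "open T" unfolding T_def
    by (rule continuous_open_preimage[OF C_inf_on_continuous[OF \<epsilon>(3)] _ c(2)]) simp
  have T0: "0 \<in> T" using \<epsilon>(1) \<gamma>0 c(3) unfolding T_def by simp
  have m: "\<gamma> t \<in> U \<inter> P" "\<phi> (\<gamma> t) \<in> W" if "t \<in> T" for t
    using that \<epsilon>(2) unfolding T_def by auto
  have "C_inf_on T (\<lambda>t. h (\<phi> (\<gamma> t)))"
    by (rule C_inf_on_compose[OF c(4) T c(2) m(2) C_inf_on_subset[OF \<epsilon>(3)]]) (auto simp: T_def)
  then have "C_inf_on T (\<lambda>t. snd c ((F \<circ> \<gamma>) t))"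
    by (rule C_inf_on_cong[OF T, rotated]) (use h m in auto)
  moreover have "(F \<circ> \<gamma>) t \<in> fst c \<inter> P'" if "t \<in> T" for t
    using h m[OF that] F unfolding smooth_map_def by auto
  ultimately have "smooth_arc (fst c \<inter> P') (snd c) (F \<circ> \<gamma>)"
    by (intro smooth_arcI[OF T T0])
  then show ?thesis unfolding curves_at_def using c(1) \<gamma>0
    by (intro CollectI conjI bexI[of _ c]) (auto simp: case_prod_beta)
qed

section \<open>The CR isomorphism\<close>

locale conformal_sphere =
  fixes f :: "quat \<Rightarrow> real" and g :: "quat metric_tensor"
  assumes f_smooth: "smooth_on unit_sphere f"
    and f_pos: "\<And>x. x \<in> unit_sphere \<Longrightarrow> f x > 0"
    and g_eq: "\<And>x u v. x \<in> unit_sphere \<Longrightarrow> u \<bullet> x = 0 \<Longrightarrow> v \<bullet> x = 0 \<Longrightarrow> g x u v = f x * (u \<bullet> v)"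
begin

section \<open>Unit vectors of the conformal metric in homogeneous coordinates\<close>

abbreviation chart where "chart \<equiv> unit_chart unit_sphere g"

abbreviation ray_space :: "(quat \<times> quat set) set" where "ray_space \<equiv> sphere_bundle unit_sphere"

text \<open>The reciprocal of the \<open>g\<close>-length of a Euclidean unit vector. Composing with
  \<open>sgn\<close> extends it radially, so that its derivative is expressed by
  \<open>sder f\<close>.\<close>

definition scale :: "quat \<Rightarrow> real"
  where "scale x = f (sgn x) powr (- 1 / 2)"

lemma scale_pos: "x \<in> unit_sphere \<Longrightarrow> scale x > 0"
  using f_pos[of x] sgn_unit[of x] by (simp add: scale_def)

lemma scale_square: "x \<in> unit_sphere \<Longrightarrow> f x * (scale x)\<^sup>2 = 1"
  using f_pos[of x] sgn_unit[of x]
  by (simp add: scale_def powr_minus powr_half_sqrt power_inverse)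

definition unit_lift :: "quat2 \<Rightarrow> quat \<times> quat"
  where "unit_lift z = (base z, scale (base z) *\<^sub>R fibre z)"

text \<open>The last term is the derivative of the scale factor: d(f^(-1/2)) = -(f^(-1/2) / (2f))
  df.\<close>

definition dunit_lift :: "quat2 \<Rightarrow> quat2 \<Rightarrow> quat \<times> quat"
  where "dunit_lift z \<zeta> = (dbase z \<zeta>, scale (base z) *\<^sub>R dfibre z \<zeta> -
    (scale (base z) / (2 * f (base z)) * sder f (base z) (dbase z \<zeta>)) *\<^sub>R fibre z)"

lemma unit_rep_eq:
  assumes x: "x \<in> unit_sphere" and v: "v \<bullet> x = 0" "v \<noteq> 0"
  shows "unit_rep g (x, ray v) = (x, scale x *\<^sub>R sgn v)"
proof -
  have s: "scale x > 0" "f x * (scale x)\<^sup>2 = 1" using scale_pos scale_square x by auto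
  have gr: "g x (r *\<^sub>R v) (r *\<^sub>R v) = f x * (r * norm v)\<^sup>2" for r
    using g_eq[OF x, of "r *\<^sub>R v" "r *\<^sub>R v"] v(1)
    by (simp add: dot_square_norm power_mult_distrib power2_eq_square mult_ac)
  have "(THE w. w \<in> ray v \<and> g x w w = 1) = scale x *\<^sub>R sgn v"
  proof (rule the_equality)
    have e: "scale x *\<^sub>R sgn v = (scale x / norm v) *\<^sub>R v" by (simp add: sgn_div_norm divide_inverse)
    show "scale x *\<^sub>R sgn v \<in> ray v \<and> g x (scale x *\<^sub>R sgn v) (scale x *\<^sub>R sgn v) = 1"
      unfolding e gr using s v(2) by (auto simp: ray_def intro!: exI[of _ "scale x / norm v"])
    fix w assume w: "w \<in> ray v \<and> g x w w = 1"
    then obtain r where r: "w = r *\<^sub>R v" "r > 0" unfolding ray_def by blast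
    then have "f x * (r * norm v)\<^sup>2 = f x * (scale x)\<^sup>2" using w gr s(2) by simp
    then have "(r * norm v)\<^sup>2 = (scale x)\<^sup>2" using f_pos[OF x] by simp
    then have "r * norm v = scale x" using r(2) s(1) by (simp add: power2_eq_iff_nonneg)
    then show "w = scale x *\<^sub>R sgn v" using r(1) v(2) by (simp add: e field_simps)
  qed
  then show ?thesis by (simp add: unit_rep_def)
qed

lemma unit_rep_twistor:
  assumes z: "z \<in> null_cone"
  shows "unit_rep g (twistor_to_sphere_bundle (cline z)) = unit_lift z"
proof -
  note b = base_fibre_unit[OF z]
  have "fibre z \<noteq> 0" using b(2) by auto
  then show ?thesis unfolding twistor_to_sphere_bundle_cline[OF z] unit_lift_def
    using unit_rep_eq[OF b(1,3)] sgn_unit[OF b(2)] by simp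
qed

lemma C_inf_on_f_sgn: "C_inf_on (- {0}) (\<lambda>x. f (sgn x))"
  using f_smooth unfolding smooth_on_sphere_iff .

lemma C_inf_on_scale: "C_inf_on (- {0}) scale"
  unfolding scale_def[abs_def]
  by (intro C_inf_on_powr C_inf_on_f_sgn f_pos sgn_in_sphere) auto

lemma C_inf_on_unit_lift: "C_inf_on {z. fst z \<noteq> 0 \<and> snd z \<noteq> 0} unit_lift"
proof -
  let ?W = "{z :: quat2. fst z \<noteq> 0 \<and> snd z \<noteq> 0}"
  have W: "open ?W" by (intro open_Collect_conj open_Collect_neq continuous_intros)
  have b: "C_inf_on ?W base" "C_inf_on ?W fibre" unfolding base_def[abs_def] fibre_def[abs_def]
    by (intro C_inf_on_qmult C_inf_on_qinv C_inf_on_bounded_linear bounded_linear_fst bounded_linear_snd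
        C_inf_on_const W; simp)+
  have nz: "base z \<noteq> 0" if "z \<in> ?W" for z using that base_qmult[of z] by (auto simp: qmult_zero_left)
  have "C_inf_on ?W (\<lambda>z. scale (base z))"
    by (rule C_inf_on_compose[OF C_inf_on_scale W _ _ b(1)]) (use nz in auto)
  then show ?thesis unfolding unit_lift_def[abs_def]
    by (intro C_inf_on_Pair C_inf_on_scaleR b W)
qed

lemma has_derivative_unit_lift:
  assumes z: "z \<in> null_cone"
  shows "(unit_lift has_derivative dunit_lift z) (at z)"
proof -
  have nz: "snd z \<noteq> 0" using coneD[OF z] by auto
  note b = base_fibre_unit[OF z]
  have b0: "base z \<noteq> 0" and sb: "sgn (base z) = base z" using b(1) sgn_unit[OF b(1)] by auto
  have fp: "f (base z) > 0" by (rule f_pos[OF b(1)])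
  have d1: "((\<lambda>z. f (sgn (base z))) has_derivative (\<lambda>\<zeta>. sder f (base z) (dbase z \<zeta>))) (at z)"
    using diff_chain_at[OF has_derivative_base[OF nz] sder_works[OF f_smooth b0]] by (simp add: o_def)
  have "((\<lambda>r. r powr (- 1 / 2)) has_derivative (*) (- 1 / 2 * f (base z) powr (- 1 / 2 - 1)))
      (at (f (sgn (base z))))"
    using has_real_derivative_powr[OF fp, of "- 1 / 2"] unfolding has_field_derivative_def sb .
  from diff_chain_at[OF d1 this]
  have "((\<lambda>z. scale (base z)) has_derivative
      (\<lambda>\<zeta>. - 1 / 2 * f (base z) powr (- 1 / 2 - 1) * sder f (base z) (dbase z \<zeta>))) (at z)"
    by (simp add: o_def scale_def)
  moreover have "f (base z) powr (- 1 / 2 - 1) = scale (base z) / f (base z)"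
    using fp sb by (simp only: powr_diff scale_def) simp
  ultimately have "((\<lambda>z. scale (base z)) has_derivative
      (\<lambda>\<zeta>. - (scale (base z) / (2 * f (base z)) * sder f (base z) (dbase z \<zeta>)))) (at z)"
    by (simp add: field_simps)
  from has_derivative_scaleR[OF this has_derivative_fibre[OF nz]]
  have "((\<lambda>z. scale (base z) *\<^sub>R fibre z) has_derivative
    (\<lambda>\<zeta>. scale (base z) *\<^sub>R dfibre z \<zeta> -
      (scale (base z) / (2 * f (base z)) * sder f (base z) (dbase z \<zeta>)) *\<^sub>R fibre z)) (at z)"
    by simp
  from has_derivative_Pair[OF has_derivative_base[OF nz] this] show ?thesis
    unfolding unit_lift_def[abs_def] dunit_lift_def[abs_def] .
qed

lemma dunit_lift_add_self:
  assumes z: "z \<in> null_cone"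
  shows "dunit_lift z (\<zeta> + z *\<^sub>h (c, 0)) = dunit_lift z \<zeta>"
proof -
  have nz: "snd z \<noteq> 0" "base z \<noteq> 0" using coneD[OF z] base_fibre_unit(1)[OF z] by auto
  have lin: "linear (dunit_lift z)" using has_derivative_unit_lift[OF z] has_derivative_linear by blast
  have "dunit_lift z (z *\<^sub>h (c, 0)) = 0"
    using linear_0[OF linear_sder[OF f_smooth nz(2)]]
    by (simp add: dunit_lift_def dbase_dfibre_self[OF nz(1)] zero_prod_def)
  then show ?thesis by (simp add: linear_add[OF lin])
qed

section \<open>The differential of the twistor map\<close>

lemma velocity_twistor_curve:
  assumes W: "open W" "(0::real) \<in> W" "\<forall>t\<in>W. y t \<in> null_cone \<and> \<gamma> t = cline (y t)"
    and y: "(y has_vector_derivative \<zeta>) (at 0)"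
  shows "velocity {chart} (twistor_to_sphere_bundle \<circ> \<gamma>) = (\<lambda>c. if c = chart then dunit_lift (y 0) \<zeta>
      else 0)"
proof -
  have y0: "y 0 \<in> null_cone" "\<gamma> 0 = cline (y 0)" using W by auto
  have ev: "eventually (\<lambda>t. (snd chart \<circ> (twistor_to_sphere_bundle \<circ> \<gamma>)) t = unit_lift (y t)) (nhds 0)"
    using eventually_nhds_in_open[OF W(1,2)]
    by eventually_elim (use W(3) unit_rep_twistor in \<open>auto simp: unit_chart_def\<close>)
  have "((\<lambda>t. unit_lift (y t)) has_vector_derivative dunit_lift (y 0) \<zeta>) (at 0)"
    by (rule has_derivative_along_curve[OF y has_derivative_unit_lift[OF y0(1)]])
  from iffD2[OF has_vector_derivative_cong_nhds[OF ev] this]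
  have "(snd chart \<circ> (twistor_to_sphere_bundle \<circ> \<gamma>) has_vector_derivative dunit_lift (y 0) \<zeta>) (at 0)" .
  then have "vector_derivative (snd chart \<circ> (twistor_to_sphere_bundle \<circ> \<gamma>)) (at 0) = dunit_lift (y 0) \<zeta>"
    by (rule vector_derivative_at)
  moreover have "(twistor_to_sphere_bundle \<circ> \<gamma>) 0 \<in> fst chart"
    using twistor_to_sphere_bundle_in[OF y0(1)] y0(2) by (simp add: unit_chart_def)
  ultimately show ?thesis unfolding velocity_def by (intro ext) simp
qed

lemma twistor_curve:
  assumes W: "open W" "(0::real) \<in> W" "\<forall>t\<in>W. y t \<in> null_cone \<and> \<gamma> t = cline (y t)" and y: "C_inf_on W y"
  shows "twistor_to_sphere_bundle \<circ> \<gamma> \<in> curves_at {chart} ray_space (twistor_to_sphere_bundle (\<gamma> 0))"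
proof -
  have "C_inf_on W (\<lambda>t. unit_lift (y t))"
    by (rule C_inf_on_compose[OF C_inf_on_unit_lift W(1) _ _ y])
      (use W(3) coneD in \<open>auto intro!: open_Collect_conj open_Collect_neq continuous_intros\<close>)
  then have "C_inf_on W (\<lambda>t. unit_rep g ((twistor_to_sphere_bundle \<circ> \<gamma>) t))"
    by (rule C_inf_on_cong[OF W(1), rotated]) (use W(3) unit_rep_twistor in auto)
  then have "smooth_arc (ray_space \<inter> ray_space) (unit_rep g) (twistor_to_sphere_bundle \<circ> \<gamma>)"
    by (rule smooth_arcI[OF W(1,2), rotated]) (use W(3) twistor_to_sphere_bundle_in in auto)
  then show ?thesis by (simp add: curves_at_def unit_chart_def)
qed

text \<open>Lifts of two curves with the same velocity have derivatives that differ by a complex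
  multiple of \<open>z\<close>, and \<open>dunit_lift\<close> vanishes on those. So the image
  velocity does not depend on the curve, as the description in \<open>differential\<close>
  requires.\<close>

lemma differential_twistor:
  assumes z: "z \<in> null_cone" and \<zeta>: "fst z \<bullet> fst \<zeta> = snd z \<bullet> snd \<zeta>"
  shows "differential CP3_atlas twistor_Q {chart} twistor_to_sphere_bundle (cline z) (cvec z \<zeta>) =
    (\<lambda>c. if c = chart then dunit_lift z \<zeta> else 0)" (is "_ = ?Y")
proof -
  have vel: "velocity {chart} (twistor_to_sphere_bundle \<circ> \<gamma>) = ?Y"
    if \<gamma>: "\<gamma> \<in> curves_at CP3_atlas twistor_Q (cline z)" "velocity CP3_atlas \<gamma> = cvec z \<zeta>" for \<gamma>
  proof -
    obtain W y \<eta> where W: "open W" "(0::real) \<in> W" "\<forall>t\<in>W. y t \<in> null_cone \<and> \<gamma> t = cline (y t)"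
      and y: "y 0 = z" "(y has_vector_derivative \<eta>) (at 0)" "velocity CP3_atlas \<gamma> = cvec z \<eta>"
      by (rule curve_lift[OF \<gamma>(1) z])
    have "z \<noteq> 0" using z by simp
    moreover have "cvec z \<eta> = cvec z \<zeta>" using y(3) \<gamma>(2) by simp
    ultimately obtain c where "\<eta> = \<zeta> + z *\<^sub>h (c, 0)" by (rule cvec_eqD)
    then have "dunit_lift (y 0) \<eta> = dunit_lift z \<zeta>" using dunit_lift_add_self[OF z] y(1) by simp
    then show ?thesis using velocity_twistor_curve[OF W y(2)] by (simp cong: if_cong)
  qed
  have "cvec z \<zeta> \<in> tangent CP3_atlas twistor_Q (cline z)" using tangent_twistor_Q[OF z] \<zeta> by blast
  then obtain \<gamma> where "\<gamma> \<in> curves_at CP3_atlas twistor_Q (cline z)" "velocity CP3_atlas \<gamma> = cvec z \<zeta>"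
    unfolding tangent_def by auto
  then show ?thesis unfolding differential_def using vel by (intro the_equality) metis+
qed

section \<open>Smoothness in both directions\<close>

lemma smooth_map_twistor:
  "smooth_map CP3_atlas twistor_Q {chart} ray_space twistor_to_sphere_bundle"
  unfolding smooth_map_def
proof (intro conjI ballI)
  show "twistor_to_sphere_bundle ` twistor_Q \<subseteq> ray_space"
    using twistor_to_sphere_bundle_bij unfolding bij_betw_def by simp
  fix e assume e: "e \<in> twistor_Q"
  obtain z where z: "z \<in> null_cone" "e = cline z" using twistor_QE[OF e] .
  obtain k where k: "k \<in> CP3_coords" "k z \<noteq> 0" using coord_nonzero_exists z(1) by blast
  \<comment> \<open>Chart values are points of the cone, so \<open>unit_lift\<close>, smooth where
    both components are nonzero, is the required smooth extension.\<close>
  let ?W = "{z :: quat2. fst z \<noteq> 0 \<and> snd z \<noteq> 0}"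
  have W: "open ?W" by (intro open_Collect_conj open_Collect_neq continuous_intros)
  have dom: "e \<in> fst (CP3_chart k)" using z k chart_domain by auto
  have *: "snd (CP3_chart k) q \<in> ?W" "twistor_to_sphere_bundle q \<in> ray_space"
      "unit_rep g (twistor_to_sphere_bundle q) = unit_lift (snd (CP3_chart k) q)"
    if "q \<in> fst (CP3_chart k)" "q \<in> twistor_Q" for q
  proof -
    note c = chart_twistor_Q[OF k(1) that]
    show "snd (CP3_chart k) q \<in> ?W" using coneD[OF c(1)] by simp
    show "twistor_to_sphere_bundle q \<in> ray_space"
        by (subst c(2)) (rule twistor_to_sphere_bundle_in[OF c(1)])
    show "unit_rep g (twistor_to_sphere_bundle q) = unit_lift (snd (CP3_chart k) q)"
      by (subst c(2)) (rule unit_rep_twistor[OF c(1)])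
  qed
  show "\<exists>(U, \<phi>)\<in>CP3_atlas. \<exists>(V, \<psi>)\<in>{chart}. \<exists>W h. e \<in> U \<and> twistor_to_sphere_bundle e \<in> V \<and> open W \<and>
      \<phi> e \<in> W \<and> C_inf_on W h \<and> (\<forall>q\<in>U \<inter> twistor_Q. \<phi> q \<in> W \<longrightarrow>
        twistor_to_sphere_bundle q \<in> V \<and> \<psi> (twistor_to_sphere_bundle q) = h (\<phi> q))"
    unfolding case_prod_beta
    by (intro bexI[of _ "CP3_chart k"] bexI[of _ chart] exI[of _ ?W] exI[of _ unit_lift] conjI)
      (use dom * e W C_inf_on_unit_lift CP3_chart_in_atlas[OF k(1)] in \<open>auto simp: unit_chart_def\<close>)
qed

lemma inv_twistor_eq:
  assumes "x \<in> unit_sphere" "v \<bullet> x = 0" "v \<noteq> 0" "snd (lift a (x, v)) \<noteq> 0"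
  shows "inv_into twistor_Q twistor_to_sphere_bundle (x, ray v) = cline (lift a (x, v))"
  using inv_into_f_f[OF twistor_to_sphere_bundle_inj cline_in_twistor_Q[OF lift_correct(1)[OF assms]]]
    lift_correct(2)[OF assms] by simp

lemma C_inf_on_lift: "C_inf_on {p. snd p \<noteq> 0} (lift a)"
proof -
  let ?W = "{p :: quat \<times> quat. snd p \<noteq> 0}"
  have W: "open ?W" by (intro open_Collect_neq continuous_intros)
  have s: "C_inf_on ?W (\<lambda>p. sgn (snd p))"
    by (rule C_inf_on_compose[OF C_inf_on_sgn W _ _ C_inf_on_bounded_linear[OF bounded_linear_snd W]]) auto
  have c: "C_inf_on ?W (\<lambda>p. qconj (fst p))"
    by (intro C_inf_on_linear_compose[OF bounded_linear_qconj W] C_inf_on_bounded_linear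
        bounded_linear_fst W)
  show ?thesis unfolding lift_def case_prod_beta Let_def
    by (intro C_inf_on_Pair C_inf_on_qmult C_inf_on_diff C_inf_on_const C_inf_on_bounded_linear
        bounded_linear_fst W s c)
qed

lemma lift_scaleR: "r > 0 \<Longrightarrow> lift a (x, r *\<^sub>R v) = lift a (x, v)"
  by (simp add: lift_def sgn_scaleR)

lemma smooth_map_inv_twistor:
  "smooth_map {chart} ray_space CP3_atlas twistor_Q (inv_into twistor_Q twistor_to_sphere_bundle)"
  (is "smooth_map _ _ _ _ ?F")
  unfolding smooth_map_def
proof (intro conjI ballI)
  show "?F ` ray_space \<subseteq> twistor_Q"
    using twistor_to_sphere_bundle_bij unfolding bij_betw_def by (metis image_subsetI inv_into_into)
  fix p assume p: "p \<in> ray_space"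
  then obtain x v where xv: "p = (x, ray v)" "x \<in> unit_sphere" "v \<bullet> x = 0" "v \<noteq> 0"
    unfolding sphere_bundle_sphere by blast
  \<comment> \<open>\<open>lift\<close> sees the vector only through \<open>sgn\<close>, so any
    positive multiple may represent the ray, in particular the \<open>g\<close>-unit one.\<close>
  have rep: "lift a (unit_rep g (x, ray v)) = lift a (x, v)" "snd (unit_rep g (x, ray v)) \<noteq> 0"
    if "x \<in> unit_sphere" "v \<bullet> x = 0" "v \<noteq> 0" for x v a
    unfolding unit_rep_eq[OF that] using scale_pos[OF that(1)] that(3)
    by (simp_all add: sgn_div_norm lift_scaleR del: scaleR_scaleR)
  obtain a where a: "snd (lift a (x, v)) \<noteq> 0" using lift_exists .
  then have "lift a (x, v) \<noteq> 0" by auto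
  then obtain k where k: "k \<in> CP3_coords" "k (lift a (x, v)) \<noteq> 0" using coord_nonzero_exists by blast
  have nz: "open {p :: quat \<times> quat. snd p \<noteq> 0}" by (intro open_Collect_neq continuous_intros)
  have lk: "C_inf_on {p. snd p \<noteq> 0} (\<lambda>p. k (lift a p))" "C_inf_on {p. snd p \<noteq> 0} (\<lambda>p. snd (lift a p))"
    by (intro C_inf_on_linear_compose[OF _ nz C_inf_on_lift] bounded_linear_coord k bounded_linear_snd)+
  \<comment> \<open>The seed \<open>a\<close> and the coordinate \<open>k\<close> are adapted to the
    given point; \<open>W\<close> is the open set where both remain usable.\<close>
  define W where "W = ({p. snd p \<noteq> 0} \<inter> (\<lambda>p. k (lift a p)) -` (- {0})) \<inter>
    ({p. snd p \<noteq> 0} \<inter> (\<lambda>p. snd (lift a p)) -` (- {0}))"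
  have W: "open W" unfolding W_def
    by (intro open_Int[of "_ \<inter> _"] continuous_open_preimage C_inf_on_continuous lk nz) auto
  define h where "h p = lift a p *\<^sub>h (inverse (k (lift a p)), 0)" for p
  have sub: "C_inf_on W (\<lambda>p. lift a p)" "C_inf_on W (\<lambda>p. k (lift a p))"
    by (rule C_inf_on_subset[OF C_inf_on_lift] C_inf_on_subset[OF lk(1)]; auto simp: W_def)+
  have h: "C_inf_on W h" unfolding h_def
    by (rule C_inf_on_bilinear[OF bounded_bilinear_rmult W sub(1) C_inf_on_Pair[OF W
        C_inf_on_inverse[OF W sub(2)] C_inf_on_const[OF W]]])
      (auto simp: W_def)
  have *: "?F q \<in> fst (CP3_chart k)" "snd (CP3_chart k) (?F q) = h (unit_rep g q)"
    if q: "q \<in> ray_space" "unit_rep g q \<in> W" for q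
  proof -
    obtain x v where xv: "q = (x, ray v)" "x \<in> unit_sphere" "v \<bullet> x = 0" "v \<noteq> 0"
      using q(1) unfolding sphere_bundle_sphere by blast
    have n: "k (lift a (x, v)) \<noteq> 0" "snd (lift a (x, v)) \<noteq> 0"
      using q(2) rep(1)[OF xv(2-4)] unfolding W_def xv(1) by auto
    note F = inv_twistor_eq[OF xv(2-4) n(2)]
    show "?F q \<in> fst (CP3_chart k)" unfolding xv(1) F using chart_domain[OF k(1) coord_nonzero[OF
        k(1) n(1)]] n(1) by simp
    show "snd (CP3_chart k) (?F q) = h (unit_rep g q)"
      unfolding xv(1) F chart_value[OF k(1) n(1)] h_def rep(1)[OF xv(2-4)] ..
  qed
  have pW: "unit_rep g p \<in> W" unfolding W_def xv(1) using rep[OF xv(2-4)] a k(2) by simp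
  show "\<exists>(U, \<phi>)\<in>{chart}. \<exists>(V, \<psi>)\<in>CP3_atlas. \<exists>W h. p \<in> U \<and> ?F p \<in> V \<and> open W \<and>
      \<phi> p \<in> W \<and> C_inf_on W h \<and> (\<forall>q\<in>U \<inter> ray_space. \<phi> q \<in> W \<longrightarrow> ?F q \<in> V \<and> \<psi> (?F q) = h (\<phi> q))"
    unfolding case_prod_beta
    by (intro bexI[of _ chart] bexI[of _ "CP3_chart k"] exI[of _ W] exI[of _ h] conjI)
      (use p * pW W h CP3_chart_in_atlas[OF k(1)] in \<open>auto simp: unit_chart_def\<close>)
qed

section \<open>Comparison of the Levi distributions and their complex structures\<close>

lemma levi_tangent_inner:
  assumes z: "z \<in> null_cone"
    and \<zeta>: "fst z \<bullet> fst \<zeta> = snd z \<bullet> snd \<zeta>" "fst z \<bullet> (fst \<zeta> *\<^sub>q qi) = snd z \<bullet> (snd \<zeta> *\<^sub>q qi)"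
  shows "dbase z \<zeta> \<bullet> base z = 0" "dbase z \<zeta> \<bullet> fibre z = 0" "dfibre z \<zeta> \<bullet> fibre z = 0"
      "dfibre z \<zeta> \<bullet> base z = 0"
  using dbase_dfibre_inner[OF z, of \<zeta>] \<zeta> coneD[OF z] by auto

text \<open>The contact condition of the sphere bundle is the second Levi equation of Q: the factors
  contributed by \<open>f\<close>, \<open>scale\<close> and |z2|^2 are positive and drop
  out.\<close>

lemma metric_unit_lift:
  assumes z: "z \<in> null_cone" and \<zeta>: "fst z \<bullet> fst \<zeta> = snd z \<bullet> snd \<zeta>"
  shows "g (base z) (dbase z \<zeta>) (snd (unit_lift z)) = 0 \<longleftrightarrow> fst z \<bullet> (fst \<zeta> *\<^sub>q qi) = snd z \<bullet> (snd \<zeta> *\<^sub>q qi)"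
proof -
  note b = base_fibre_unit[OF z] and d = dbase_dfibre_inner[OF z, of \<zeta>] and nz = coneD[OF z]
  have "dbase z \<zeta> \<bullet> base z = 0" using d(1) \<zeta> nz by simp
  then have "g (base z) (dbase z \<zeta>) (snd (unit_lift z)) = f (base z) * (scale (base z) * (dbase z \<zeta>
      \<bullet> fibre z))"
    using g_eq[OF b(1), of "dbase z \<zeta>" "snd (unit_lift z)"] b(3) by (simp add: unit_lift_def)
  then have "g (base z) (dbase z \<zeta>) (snd (unit_lift z)) = 0 \<longleftrightarrow> dbase z \<zeta> \<bullet> fibre z = 0"
    using f_pos[OF b(1)] scale_pos[OF b(1)] by simp
  also have "\<dots> \<longleftrightarrow> fst z \<bullet> (fst \<zeta> *\<^sub>q qi) = snd z \<bullet> (snd \<zeta> *\<^sub>q qi)"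
    using d(2) nz by auto
  finally show ?thesis .
qed

text \<open>On the Levi distribution the cross product with the unit vector is right multiplication
  by p, for the horizontal and the vertical part alike, so both can be compared with
  \<open>\<zeta>\<close> replaced by \<open>\<zeta> *\<^sub>h qi\<close>.\<close>

lemma sphere_bundle_J_unit_lift:
  assumes z: "z \<in> null_cone"
    and \<zeta>: "fst z \<bullet> fst \<zeta> = snd z \<bullet> snd \<zeta>" "fst z \<bullet> (fst \<zeta> *\<^sub>q qi) = snd z \<bullet> (snd \<zeta> *\<^sub>q qi)"
  shows "sphere_bundle_J unit_sphere g S3_orientation (unit_lift z) (dunit_lift z \<zeta>)
      = dunit_lift z (\<zeta> *\<^sub>h qi)"
proof -
  note b = base_fibre_unit[OF z] and i = levi_tangent_inner[OF assms]
  have nz: "snd z \<noteq> 0" "base z \<noteq> 0" using coneD[OF z] b(1) by auto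
  note tw = twist_unit_imaginary[OF nz(1)]
  define x where "x = base z"
  define V where "V = fibre z"
  define p where "p = twist z"
  define s where "s = scale x"
  define w where "w = dbase z \<zeta>"
  define v where "v = dfibre z \<zeta>"
  define df where "df = sder f x"
  \<comment> \<open>The vertical part: subtracting the horizontal lift of \<open>w\<close> cancels
    the term with df(w) that came from rescaling and leaves the one with df(V), a multiple of
    \<open>w\<close>.\<close>
  define u where "u = s *\<^sub>R v + (df V * s / (2 * f x)) *\<^sub>R w"
  have V: "V = x *\<^sub>q p" unfolding V_def x_def p_def by (rule fibre_twist[OF nz(1)])
  have x: "x \<in> unit_sphere" using b(1) x_def by simp
  have s: "s > 0" "f x * s\<^sup>2 = 1" "f x > 0" unfolding s_def using scale_pos scale_square f_pos x by auto
  have w: "w \<bullet> x = 0" "w \<bullet> V = 0" and v: "v \<bullet> x = 0" "v \<bullet> V = 0" and Vx: "V \<bullet> x = 0"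
    unfolding w_def v_def x_def V_def by (fact i b)+
  have u: "u \<bullet> x = 0" "u \<bullet> V = 0" using w v by (simp_all add: u_def inner_add_left)
  have lin: "linear df" unfolding df_def using linear_sder[OF f_smooth] nz(2) x_def by simp
  have wp: "(w *\<^sub>q p) \<bullet> x = 0" "(w *\<^sub>q p) \<bullet> V = 0"
    using inner_qmult_imaginary(2)[OF tw, of w x] w inner_qmult_cancel_right[of w p x] tw(2)
    unfolding V p_def[symmetric] by simp_all
  have cross: "cross_product unit_sphere g S3_orientation x (s *\<^sub>R V) y = y *\<^sub>q p"
    if "y \<bullet> x = 0" "y \<bullet> V = 0" for y
    unfolding V
    by (rule cross_product_sphere[OF _ s(3,1,2) x tw[folded p_def]])
      (use that g_eq[OF x] V in auto)
  have hl: "horizontal_lift unit_sphere g x (s *\<^sub>R V) y =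
      (y, - ((1 / (2 * f x)) *\<^sub>R ((df y * s) *\<^sub>R V + (df V * s) *\<^sub>R y)))"
    if "y \<bullet> x = 0" "y \<bullet> V = 0" for y
  proof -
    have sV: "(s *\<^sub>R V) \<bullet> x = 0" using Vx by simp
    have "horizontal_lift unit_sphere g x (s *\<^sub>R V) y = (y, - ((y \<bullet> s *\<^sub>R V) *\<^sub>R x +
      (1 / (2 * f x)) *\<^sub>R (sder f x y *\<^sub>R s *\<^sub>R V + sder f x (s *\<^sub>R V) *\<^sub>R y - (y \<bullet> s *\<^sub>R V) *\<^sub>R
          sgrad f x)))"
      by (rule horizontal_lift_sphere[OF f_smooth _ _ x sV that(1)]) (fact f_pos g_eq)+
    then show ?thesis using that(2) linear_scale[OF lin, of s V] by (simp add: df_def mult.commute)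
  qed
  have ul: "unit_lift z = (x, s *\<^sub>R V)" by (simp add: unit_lift_def x_def s_def V_def)
  have d: "dunit_lift z \<zeta> = (w, s *\<^sub>R v - (s / (2 * f x) * df w) *\<^sub>R V)"
    by (simp add: dunit_lift_def x_def s_def V_def w_def v_def df_def)
  have di: "dunit_lift z (\<zeta> *\<^sub>h qi) = (w *\<^sub>q p, s *\<^sub>R (v *\<^sub>q p) - (s / (2 * f x) * df (w *\<^sub>q p)) *\<^sub>R V)"
    by (simp add: dunit_lift_def dbase_dfibre_qi[OF nz(1)] x_def s_def V_def w_def v_def df_def p_def)
  have h: "fst (dunit_lift z \<zeta>) = w" "snd (dunit_lift z \<zeta> - horizontal_lift unit_sphere g x (s *\<^sub>R
      V) w) = u"
    unfolding d hl[OF w] u_def by (simp_all add: scaleR_add_right field_simps)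
  have "sphere_bundle_J unit_sphere g S3_orientation (unit_lift z) (dunit_lift z \<zeta>) =
      horizontal_lift unit_sphere g x (s *\<^sub>R V) (w *\<^sub>q p) + (0, u *\<^sub>q p)"
    by (simp only: sphere_bundle_J_def ul prod.case Let_def h cross[OF w] cross[OF u])
  also have "\<dots> = dunit_lift z (\<zeta> *\<^sub>h qi)"
    \<comment> \<open>The df(V)-term of the horizontal lift of w p cancels the one in u p, while its
      df-term in the direction w p is the rescaling term of the new vector.\<close>
    unfolding hl[OF wp] di u_def qmult_add_left qmult_scaleR_left by (simp add: scaleR_add_right mult_ac)
  finally show ?thesis .
qed

lemma levi_sphere_bundle:
  assumes z: "z \<in> null_cone" and \<zeta>: "fst z \<bullet> fst \<zeta> = snd z \<bullet> snd \<zeta>"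
    and Y: "Y = (\<lambda>c. if c = chart then dunit_lift z \<zeta> else 0)"
      "Y \<in> tangent {chart} ray_space (twistor_to_sphere_bundle (cline z))"
  shows "Y \<in> levi (sphere_bundle_CR unit_sphere g S3_orientation) (twistor_to_sphere_bundle (cline z)) \<longleftrightarrow>
    fst z \<bullet> (fst \<zeta> *\<^sub>q qi) = snd z \<bullet> (snd \<zeta> *\<^sub>q qi)"
proof -
  have "fst (twistor_to_sphere_bundle (cline z)) = base z"
      by (simp add: twistor_to_sphere_bundle_cline[OF z])
  moreover have "fst (Y chart) = dbase z \<zeta>" by (simp add: Y(1) dunit_lift_def)
  ultimately show ?thesis
    using Y(2) metric_unit_lift[OF z \<zeta>] unit_rep_twistor[OF z] by (simp add: sphere_bundle_CR_def)
qed

lemma cr_isomorphism_twistor: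
  "cr_isomorphism Q_CR (sphere_bundle_CR unit_sphere g S3_orientation) twistor_to_sphere_bundle"
proof -
  let ?F = twistor_to_sphere_bundle and ?D = "sphere_bundle_CR unit_sphere g S3_orientation"
  let ?tv = "\<lambda>\<xi> c. if c = chart then \<xi> else 0"
  have sel: "points Q_CR = twistor_Q" "atlas Q_CR = CP3_atlas" "points ?D = ray_space" "atlas ?D = {chart}"
    "cstr Q_CR e = CP3_J" for e by (simp_all add: Q_CR_def sphere_bundle_CR_def)
  have fibre: "dF ` levi Q_CR e = levi ?D (?F e) \<and>
      (\<forall>X\<in>levi Q_CR e. \<forall>Y\<in>levi Q_CR e. dF (\<lambda>c. X c + Y c) = (\<lambda>c. dF X c + dF Y c)) \<and>
      (\<forall>X\<in>levi Q_CR e. \<forall>r. dF (\<lambda>c. r *\<^sub>R X c) = (\<lambda>c. r *\<^sub>R dF X c)) \<and>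
      (\<forall>X\<in>levi Q_CR e. dF (CP3_J X) = cstr ?D (?F e) (dF X))"
    (is "?image \<and> ?add \<and> ?scale \<and> ?J")
    if e: "e \<in> twistor_Q" and dFe: "dF = differential CP3_atlas twistor_Q {chart} ?F e" for e dF
  proof -
    obtain z where z: "z \<in> null_cone" "e = cline z" using twistor_QE[OF e] .
    have z0: "z \<noteq> 0" using z(1) by simp
    have lin: "linear (dunit_lift z)" using has_derivative_unit_lift[OF z(1)] has_derivative_linear by blast
    have D: "dF (cvec z \<zeta>) = ?tv (dunit_lift z \<zeta>)" if "fst z \<bullet> fst \<zeta> = snd z \<bullet> snd \<zeta>" for \<zeta>
      unfolding dFe z(2) by (rule differential_twistor[OF z(1) that])
    note L = levi_Q[OF z(1), folded z(2)]
    \<comment> \<open>Tangency of the image needs a curve that realizes it: the image of a curve in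
      Q. The Levi condition is then the second equation for \<open>\<zeta>\<close>.\<close>
    have img: "dF X \<in> levi ?D (?F e)" if X: "X \<in> levi Q_CR e" for X
    proof -
      have "X \<in> tangent CP3_atlas twistor_Q e" using X by (simp add: Q_CR_def)
      then obtain \<gamma> where \<gamma>: "\<gamma> \<in> curves_at CP3_atlas twistor_Q (cline z)" "X = velocity CP3_atlas \<gamma>"
        unfolding tangent_def z(2) by auto
      obtain W y \<eta> where W: "open W" "(0::real) \<in> W" "\<forall>t\<in>W. y t \<in> null_cone \<and> \<gamma> t = cline (y t)"
        and y: "C_inf_on W y" "y 0 = z" "(y has_vector_derivative \<eta>) (at 0)" "velocity CP3_atlas \<gamma>
            = cvec z \<eta>"
        by (rule curve_lift[OF \<gamma>(1) z(1)])
      obtain \<zeta> where \<zeta>: "X = cvec z \<zeta>" "fst z \<bullet> fst \<zeta> = snd z \<bullet> snd \<zeta>"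
          "fst z \<bullet> (fst \<zeta> *\<^sub>q qi) = snd z \<bullet> (snd \<zeta> *\<^sub>q qi)"
        using X L by blast
      have "cvec z \<eta> = cvec z \<zeta>" using \<gamma>(2) y(4) \<zeta>(1) by simp
      from cvec_eqD[OF z0 this] have "dunit_lift (y 0) \<eta> = dunit_lift z \<zeta>"
        using dunit_lift_add_self[OF z(1)] y(2) by metis
      then have v: "velocity {chart} (?F \<circ> \<gamma>) = ?tv (dunit_lift z \<zeta>)"
        using velocity_twistor_curve[OF W y(3)] by (simp cong: if_cong)
      have c: "?F \<circ> \<gamma> \<in> curves_at {chart} ray_space (?F (cline z))"
        using twistor_curve[OF W y(1)] W(2,3) y(2) by auto
      have "?tv (dunit_lift z \<zeta>) \<in> tangent {chart} ray_space (?F (cline z))"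
        using imageI[OF c, of "velocity {chart}"] unfolding tangent_def v .
      from levi_sphere_bundle[OF z(1) \<zeta>(2) refl this] show ?thesis
        unfolding \<zeta>(1) D[OF \<zeta>(2)] z(2) using \<zeta>(3) by simp
    qed
    \<comment> \<open>A curve that represents the given Levi vector is pulled back by the smooth
      inverse; a lift of the pulled-back curve provides \<open>\<zeta>\<close>.\<close>
    have surj: "\<exists>X\<in>levi Q_CR e. Y = dF X" if Y: "Y \<in> levi ?D (?F e)" for Y
    proof -
      have Yt: "Y \<in> tangent {chart} ray_space (?F (cline z))" using Y z(2)
          by (simp add: sphere_bundle_CR_def)
      then obtain \<delta> where \<delta>: "\<delta> \<in> curves_at {chart} ray_space (?F e)" "Y = velocity {chart} \<delta>"
        unfolding tangent_def z(2) by auto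
      let ?\<gamma> = "inv_into twistor_Q ?F \<circ> \<delta>"
      have "?\<gamma> \<in> curves_at CP3_atlas twistor_Q (inv_into twistor_Q ?F (?F e))"
        using smooth_map_curve[OF smooth_map_inv_twistor[unfolded unit_chart_def] \<delta>(1)[unfolded
            unit_chart_def]] .
      then have \<gamma>: "?\<gamma> \<in> curves_at CP3_atlas twistor_Q (cline z)"
        using inv_into_f_f[OF twistor_to_sphere_bundle_inj e] z(2) by simp
      obtain W y \<zeta> where W: "open W" "(0::real) \<in> W" "\<forall>t\<in>W. y t \<in> null_cone \<and> ?\<gamma> t = cline (y t)"
        and y: "y 0 = z" "(y has_vector_derivative \<zeta>) (at 0)"
        by (rule curve_lift[OF \<gamma> z(1)])
      have \<zeta>: "fst z \<bullet> fst \<zeta> = snd z \<bullet> snd \<zeta>"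
        using cone_curve_derivative[OF W(1,2) _ y(2)] W(3) y(1) by auto
      have "smooth_arc (ray_space \<inter> ray_space) (unit_rep g) \<delta>" using \<delta>(1)
          by (simp add: curves_at_def unit_chart_def)
      then obtain \<epsilon> where \<epsilon>: "\<epsilon> > 0" "\<forall>t\<in>{-\<epsilon><..<\<epsilon>}. \<delta> t \<in> ray_space \<inter> ray_space"
        unfolding smooth_arc_def by (elim exE conjE)
      \<comment> \<open>The arc is known to lie in the sphere bundle only near 0; agreement near 0
        is enough for equal velocities.\<close>
      have "eventually (\<lambda>t. (?F \<circ> ?\<gamma>) t = \<delta> t) (nhds 0)"
        using eventually_nhds_interval[OF \<epsilon>(1)]
      proof eventually_elim
        case (elim t)
        then have "\<delta> t \<in> ?F ` twistor_Q" using \<epsilon>(2) twistor_to_sphere_bundle_bij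
            unfolding bij_betw_def by simp
        from f_inv_into_f[OF this] show ?case by simp
      qed
      from velocity_cong[OF this, of "{chart}", symmetric] have Yd: "Y = ?tv (dunit_lift z \<zeta>)"
        using velocity_twistor_curve[OF W y(2)] unfolding \<delta>(2) y(1) by (rule trans)
      have "fst z \<bullet> (fst \<zeta> *\<^sub>q qi) = snd z \<bullet> (snd \<zeta> *\<^sub>q qi)"
        using levi_sphere_bundle[OF z(1) \<zeta> Yd Yt] Y z(2) by simp
      then have "cvec z \<zeta> \<in> levi Q_CR e" using L \<zeta> by blast
      then show ?thesis using D[OF \<zeta>] Yd by (intro bexI[of _ "cvec z \<zeta>"]) simp
    qed
    have ?image using img surj by blast
    moreover have ?add
    proof (intro ballI)
      fix X Y assume "X \<in> levi Q_CR e" "Y \<in> levi Q_CR e"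
      then obtain \<zeta> \<eta> where \<zeta>: "X = cvec z \<zeta>" "fst z \<bullet> fst \<zeta> = snd z \<bullet> snd \<zeta>"
        and \<eta>: "Y = cvec z \<eta>" "fst z \<bullet> fst \<eta> = snd z \<bullet> snd \<eta>" using L by blast
      have "fst z \<bullet> fst (\<zeta> + \<eta>) = snd z \<bullet> snd (\<zeta> + \<eta>)" using \<zeta>(2) \<eta>(2) by (simp add: inner_add_right)
      from D[OF this] show "dF (\<lambda>c. X c + Y c) = (\<lambda>c. dF X c + dF Y c)"
        unfolding \<zeta>(1) \<eta>(1) cvec_add[OF z0, symmetric] D[OF \<zeta>(2)] D[OF \<eta>(2)]
        by (simp add: linear_add[OF lin] fun_eq_iff)
    qed
    moreover have ?scale
    proof (intro ballI allI)
      fix X and r :: real assume "X \<in> levi Q_CR e"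
      then obtain \<zeta> where \<zeta>: "X = cvec z \<zeta>" "fst z \<bullet> fst \<zeta> = snd z \<bullet> snd \<zeta>" using L by blast
      have "fst z \<bullet> fst (r *\<^sub>R \<zeta>) = snd z \<bullet> snd (r *\<^sub>R \<zeta>)" using \<zeta>(2) by simp
      from D[OF this] show "dF (\<lambda>c. r *\<^sub>R X c) = (\<lambda>c. r *\<^sub>R dF X c)"
        unfolding \<zeta>(1) cvec_scaleR[OF z0, symmetric] D[OF \<zeta>(2)]
        by (simp add: linear_scale[OF lin] fun_eq_iff)
    qed
    moreover have ?J
    proof
      fix X assume "X \<in> levi Q_CR e"
      then obtain \<zeta> where \<zeta>: "X = cvec z \<zeta>" "fst z \<bullet> fst \<zeta> = snd z \<bullet> snd \<zeta>"
        "fst z \<bullet> (fst \<zeta> *\<^sub>q qi) = snd z \<bullet> (snd \<zeta> *\<^sub>q qi)" using L by blast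
      have "fst z \<bullet> fst (\<zeta> *\<^sub>h qi) = snd z \<bullet> snd (\<zeta> *\<^sub>h qi)" using \<zeta>(3) by (simp add: rmult_def)
      from D[OF this] show "dF (CP3_J X) = cstr ?D (?F e) (dF X)"
        unfolding \<zeta>(1) CP3_J_cvec[OF z0] D[OF \<zeta>(2)]
        using sphere_bundle_J_unit_lift[OF z(1) \<zeta>(2,3)] unit_rep_twistor[OF z(1)] z(2)
        by (simp add: sphere_bundle_CR_def fun_eq_iff)
    qed
    ultimately show ?thesis by blast
  qed
  show ?thesis
    unfolding cr_isomorphism_def Let_def sel
    using twistor_to_sphere_bundle_bij smooth_map_twistor smooth_map_inv_twistor fibre[OF _ refl] by blast
qed

end

text \<open>Chart, Levi distribution and complex structure of the sphere bundle are all written with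
  \<open>g\<close>. That the same bijection serves every \<open>g\<close> of the class shows that
  the CR structure depends on the conformal class alone.\<close>

theorem proposition2p1:
  fixes g :: "quat metric_tensor"
  assumes "g \<in> conformal_class unit_sphere round_metric"
  shows "cr_isomorphism Q_CR (sphere_bundle_CR unit_sphere g S3_orientation)
    twistor_to_sphere_bundle"
proof -
  obtain f where f: "smooth_on unit_sphere f" "\<forall>x\<in>unit_sphere. f x > 0"
    "\<forall>x\<in>unit_sphere. \<forall>u\<in>tspace unit_sphere x. \<forall>v\<in>tspace unit_sphere x. g x u v = f x * round_metric x u v"
    using assms unfolding conformal_class_def by blast
  interpret conformal_sphere f g
  proof
    fix x u v :: quat assume x: "x \<in> unit_sphere"
    show "f x > 0" using f(2) x by blast
    assume "u \<bullet> x = 0" "v \<bullet> x = 0"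
    then show "g x u v = f x * (u \<bullet> v)"
      using f(3) x tspace_sphere[OF x] unfolding round_metric_def by blast
  qed (rule f(1))
  show ?thesis by (rule cr_isomorphism_twistor)
qed

end
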